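(* Consider the problem $\min_{x\in\Omega} f(x)=\frac1n\sum_{i=1}^n f_i(x)$ with $f_i(x)=\mathbb{E}_{\xi_i}[F_i(x,\xi_i)]$, and suppose that Assumptions (A1)--(A6) listed in the context hold. For a horizon $T\ge 1$ let $\{x_{i,k}\}$ be generated by the algorithm Com-DSZO (described in the context) with parameters $\mu=1/\sqrt{T}$, $\epsilon=\mu/(2\underline{R})$, $\psi\in(0,r^{-1}]$, $\eta_k=\frac{1}{M_1\sqrt{k+c}}$, where $M_1=\left(5+\frac{10}{n}\right)4dL_m$ and $c>4$, and $\gamma>0$ satisfying $\gamma<\min\{1,\delta\kappa_1^{-1},c_0\kappa_2^{-1}\}$. Let the contraction factor (see the context) be $\kappa_0=1-c_0$ with $c_0=\frac{\psi r\omega}{2}$. Then for any optimal point $x^*\in\Omega$, with $\bar x_k=\frac1n\sum_{i=1}^nx_{i,k}$, $$\sum_{k=1}^T\mathbb{E}\big[f(\bar x_k)-f(x^* )\big]\le\mathcal O\left(\frac{d^2\sqrt{T+c}}{(\psi r\omega)^2}\right).$$ Under high compression fidelity ($\omega\to1$, $\psi r\to1$, so that $\psi r\omega\approx1$), this yields $\sum_{k=1}^T\mathbb{E}[f(\bar x_k)-f(x^* )]<\mathcal O(\sqrt{T+c})$.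
   Context: Setting. There are $n$ agents $\mathcal V=\{1,\dots,n\}$; $\Omega\subseteq\mathbb{R}^d$; $\xi_i$ is a random sample from an unknown distribution $\mathcal P_i$; $F_i(\cdot,\xi_i)$ is real-valued and $f_i(x)=\mathbb{E}_{\xi_i}[F_i(x,\xi_i)]$. $\mathcal N_i$ is the set of agents with which $i$ interacts (including $i$ itself in the sums below), and $\mathbf W\in\mathbb{R}^{n\times n}$ is the weight matrix of the communication graph $\mathcal G$ ($\mathbf W_{i,j}=0$ for $j\notin\mathcal N_i$). Assumptions. (A1) $\mathcal G$ is undirected, connected and balanced, so $\mathbf W$ is doubly stochastic; $\mathbf W^{\mathsf T}=\mathbf W$; $\mathrm{null}(\mathbf I-\mathbf W)=\mathrm{span}(\mathbf 1)$; $\mathbf I+\mathbf W\succ0$. Write $\mathbf H=\frac1n\mathbf 1\mathbf 1^{\mathsf T}$; the spectral gap $\delta\in(0,1]$ is defined by $\|\mathbf W-\mathbf H\|_2=1-\delta$, and $\beta=\|\mathbf I-\mathbf W\|_2\in(0,2)$. (A2) $\Omega$ is closed and convex, and there are $\bar R,\underline R>0$ such that $\Omega$ contains the Euclidean ball of radius $\underline R$ centered at $0$ and is contained in the ball of radius $\bar R$ centered at $0$. (A3) For each $i$, $F_i(x,\xi_i)$ is convex and $L_f$-Lipschitz continuous in $x$ on $\Omega$, with $L_f>0$. (A4) There is $\hat\sigma>0$ with $\mathbb{E}_{\xi_i}[\|\nabla_xF_i(x,\xi_i)-\nabla f_i(x)\|^2]\le\hat\sigma^2$ for all $x\in\Omega$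 and all $i$. (A5) The (possibly random) compressor $\mathcal C:\mathbb{R}^d\to\mathbb{R}^d$ is such that, for a scaling factor $r\ge1$, $\mathcal C_r(x)=\frac1r\mathcal C(x)$ satisfies $\mathbb{E}_{\mathcal C}[\|\mathcal C_r(x)-x\|^2]\le(1-\omega)\|x\|^2$ for all $x\in\mathbb{R}^d$, where $\omega\in(0,1]$ and the expectation is over the internal randomness of $\mathcal C$. (A6) Each $f_i$ has $L_m$-Lipschitz gradient: $\|\nabla f_i(x)-\nabla f_i(y)\|\le L_m\|x-y\|$ for all $x,y\in\Omega$. Algorithm Com-DSZO. Inputs $\eta_k,\mu,\epsilon,\psi,\gamma$; $\Omega_\epsilon=\{(1-\epsilon)x: x\in\Omega\}$; $\Pi_{\Omega_\epsilon}$ is Euclidean projection. Initialize $x_{i,0}\in\Omega$, $\hat x_{i,0}=b_{i,0}=\mathbf 0_d$, $q_{i,0}=\mathcal C(x_{i,0})$. For $k=0,1,\dots$ each agent $i$ draws a fresh $u_{i,k}$ uniformly from the unit sphere of $\mathbb{R}^d$ and a fresh sample $\xi_{i,k}\sim\mathcal P_i$, forms $\mathbf g_i^\mu(x_{i,k})=\frac d\mu\big(F_i(x_{i,k}+\mu u_{i,k},\xi_{i,k})-F_i(x_{i,k},\xi_{i,k})\big)u_{i,k}$, and sets $\hat x_{i,k+1}=\hat x_{i,k}+\psi q_{i,k}$; $b_{i,k+1}=b_{i,k}+\psi\big(q_{i,k}-\sum_{j\in\mathcal N_i}\mathbf W_{i,j}q_{j,k}\big)$; $x_{i,k+1}=\Pi_{\Omega_\epsilon}[x_{i,k}-\gamma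 b_{i,k+1}-\eta_k\mathbf g_i^\mu(x_{i,k})]$; $q_{i,k+1}=\mathcal C(x_{i,k+1}-\hat x_{i,k+1})$. Constants. $c_0=\frac{\psi r\omega}{2}$; $\kappa_1=\frac\delta4+2(1+c_0^{-1})^2\gamma\beta^2$; $\kappa_2=(1+c_0^{-1})^2\gamma\beta^2+(1+\frac2\delta)\beta^2$ (so the condition on $\gamma$ is implicit in $\gamma$). Contraction factor. Let $\mathbf X_k,\widehat{\mathbf X}_k,\mathbf G_k^\mu\in\mathbb{R}^{n\times d}$ have rows $x_{i,k}^{\mathsf T},\hat x_{i,k}^{\mathsf T},\mathbf g_i^\mu(x_{i,k})^{\mathsf T}$, let $\overline{\mathbf X}_k=\mathbf H\mathbf X_k$, and $\mathbf e_k=\mathbb{E}[\|\mathbf X_k-\overline{\mathbf X}_k\|_F^2+\|\widehat{\mathbf X}_{k+1}-\mathbf X_k\|_F^2]$. The contraction factor $\kappa_0$ is the constant in the error recursion $\mathbf e_{k+1}\le\kappa_0\mathbf e_k+\mathbf C_3\eta_k^2\mathbb{E}[\|\mathbf G_k^\mu\|_F^2]$, $k\ge0$, where $\mathbf C_3=4(1+\frac{\gamma\delta}2)(1+\frac2{\gamma\delta})+2(1+c_0^{-1})(1+c_0)(1-\psi r\omega)$. $\beta(k)=\mathcal O(\alpha(k))$ means $\limsup_{k\to\infty}\beta(k)/\alpha(k)<+\infty$ (here in the variable $T$).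
   Formalization: Assumption (A3) is required on some convex open neighbourhood of Ω, the same for all samples, instead of only on Ω, because the algorithm queries F_i at points x+μu outside Ω, where the claim can fail if F_i is arbitrary there. *)

theory Defs
  imports "HOL-Probability.Probability"
begin

text \<open>
  Agents are the elements of a finite type \<open>'n\<close>, so that \<open>n = CARD('n)\<close>; the decision space is a
  Euclidean space \<open>'a\<close>, so that \<open>d = DIM('a)\<close>.  An \<open>n \<times> d\<close> matrix whose rows are indexed by the
  agents is an element of \<^typ>\<open>'a ^ 'n\<close>; its norm is the Frobenius norm.
\<close>

definition matrix_action :: "real ^ 'n ^ 'n \<Rightarrow> 'a::real_vector ^ 'n \<Rightarrow> 'a ^ 'n" where
  "matrix_action A X = (\<chi> i. \<Sum>j\<in>UNIV. (A $ i $ j) *\<^sub>R (X $ j))"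

definition H_mat :: "real ^ 'n ^ 'n" where
  "H_mat = (\<chi> i j. 1 / real CARD('n))"

definition row_mean :: "'a::real_vector ^ 'n \<Rightarrow> 'a" where
  "row_mean X = (1 / real CARD('n)) *\<^sub>R (\<Sum>i\<in>UNIV. X $ i)"

definition spectral_norm :: "real ^ 'n ^ 'n \<Rightarrow> real" where
  "spectral_norm A = onorm (\<lambda>v. A *v v)"

definition spectral_gap :: "real ^ 'n ^ 'n \<Rightarrow> real" where
  "spectral_gap W = 1 - spectral_norm (W - H_mat)"

definition beta_const :: "real ^ 'n ^ 'n \<Rightarrow> real" where
  "beta_const W = spectral_norm (mat 1 - W)"

text \<open>\<open>N i\<close> is the set of neighbours of \<open>i\<close>, with \<open>i\<close> itself included.\<close>

definition assumption_A1 :: "('n \<Rightarrow> 'n set) \<Rightarrow> real ^ 'n ^ 'n \<Rightarrow> bool" where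
  "assumption_A1 N W \<longleftrightarrow>
     (\<forall>i. i \<in> N i) \<and> (\<forall>i j. j \<in> N i \<longleftrightarrow> i \<in> N j) \<and>
     (\<forall>i j. (i, j) \<in> {(a, b). b \<in> N a}\<^sup>*) \<and>
     (\<forall>i j. j \<notin> N i \<longrightarrow> W $ i $ j = 0) \<and>
     (\<forall>i j. 0 \<le> W $ i $ j) \<and>
     (\<forall>i. (\<Sum>j\<in>UNIV. W $ i $ j) = 1) \<and> (\<forall>j. (\<Sum>i\<in>UNIV. W $ i $ j) = 1) \<and>
     transpose W = W \<and>
     {v. (mat 1 - W) *v v = 0} = span {1} \<and>
     (\<forall>v. v \<noteq> 0 \<longrightarrow> v \<bullet> ((mat 1 + W) *v v) > 0) \<and>
     0 < spectral_gap W \<and> spectral_gap W \<le> 1 \<and>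
     0 < beta_const W \<and> beta_const W < 2"

definition assumption_A2 :: "'a::euclidean_space set \<Rightarrow> real \<Rightarrow> real \<Rightarrow> bool" where
  "assumption_A2 \<Omega> R_low R_up \<longleftrightarrow>
     closed \<Omega> \<and> convex \<Omega> \<and> R_low > 0 \<and> R_up > 0 \<and> cball 0 R_low \<subseteq> \<Omega> \<and> \<Omega> \<subseteq> cball 0 R_up"

definition local_obj :: "('n \<Rightarrow> 's measure) \<Rightarrow> ('n \<Rightarrow> 'a \<Rightarrow> 's \<Rightarrow> real) \<Rightarrow> 'n \<Rightarrow> 'a \<Rightarrow> real" where
  "local_obj P F i x = (\<integral>s. F i x s \<partial>P i)"

definition global_obj ::
    "('n::finite \<Rightarrow> 's measure) \<Rightarrow> ('n \<Rightarrow> 'a \<Rightarrow> 's \<Rightarrow> real) \<Rightarrow> 'a \<Rightarrow> real" where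
  "global_obj P F x = (1 / real CARD('n)) * (\<Sum>i\<in>UNIV. local_obj P F i x)"

definition optimal_point :: "'a set \<Rightarrow> ('a \<Rightarrow> real) \<Rightarrow> 'a \<Rightarrow> bool" where
  "optimal_point \<Omega> f x \<longleftrightarrow> x \<in> \<Omega> \<and> (\<forall>y\<in>\<Omega>. f x \<le> f y)"

text \<open>The samples and objectives are such that the expectations defining \<open>f\<^sub>i\<close> on \<open>\<Omega>\<close> exist.\<close>

definition stochastic_objective ::
    "('n \<Rightarrow> 's measure) \<Rightarrow> ('n \<Rightarrow> 'a::euclidean_space \<Rightarrow> 's \<Rightarrow> real) \<Rightarrow> 'a set \<Rightarrow> bool" where
  "stochastic_objective P F \<Omega> \<longleftrightarrow>
     (\<forall>i. prob_space (P i) \<and>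
          (\<lambda>(x, s). F i x s) \<in> borel_measurable (borel \<Otimes>\<^sub>M P i) \<and>
          (\<forall>x\<in>\<Omega>. integrable (P i) (F i x)))"

text \<open>
  The algorithm evaluates \<open>F i\<close> at \<open>x + \<mu> *\<^sub>R u\<close> with \<open>x \<in> \<Omega>\<^sub>\<epsilon>\<close> and \<open>norm u = 1\<close>.  With
  \<open>\<epsilon> = \<mu> / (2 * R_low)\<close> such a point may lie outside \<open>\<Omega>\<close> (only \<open>x + (\<mu> / 2) *\<^sub>R u \<in> \<Omega>\<close> is
  guaranteed).  Convexity and Lipschitz continuity of \<open>F i\<close> "on \<open>\<Omega>\<close>" are therefore read as
  holding on some convex open neighbourhood \<open>D\<close> of \<open>\<Omega>\<close>, which contains all query points once
  \<open>\<mu>\<close> is small.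
\<close>

definition assumption_A3 ::
    "('n \<Rightarrow> 's measure) \<Rightarrow> ('n \<Rightarrow> 'a::euclidean_space \<Rightarrow> 's \<Rightarrow> real) \<Rightarrow> 'a set \<Rightarrow> real \<Rightarrow> bool" where
  "assumption_A3 P F \<Omega> L_f \<longleftrightarrow>
     L_f > 0 \<and>
     (\<exists>D. open D \<and> convex D \<and> \<Omega> \<subseteq> D \<and>
        (\<forall>i. \<forall>s\<in>space (P i).
           convex_on D (\<lambda>x. F i x s) \<and> L_f-lipschitz_on D (\<lambda>x. F i x s)))"

definition gradient :: "('a::euclidean_space \<Rightarrow> real) \<Rightarrow> 'a \<Rightarrow> 'a" where
  "gradient g x = (THE D. GDERIV g x :> D)"

definition assumption_A4 ::
    "('n \<Rightarrow> 's measure) \<Rightarrow> ('n \<Rightarrow> 'a::euclidean_space \<Rightarrow> 's \<Rightarrow> real) \<Rightarrow> 'a set \<Rightarrow> real \<Rightarrow> bool" where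
  "assumption_A4 P F \<Omega> \<sigma> \<longleftrightarrow>
     \<sigma> > 0 \<and>
     (\<forall>i. \<forall>x\<in>\<Omega>.
        (AE s in P i. (\<lambda>y. F i y s) differentiable (at x)) \<and>
        integrable (P i)
          (\<lambda>s. (norm (gradient (\<lambda>y. F i y s) x - gradient (local_obj P F i) x))\<^sup>2) \<and>
        (\<integral>s. (norm (gradient (\<lambda>y. F i y s) x - gradient (local_obj P F i) x))\<^sup>2 \<partial>P i) \<le> \<sigma>\<^sup>2)"

text \<open>A random map is \<open>C z\<close> with \<open>z\<close> distributed according to \<open>Q\<close>.\<close>

definition assumption_A5 ::
    "'z measure \<Rightarrow> ('z \<Rightarrow> 'a::euclidean_space \<Rightarrow> 'a) \<Rightarrow> real \<Rightarrow> real \<Rightarrow> bool" where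
  "assumption_A5 Q C r \<omega> \<longleftrightarrow>
     1 \<le> r \<and> 0 < \<omega> \<and> \<omega> \<le> 1 \<and>
     (\<lambda>(z, x). C z x) \<in> borel_measurable (Q \<Otimes>\<^sub>M borel) \<and>
     (\<forall>x. integrable Q (\<lambda>z. (norm ((1 / r) *\<^sub>R C z x - x))\<^sup>2) \<and>
          (\<integral>z. (norm ((1 / r) *\<^sub>R C z x - x))\<^sup>2 \<partial>Q) \<le> (1 - \<omega>) * (norm x)\<^sup>2)"

definition assumption_A6 ::
    "('n \<Rightarrow> 's measure) \<Rightarrow> ('n \<Rightarrow> 'a::euclidean_space \<Rightarrow> 's \<Rightarrow> real) \<Rightarrow> 'a set \<Rightarrow> real \<Rightarrow> bool" where
  "assumption_A6 P F \<Omega> L_m \<longleftrightarrow>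
     (\<forall>i. (\<forall>x\<in>\<Omega>. local_obj P F i differentiable (at x)) \<and>
          (\<forall>x\<in>\<Omega>. \<forall>y\<in>\<Omega>.
             norm (gradient (local_obj P F i) x - gradient (local_obj P F i) y)
               \<le> L_m * norm (x - y)))"

text \<open>
  The uniform distribution on the unit sphere, as the law of the direction of a uniform point of
  the unit ball (normalised cone measure, i.e. normalised surface measure).
\<close>

definition uniform_sphere :: "'a::euclidean_space measure" where
  "uniform_sphere = distr (uniform_measure lborel (ball 0 1)) borel sgn"

text \<open>
  \<open>\<xi> i k\<close>, \<open>u i k\<close> and \<open>\<zeta> i k\<close> are the sample and the direction that agent \<open>i\<close> draws at step \<open>k\<close>, and
  the internal randomness of the compression producing \<open>q\<^sub>i\<^sub>,\<^sub>k\<close>.  All of them together are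
  independent: the triple for one \<open>(i, k)\<close> has a product law, and the triples are independent.
\<close>

definition fresh_draws ::
    "'w measure \<Rightarrow> ('n \<Rightarrow> 's measure) \<Rightarrow> 'z measure \<Rightarrow>
     ('n \<Rightarrow> nat \<Rightarrow> 'w \<Rightarrow> 's) \<Rightarrow> ('n \<Rightarrow> nat \<Rightarrow> 'w \<Rightarrow> 'a::euclidean_space) \<Rightarrow>
     ('n \<Rightarrow> nat \<Rightarrow> 'w \<Rightarrow> 'z) \<Rightarrow> bool" where
  "fresh_draws M P Q \<xi> u \<zeta> \<longleftrightarrow>
     prob_space M \<and> prob_space Q \<and>
     (\<forall>i k. distr M (P i \<Otimes>\<^sub>M uniform_sphere \<Otimes>\<^sub>M Q) (\<lambda>w. (\<xi> i k w, u i k w, \<zeta> i k w))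
              = P i \<Otimes>\<^sub>M uniform_sphere \<Otimes>\<^sub>M Q) \<and>
     prob_space.indep_vars M (\<lambda>(i, k). P i \<Otimes>\<^sub>M uniform_sphere \<Otimes>\<^sub>M Q)
       (\<lambda>(i, k) w. (\<xi> i k w, u i k w, \<zeta> i k w)) UNIV"

definition grad_est ::
    "('a::euclidean_space \<Rightarrow> 's \<Rightarrow> real) \<Rightarrow> real \<Rightarrow> 'a \<Rightarrow> 's \<Rightarrow> 'a \<Rightarrow> 'a" where
  "grad_est Fi \<mu> x s v = (real DIM('a) / \<mu> * (Fi (x + \<mu> *\<^sub>R v) s - Fi x s)) *\<^sub>R v"

definition G_mat ::
    "('n \<Rightarrow> 'a::euclidean_space \<Rightarrow> 's \<Rightarrow> real) \<Rightarrow> real \<Rightarrow> 'a ^ 'n \<Rightarrow> ('n \<Rightarrow> 's) \<Rightarrow> ('n \<Rightarrow> 'a) \<Rightarrow> 'a ^ 'n"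
  where "G_mat F \<mu> X s v = (\<chi> i. grad_est (F i) \<mu> (X $ i) (s i) (v i))"

definition shrink :: "real \<Rightarrow> 'a::real_vector set \<Rightarrow> 'a set" where
  "shrink \<epsilon> \<Omega> = (\<lambda>x. (1 - \<epsilon>) *\<^sub>R x) ` \<Omega>"

text \<open>
  One sample path of Com-DSZO for given draws \<open>s i k\<close>, \<open>v i k\<close>, \<open>z i k\<close>.
  The state at step \<open>k\<close> holds \<open>x\<^sub>i\<^sub>,\<^sub>k\<close>, its compressed estimate, \<open>b\<^sub>i\<^sub>,\<^sub>k\<close>, \<open>q\<^sub>i\<^sub>,\<^sub>k\<close> for all agents.
\<close>

record ('a, 'n) dszo_state =
  st_x :: "'a ^ ('n::finite)"
  st_xhat :: "'a ^ 'n"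
  st_b :: "'a ^ 'n"
  st_q :: "'a ^ 'n"

primrec com_dszo ::
    "('n::finite \<Rightarrow> 'n set) \<Rightarrow> real ^ 'n ^ 'n \<Rightarrow> 'a::euclidean_space set \<Rightarrow>
     ('n \<Rightarrow> 'a \<Rightarrow> 's \<Rightarrow> real) \<Rightarrow> ('z \<Rightarrow> 'a \<Rightarrow> 'a) \<Rightarrow>
     (nat \<Rightarrow> real) \<Rightarrow> real \<Rightarrow> real \<Rightarrow> real \<Rightarrow> real \<Rightarrow> 'a ^ 'n \<Rightarrow>
     ('n \<Rightarrow> nat \<Rightarrow> 's) \<Rightarrow> ('n \<Rightarrow> nat \<Rightarrow> 'a) \<Rightarrow> ('n \<Rightarrow> nat \<Rightarrow> 'z) \<Rightarrow> nat \<Rightarrow> ('a, 'n) dszo_state"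
where
  "com_dszo N W \<Omega> F C \<eta> \<mu> \<epsilon> \<psi> \<gamma> X0 s v z 0 =
     \<lparr> st_x = X0, st_xhat = 0, st_b = 0, st_q = (\<chi> i. C (z i 0) (X0 $ i)) \<rparr>"
| "com_dszo N W \<Omega> F C \<eta> \<mu> \<epsilon> \<psi> \<gamma> X0 s v z (Suc k) =
     (let S = com_dszo N W \<Omega> F C \<eta> \<mu> \<epsilon> \<psi> \<gamma> X0 s v z k;
          X = st_x S; Q = st_q S;
          Xh' = (\<chi> i. st_xhat S $ i + \<psi> *\<^sub>R Q $ i);
          B' = (\<chi> i. st_b S $ i + \<psi> *\<^sub>R (Q $ i - (\<Sum>j\<in>N i. (W $ i $ j) *\<^sub>R Q $ j)));
          X' = (\<chi> i. closest_point (shrink \<epsilon> \<Omega>)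
                       (X $ i - \<gamma> *\<^sub>R B' $ i - \<eta> k *\<^sub>R grad_est (F i) \<mu> (X $ i) (s i k) (v i k)))
      in \<lparr> st_x = X', st_xhat = Xh', st_b = B', st_q = (\<chi> i. C (z i (Suc k)) (X' $ i - Xh' $ i)) \<rparr>)"

definition c0_const :: "real \<Rightarrow> real \<Rightarrow> real \<Rightarrow> real" where
  "c0_const \<psi> r \<omega> = \<psi> * r * \<omega> / 2"

definition kappa1 :: "real ^ 'n ^ 'n \<Rightarrow> real \<Rightarrow> real \<Rightarrow> real" where
  "kappa1 W \<gamma> c0 = spectral_gap W / 4 + 2 * (1 + inverse c0)\<^sup>2 * \<gamma> * (beta_const W)\<^sup>2"

definition kappa2 :: "real ^ 'n ^ 'n \<Rightarrow> real \<Rightarrow> real \<Rightarrow> real" where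
  "kappa2 W \<gamma> c0 = (1 + inverse c0)\<^sup>2 * \<gamma> * (beta_const W)\<^sup>2
                     + (1 + 2 / spectral_gap W) * (beta_const W)\<^sup>2"

definition C3_const :: "real ^ 'n ^ 'n \<Rightarrow> real \<Rightarrow> real \<Rightarrow> real \<Rightarrow> real \<Rightarrow> real" where
  "C3_const W \<gamma> \<psi> r \<omega> =
     (let \<delta> = spectral_gap W; c0 = c0_const \<psi> r \<omega>
      in 4 * (1 + \<gamma> * \<delta> / 2) * (1 + 2 / (\<gamma> * \<delta>))
         + 2 * (1 + inverse c0) * (1 + c0) * (1 - \<psi> * r * \<omega>))"

definition M1_const :: "nat \<Rightarrow> nat \<Rightarrow> real \<Rightarrow> real" where
  "M1_const n d L_m = (5 + 10 / real n) * 4 * real d * L_m"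

definition step_params_ok ::
    "real ^ 'n ^ 'n \<Rightarrow> real \<Rightarrow> real \<Rightarrow> real \<Rightarrow> real \<Rightarrow> bool" where
  "step_params_ok W \<gamma> \<psi> r \<omega> \<longleftrightarrow>
     (let c0 = c0_const \<psi> r \<omega>
      in 0 < \<psi> \<and> \<psi> \<le> inverse r \<and> 0 < \<gamma> \<and> \<gamma> < 1 \<and>
         \<gamma> < spectral_gap W * inverse (kappa1 W \<gamma> c0) \<and> \<gamma> < c0 * inverse (kappa2 W \<gamma> c0))"

text \<open>The error \<open>e\<^sub>k\<close> of a random run \<open>S\<close>, where \<open>S w k\<close> is its state at step \<open>k\<close> for outcome \<open>w\<close>.\<close>

definition run_error ::
    "'w measure \<Rightarrow> ('w \<Rightarrow> nat \<Rightarrow> ('a::euclidean_space, 'n::finite) dszo_state) \<Rightarrow> nat \<Rightarrow> real" where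
  "run_error M S k =
     (\<integral>w. (norm (st_x (S w k) - matrix_action H_mat (st_x (S w k))))\<^sup>2
          + (norm (st_xhat (S w (Suc k)) - st_x (S w k)))\<^sup>2 \<partial>M)"

text \<open>\<open>\<kappa>\<^sub>0\<close> is a contraction factor of the run: the constant in its error recursion.\<close>

definition contraction_factor ::
    "'w measure \<Rightarrow> ('n::finite \<Rightarrow> 'a::euclidean_space \<Rightarrow> 's \<Rightarrow> real) \<Rightarrow> (nat \<Rightarrow> real) \<Rightarrow> real \<Rightarrow> real \<Rightarrow>
     ('n \<Rightarrow> nat \<Rightarrow> 'w \<Rightarrow> 's) \<Rightarrow> ('n \<Rightarrow> nat \<Rightarrow> 'w \<Rightarrow> 'a) \<Rightarrow>
     ('w \<Rightarrow> nat \<Rightarrow> ('a, 'n) dszo_state) \<Rightarrow> real \<Rightarrow> bool" where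
  "contraction_factor M F \<eta> \<mu> C3 \<xi> u S \<kappa>\<^sub>0 \<longleftrightarrow>
     (\<forall>k. run_error M S (Suc k) \<le>
        \<kappa>\<^sub>0 * run_error M S k
        + C3 * (\<eta> k)\<^sup>2 *
          (\<integral>w. (norm (G_mat F \<mu> (st_x (S w k)) (\<lambda>i. \<xi> i k w) (\<lambda>i. u i k w)))\<^sup>2 \<partial>M))"

definition regret_sum ::
    "'w measure \<Rightarrow> ('a \<Rightarrow> real) \<Rightarrow> ('w \<Rightarrow> nat \<Rightarrow> ('a::euclidean_space, 'n::finite) dszo_state) \<Rightarrow>
     'a \<Rightarrow> nat \<Rightarrow> real" where
  "regret_sum M f S xs T = (\<Sum>k=1..T. \<integral>w. (f (row_mean (st_x (S w k))) - f xs) \<partial>M)"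

definition is_bigO :: "(nat \<Rightarrow> real) \<Rightarrow> (nat \<Rightarrow> real) \<Rightarrow> bool" where
  "is_bigO \<beta> \<alpha> \<longleftrightarrow> limsup (\<lambda>k. ereal (\<beta> k / \<alpha> k)) < \<infinity>"

end

theory Submission
  imports Defs
begin

text \<open>
  The sum of the expected optimality gaps is controlled as for projected subgradient descent with
  step sizes \<open>\<eta>\<^sub>k\<close> of order \<open>1 / sqrt k\<close>.  Three effects disturb that classical argument.

  The gradient estimates are biased, and their query points may leave \<open>\<Omega>\<close>, where the gradients of
  the objectives are not known to be Lipschitz.  But the objectives are convex and Lipschitz on a
  neighbourhood of \<open>\<Omega>\<close>, and for such functions \<open>sphere_gradient_estimate\<close> shows that the estimator
  satisfies the subgradient inequality in the mean, up to \<open>2 * L * \<mu>\<close>.  It amounts to the divergence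
  theorem for the ball, but is derived as an inequality from convexity, a translation of Lebesgue
  measure and a limit over thin shells.  As the draws of a step are independent of the iterates of that
  step (\<open>past_independent\<close>), the inequality holds in expectation along the run (\<open>g_at_inner_mean\<close>).

  The agents disagree, and they communicate compressed information.  Both deviations are measured by
  the error \<open>e\<^sub>k\<close> of the run, and \<open>descent_pointwise\<close> bounds their influence on one step by a multiple
  of \<open>e\<^sub>k\<close>.  Since \<open>e\<^sub>k\<close> contracts up to a term of order \<open>\<eta>\<^sub>k\<^sup>2\<close>, the sum of \<open>e\<^sub>k / \<eta>\<^sub>k\<close>, which is
  what remains after division by the step size, has order \<open>sqrt T\<close> (\<open>contraction_weighted_sum\<close>).

  Finally, the comparison with the optimum takes place in the shrunken set.  With \<open>\<mu> = 1 / sqrt T\<close> and \<open>\<epsilon>\<close>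
  proportional to \<open>\<mu>\<close>, shrinking and bias contribute order \<open>1 / sqrt T\<close> per step, hence \<open>sqrt T\<close> in
  total.  Everything is put together in \<open>regret_bound\<close>, whose constant depends on the compressor only
  through a lower bound for the contraction gain \<open>c\<^sub>0\<close>; this uniformity gives the statement on
  high compression fidelity, where \<open>c\<^sub>0\<close> tends to \<open>1 / 2\<close>.
\<close>

section \<open>The uniform distribution on the sphere\<close>

lemma ball_borel_measurable [measurable]: "ball (c::'a::euclidean_space) r \<in> sets borel"
  by simp

lemma sgn_borel_measurable [measurable]: "(sgn :: 'a::euclidean_space \<Rightarrow> 'a) \<in> borel_measurable borel"
  unfolding sgn_div_norm by measurable

text \<open>
  Polar coordinates for functions of the direction alone: by scaling, the direction of a uniform
  point has the same law in every ball.  Subtracting the identities for two radii gives the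
  corresponding one on a spherical shell.
\<close>

lemma ball_weighted_integral_sgn:
  fixes h :: "'a::euclidean_space \<Rightarrow> real"
  assumes [measurable]: "h \<in> borel_measurable borel" and "0 < \<rho>"
  shows "(\<integral>v. indicator (ball 0 \<rho>) v * h (sgn v) \<partial>lborel)
       = \<rho> ^ DIM('a) * unit_ball_vol (real DIM('a)) * (\<integral>u. h u \<partial>uniform_sphere)"
proof -
  let ?V = "unit_ball_vol (real DIM('a))"
  let ?I = "\<integral>v. indicator (ball 0 1) (v::'a) * h (sgn v) \<partial>lborel"
  have V: "?V > 0" by (simp add: unit_ball_vol_pos)
  have [measurable]: "(\<lambda>v. indicat_real (ball (0::'a) 1) v / ?V) \<in> borel_measurable borel"
    by (intro borel_measurable_divide borel_measurable_indicator) auto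
  have [measurable]: "(\<lambda>v::'a. indicat_real (ball 0 \<rho>) v * h (sgn v)) \<in> borel_measurable borel" for \<rho>
    by (intro borel_measurable_times borel_measurable_indicator measurable_compose[OF _ assms(1)]) auto
  have inv: "1 / ennreal ?V = ennreal (1 / ?V)"
    using divide_ennreal[of 1 ?V] V by simp
  have em: "emeasure lborel (ball (0::'a) 1) = ennreal ?V"
    by (simp add: emeasure_ball)
  have dens: "uniform_measure lborel (ball (0::'a) 1)
      = density lborel (\<lambda>v. ennreal (indicator (ball 0 1) v / ?V))"
    unfolding uniform_measure_def em
    by (intro density_cong) (auto simp: inv indicator_def)
  have "(\<integral>u. h u \<partial>uniform_sphere) = (\<integral>v. h (sgn v) \<partial>uniform_measure lborel (ball (0::'a) 1))"
    unfolding uniform_sphere_def by (subst integral_distr) auto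
  also have "\<dots> = (\<integral>v. (indicator (ball 0 1) v / ?V) *\<^sub>R h (sgn v) \<partial>lborel)"
    unfolding dens using V by (subst integral_density) auto
  also have "\<dots> = (\<integral>v. (1 / ?V) * (indicator (ball 0 1) v * h (sgn v)) \<partial>lborel)"
    by (intro Bochner_Integration.integral_cong) auto
  also have "\<dots> = ?I / ?V"
    by (subst integral_mult_right_zero) simp
  finally have "(\<integral>u. h u \<partial>uniform_sphere) = ?I / ?V" .
  then have 1: "?I = ?V * (\<integral>u. h u \<partial>uniform_sphere)"
    using less_imp_neq[OF V] by (metis nonzero_mult_div_cancel_left times_divide_eq_right)
  have "(\<integral>v. indicator (ball 0 \<rho>) v * h (sgn v) \<partial>lborel)
      = (\<integral>v. indicator (ball 0 \<rho>) v * h (sgn v) \<partial>(density (distr lborel borel (\<lambda>x. 0 + \<rho> *\<^sub>R x)) (\<lambda>_. ennreal (\<bar>\<rho>\<bar> ^ DIM('a)))))"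
    using lborel_affine[of \<rho> "0::'a"] \<open>0 < \<rho>\<close> by (simp add: ennreal_power)
  also have "\<dots> = (\<integral>v. \<rho> ^ DIM('a) * (indicator (ball 0 \<rho>) (\<rho> *\<^sub>R v) * h (sgn (\<rho> *\<^sub>R v))) \<partial>lborel)"
    using \<open>0 < \<rho>\<close> by (subst integral_density) (auto simp: integral_distr)
  also have "\<dots> = (\<integral>v. \<rho> ^ DIM('a) * (indicator (ball 0 1) v * h (sgn v)) \<partial>lborel)"
    using \<open>0 < \<rho>\<close> by (intro Bochner_Integration.integral_cong) (auto simp: indicator_def sgn_scaleR)
  also have "\<dots> = \<rho> ^ DIM('a) * ?I"
    by simp
  finally show ?thesis using 1 by simp
qed

lemma prob_space_uniform_sphere: "prob_space (uniform_sphere :: 'a::euclidean_space measure)"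
proof -
  have "prob_space (uniform_measure lborel (ball (0::'a) 1))"
    by (intro prob_space_uniform_measure) (auto simp: emeasure_ball ennreal_eq_0_iff not_le unit_ball_vol_pos)
  then show ?thesis unfolding uniform_sphere_def
    by (intro prob_space.prob_space_distr) auto
qed

lemma sets_uniform_sphere [measurable_cong]: "sets uniform_sphere = sets borel"
  by (simp add: uniform_sphere_def)

lemma AE_uniform_sphere_norm_le: "AE u in (uniform_sphere :: 'a::euclidean_space measure). norm u \<le> 1"
proof -
  show ?thesis unfolding uniform_sphere_def
    by (subst AE_distr_iff) (auto simp: norm_sgn)
qed

lemma integrable_indicator_ball:
  "integrable lborel (\<lambda>v. (B::real) * indicator (ball (c::'a::euclidean_space) \<rho>) v)"
proof -
  have "emeasure lborel (ball c \<rho>) < \<infinity>"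
    by (intro emeasure_bounded_finite bounded_ball)
  then show ?thesis by (intro integrable_mult_right integrable_real_indicator) auto
qed

lemma integrable_bounded_ball:
  fixes f :: "'a::euclidean_space \<Rightarrow> real"
  assumes [measurable]: "f \<in> borel_measurable borel"
    and "\<And>v. norm v < \<rho> \<Longrightarrow> \<bar>f v\<bar> \<le> B" and "\<And>v. norm v \<ge> \<rho> \<Longrightarrow> f v = 0"
  shows "integrable lborel f"
proof (rule Bochner_Integration.integrable_bound[where f="\<lambda>v. B * indicator (ball 0 \<rho>) v"])
  show "integrable lborel (\<lambda>v. B * indicator (ball (0::'a) \<rho>) v)"
    by (rule integrable_indicator_ball)
  show "AE v in lborel. norm (f v) \<le> norm (B * indicator (ball 0 \<rho>) v)"
  proof (rule AE_I2)
    fix v :: 'a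
    show "norm (f v) \<le> norm (B * indicator (ball 0 \<rho>) v)"
      using assms(2)[of v] assms(3)[of v] by (cases "norm v < \<rho>") (auto simp: indicator_def)
  qed
qed simp

section \<open>Gradient estimation on the sphere for convex functions\<close>

text \<open>
  A Lipschitz approximation of the indicator of the ball of radius \<open>\<mu>\<close>, falling linearly
  from 1 to 0 across the shell of width \<open>h\<close> next to the boundary.  Its gradient
  is \<open>- sgn v / h\<close> on that shell and 0 elsewhere, so as \<open>h\<close> tends to 0 it turns volume
  integrals of differences into integrals over the sphere.
\<close>

definition cutoff :: "real \<Rightarrow> real \<Rightarrow> 'a::euclidean_space \<Rightarrow> real" where
  "cutoff \<mu> h v = max 0 (min 1 ((\<mu> - norm v) / h))"

lemma cutoff_measurable [measurable]: "cutoff \<mu> h \<in> borel_measurable borel"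
  unfolding cutoff_def by measurable

lemma cutoff_lipschitz:
  assumes "h > 0" shows "\<bar>cutoff \<mu> h a - cutoff \<mu> h b\<bar> \<le> norm (a - b) / h"
proof -
  have "\<bar>cutoff \<mu> h a - cutoff \<mu> h b\<bar> \<le> \<bar>(\<mu> - norm a) / h - (\<mu> - norm b) / h\<bar>"
    unfolding cutoff_def by linarith
  also have "\<dots> = \<bar>norm b - norm a\<bar> / h"
    using assms by (simp add: diff_divide_distrib[symmetric] abs_divide)
  also have "\<dots> \<le> norm (a - b) / h"
    using assms norm_triangle_ineq3[of b a] by (intro divide_right_mono) (auto simp: norm_minus_commute)
  finally show ?thesis .
qed

lemma cutoff_bounds: "0 \<le> cutoff \<mu> h v" "cutoff \<mu> h v \<le> 1"
  by (auto simp: cutoff_def)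

lemma cutoff_eq_0: "h > 0 \<Longrightarrow> norm v \<ge> \<mu> \<Longrightarrow> cutoff \<mu> h v = 0"
  using divide_nonpos_pos[of "\<mu> - norm v" h] by (simp add: cutoff_def max_def min_def)

lemma cutoff_eq_1: "h > 0 \<Longrightarrow> norm v \<le> \<mu> - h \<Longrightarrow> cutoff \<mu> h v = 1"
  using le_divide_eq_1_pos[of h "\<mu> - norm v"] by (simp add: cutoff_def)

lemma cutoff_eq_affine:
  assumes "h > 0" "norm v \<le> \<mu>" "\<mu> - h \<le> norm v"
  shows "cutoff \<mu> h v = (\<mu> - norm v) / h"
  using assms divide_nonneg_pos[of "\<mu> - norm v" h] divide_le_eq_1_pos[of h "\<mu> - norm v"]
  by (simp add: cutoff_def)

text \<open>
  The two spheres where the directional derivative fails to exist are null sets.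
\<close>

lemma cutoff_deriv:
  fixes v w :: "'a::euclidean_space"
  assumes h: "0 < h" "h < \<mu>" and v: "norm v \<noteq> \<mu>" "norm v \<noteq> \<mu> - h"
  shows "((\<lambda>s. cutoff \<mu> h (v + s *\<^sub>R w)) has_real_derivative
           - (indicator (ball 0 \<mu> - ball 0 (\<mu> - h)) v * (sgn v \<bullet> w) / h)) (at 0)"
proof -
  have lim: "((\<lambda>s. norm (v + s *\<^sub>R w)) \<longlongrightarrow> norm v) (nhds 0)"
  proof -
    have "isCont (\<lambda>s. norm (v + s *\<^sub>R w)) 0"
      by (intro continuous_intros)
    then have "((\<lambda>s. norm (v + s *\<^sub>R w)) \<longlongrightarrow> norm (v + 0 *\<^sub>R w)) (nhds 0)"
      unfolding isCont_def by (rule iffD1[OF tendsto_at_iff_tendsto_nhds])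
    then show ?thesis by simp
  qed
  consider "norm v < \<mu> - h" | "norm v > \<mu>" | "\<mu> - h < norm v" "norm v < \<mu>"
    using v by linarith
  then show ?thesis
  proof cases
    case 1
    have "\<forall>\<^sub>F s in nhds 0. norm (v + s *\<^sub>R w) < \<mu> - h"
      using order_tendstoD(2)[OF lim 1] .
    then have "\<forall>\<^sub>F s in nhds 0. cutoff \<mu> h (v + s *\<^sub>R w) = 1"
      by eventually_elim (use h in \<open>auto intro!: cutoff_eq_1\<close>)
    then have "((\<lambda>s. cutoff \<mu> h (v + s *\<^sub>R w)) has_real_derivative 0) (at 0)"
      by (subst DERIV_cong_ev[OF refl _ refl]) auto
    then show ?thesis using 1 by (simp add: indicator_def)
  next
    case 2
    have "\<forall>\<^sub>F s in nhds 0. norm (v + s *\<^sub>R w) > \<mu>"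
      using order_tendstoD(1)[OF lim 2] .
    then have "\<forall>\<^sub>F s in nhds 0. cutoff \<mu> h (v + s *\<^sub>R w) = 0"
      by eventually_elim (use h in \<open>auto intro!: cutoff_eq_0\<close>)
    then have "((\<lambda>s. cutoff \<mu> h (v + s *\<^sub>R w)) has_real_derivative 0) (at 0)"
      by (subst DERIV_cong_ev[OF refl _ refl]) auto
    then show ?thesis using 2 by (simp add: indicator_def)
  next
    case 3
    have "\<forall>\<^sub>F s in nhds 0. norm (v + s *\<^sub>R w) < \<mu>" "\<forall>\<^sub>F s in nhds 0. norm (v + s *\<^sub>R w) > \<mu> - h"
      using order_tendstoD[OF lim] 3 by auto
    then have ev: "\<forall>\<^sub>F s in nhds 0. cutoff \<mu> h (v + s *\<^sub>R w) = (\<mu> - norm (v + s *\<^sub>R w)) / h"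
      by eventually_elim (use h in \<open>auto intro!: cutoff_eq_affine\<close>)
    have v0: "v \<noteq> 0" using 3 h by auto
    have "((\<lambda>s. norm (v + s *\<^sub>R w)) has_derivative (\<lambda>s. sgn v \<bullet> (s *\<^sub>R w))) (at 0)"
    proof (rule has_derivative_compose[of "\<lambda>s. v + s *\<^sub>R w" "\<lambda>s. s *\<^sub>R w" 0 UNIV norm "\<lambda>x. sgn v \<bullet> x"])
      show "((\<lambda>s. v + s *\<^sub>R w) has_derivative (\<lambda>s. s *\<^sub>R w)) (at 0)"
        using has_derivative_add[OF has_derivative_const has_derivative_scaleR_left[OF has_derivative_ident]] by simp
      show "(norm has_derivative (\<lambda>x. sgn v \<bullet> x)) (at (v + 0 *\<^sub>R w))"
        using has_derivative_norm[OF v0] by (simp add: inner_commute)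
    qed
    then have "((\<lambda>s. norm (v + s *\<^sub>R w)) has_real_derivative (sgn v \<bullet> w)) (at 0)"
      unfolding has_field_derivative_def by (rule has_derivative_eq_rhs) (simp add: fun_eq_iff mult.commute)
    then have "((\<lambda>s. (\<mu> - norm (v + s *\<^sub>R w)) / h) has_real_derivative (0 - (sgn v \<bullet> w)) / h) (at 0)"
      by (intro DERIV_cdivide DERIV_diff DERIV_const)
    then have "((\<lambda>s. cutoff \<mu> h (v + s *\<^sub>R w)) has_real_derivative (0 - (sgn v \<bullet> w)) / h) (at 0)"
      by (subst DERIV_cong_ev[OF refl ev refl])
    then show ?thesis using 3 by (simp add: indicator_def)
  qed
qed

text \<open>
  The divergence theorem on a thin shell, combined with convexity.  For small \<open>t\<close>, convexity
  gives \<open>g (x + v) - g (x + v - t *\<^sub>R w) \<ge> t * (g (x + v) - g (y + v))\<close> where \<open>w = x - y\<close>.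
  Integrating against the cutoff and moving the translation from \<open>g\<close> to the cutoff bounds the
  left side of the claim by a difference quotient of the cutoff, integrated against \<open>g\<close>; its
  limit for \<open>t \<rightarrow> 0\<close> is the shell integral, by dominated convergence.
\<close>

lemma sphere_gradient_estimate_shell:
  fixes g :: "'a::euclidean_space \<Rightarrow> real"
  assumes conv: "convex_on D g" and lip: "L-lipschitz_on D g"
    and meas [measurable]: "g \<in> borel_measurable borel"
    and h: "0 < h" "h < \<mu>" "\<mu> < \<delta>" and D: "ball x \<delta> \<subseteq> D" "ball y \<delta> \<subseteq> D"
  shows "(g x - g y - 2 * L * \<mu>) * (\<integral>v. cutoff \<mu> h v \<partial>(lborel :: 'a measure))
      \<le> (\<integral>v. indicator (ball 0 \<mu> - ball 0 (\<mu> - h)) v * (sgn v \<bullet> (x - y)) / h * g (x + v) \<partial>lborel)"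
proof -
  define w where "w = x - y"
  define \<Delta> where "\<Delta> = g x - g y - 2 * L * \<mu>"
  \<comment> \<open>\<open>\<tau>\<close> is so small that the translated cutoffs stay supported in \<open>ball 0 \<delta>\<close>, where \<open>g\<close> is controlled\<close>
  define \<tau> where "\<tau> = min (1/2) ((\<delta> - \<mu>) / (2 * (norm w + 1)))"
  define t where "t n = \<tau> / real (Suc n)" for n
  define B where "B = \<bar>g x\<bar> + L * (\<delta> + norm w)"
  let ?\<phi> = "cutoff \<mu> h :: 'a \<Rightarrow> real"
  define f where "f v = indicator (ball 0 \<mu> - ball 0 (\<mu> - h)) v * (sgn v \<bullet> w) / h * g (x + v)" for v
  define s where "s n v = (?\<phi> v - ?\<phi> (v + t n *\<^sub>R w)) / t n * g (x + v)" for n v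
  have L: "L \<ge> 0" using lip by (rule lipschitz_on_nonneg)
  have \<tau>: "\<tau> > 0" "\<tau> \<le> 1/2" "\<tau> * norm w < \<delta> - \<mu>"
  proof -
    have p: "norm w + 1 > 0" by (rule add_nonneg_pos) auto
    show "\<tau> > 0" using h p unfolding \<tau>_def by auto
    show "\<tau> \<le> 1/2" unfolding \<tau>_def by (rule min.cobounded1)
    have "\<tau> * norm w \<le> ((\<delta> - \<mu>) / (2 * (norm w + 1))) * norm w"
      unfolding \<tau>_def by (intro mult_right_mono) auto
    also have "\<dots> \<le> ((\<delta> - \<mu>) / (2 * (norm w + 1))) * (norm w + 1)"
      using h by (intro mult_left_mono) auto
    also have "\<dots> = (\<delta> - \<mu>) / 2" using p by (simp add: field_simps)
    also have "\<dots> < \<delta> - \<mu>" using h by simp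
    finally show "\<tau> * norm w < \<delta> - \<mu>" .
  qed
  have t: "0 < t n" "t n < 1" "t n * norm w < \<delta> - \<mu>" for n
  proof -
    have "t n \<le> \<tau>" using \<tau> unfolding t_def by (simp add: field_simps)
    moreover have "t n * norm w \<le> \<tau> * norm w" using \<open>t n \<le> \<tau>\<close> by (intro mult_right_mono) auto
    ultimately show "t n < 1" "t n * norm w < \<delta> - \<mu>" using \<tau> by auto
    show "0 < t n" using \<tau> by (simp add: t_def)
  qed
  have t0: "t \<longlonglongrightarrow> 0"
    unfolding t_def using LIMSEQ_Suc[OF lim_const_over_n[of \<tau>]] by simp
  have inD: "x + v \<in> D" "y + v \<in> D" if "norm v < \<delta>" for v
    using D that by (auto simp: subset_iff dist_norm)
  have cD: "convex D" using conv by (rule convex_on_imp_convex)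
  have mix: "x + v - a *\<^sub>R w = (1 - a) *\<^sub>R (x + v) + a *\<^sub>R (y + v)" for a v
    unfolding w_def by (simp add: algebra_simps)
  have xtD: "x + v - a *\<^sub>R w \<in> D" if "norm v < \<delta>" "0 \<le> a" "a \<le> 1" for v a
    unfolding mix using that inD[OF that(1)] cD by (intro convexD) auto
  have xD: "x \<in> D" "y \<in> D" using inD[of 0] h by auto
  have Bx: "\<bar>g (x + v - a *\<^sub>R w)\<bar> \<le> B" if v: "norm v < \<delta>" "0 \<le> a" "a \<le> 1" for v a
  proof -
    have "\<bar>g (x + v - a *\<^sub>R w) - g x\<bar> \<le> L * norm (v - a *\<^sub>R w)"
      using lipschitz_on_normD[OF lip xtD[OF v] xD(1)] by (simp add: algebra_simps)
    also have "norm (v - a *\<^sub>R w) \<le> norm v + a * norm w"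
      using norm_triangle_ineq4[of v "a *\<^sub>R w"] v by simp
    also have "\<dots> \<le> \<delta> + norm w" using v mult_right_mono[of a 1 "norm w"] by simp
    finally show ?thesis using L unfolding B_def by (simp add: mult_left_mono)
  qed
  have B0: "\<bar>g (x + v)\<bar> \<le> B" if "norm v < \<delta>" for v
    using Bx[OF that, of 0] by simp
  have Bpos: "B \<ge> 0" using B0[of 0] h by auto
  \<comment> \<open>convexity on the segment from \<open>x + v\<close> to \<open>y + v\<close>; the Lipschitz bound then removes \<open>v\<close>\<close>
  have key: "t n * \<Delta> \<le> g (x + v) - g (x + v - t n *\<^sub>R w)" if v: "norm v < \<mu>" for n v
  proof -
    have v': "norm v < \<delta>" using v h by simp
    have "g (x + v - t n *\<^sub>R w) \<le> (1 - t n) * g (x + v) + t n * g (y + v)"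
      unfolding mix using t[of n] inD[OF v'] conv by (intro convex_onD) auto
    then have 1: "g (x + v) - g (x + v - t n *\<^sub>R w) \<ge> t n * (g (x + v) - g (y + v))"
      by (simp add: algebra_simps)
    have "\<bar>g (x + v) - g x\<bar> \<le> L * norm v" "\<bar>g (y + v) - g y\<bar> \<le> L * norm v"
      using lipschitz_on_normD[OF lip inD(1)[OF v'] xD(1)] lipschitz_on_normD[OF lip inD(2)[OF v'] xD(2)]
      by auto
    moreover have "L * norm v \<le> L * \<mu>" using v L by (intro mult_left_mono) auto
    ultimately have "\<Delta> \<le> g (x + v) - g (y + v)" unfolding \<Delta>_def by linarith
    then have "t n * \<Delta> \<le> t n * (g (x + v) - g (y + v))" using t[of n] by (intro mult_left_mono) auto
    then show ?thesis using 1 by linarith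
  qed
  have int\<phi>: "integrable lborel ?\<phi>"
    using h by (intro integrable_bounded_ball[where \<rho>=\<mu> and B=1]) (auto simp: cutoff_bounds cutoff_eq_0)
  have int1: "integrable lborel (\<lambda>v. ?\<phi> v * g (x + v - a *\<^sub>R w))" if "0 \<le> a" "a \<le> 1" for a
  proof (rule integrable_bounded_ball[where \<rho>=\<mu> and B=B])
    fix v :: 'a assume "norm v < \<mu>"
    then have "\<bar>?\<phi> v\<bar> * \<bar>g (x + v - a *\<^sub>R w)\<bar> \<le> 1 * B"
      using h that cutoff_bounds[of \<mu> h v] by (intro mult_mono Bx) auto
    then show "\<bar>?\<phi> v * g (x + v - a *\<^sub>R w)\<bar> \<le> B" by (simp add: abs_mult)
  qed (use h in \<open>auto simp: cutoff_eq_0\<close>)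
  have int1': "integrable lborel (\<lambda>v. ?\<phi> v * g (x + v))"
    using int1[of 0] by simp
  have transl: "(\<integral>v. q v \<partial>lborel) = (\<integral>v. q (a + v) \<partial>lborel)"
    if [measurable]: "q \<in> borel_measurable borel" for q :: "'a \<Rightarrow> real" and a
    by (subst lborel_distr_plus[of a, symmetric], subst integral_distr) auto
  have lower: "\<Delta> * (\<integral>v. ?\<phi> v \<partial>lborel) \<le> (\<integral>v. s n v \<partial>lborel)" for n
  proof -
    note tn = t[of n]
    have int2: "integrable lborel (\<lambda>v. ?\<phi> (v + t n *\<^sub>R w) * g (x + v))"
    proof (rule integrable_bounded_ball[where \<rho>=\<delta> and B=B])
      fix v :: 'a assume "norm v < \<delta>"
      then have "\<bar>?\<phi> (v + t n *\<^sub>R w)\<bar> * \<bar>g (x + v)\<bar> \<le> 1 * B"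
        using cutoff_bounds[of \<mu> h "v + t n *\<^sub>R w"] by (intro mult_mono B0) auto
      then show "\<bar>?\<phi> (v + t n *\<^sub>R w) * g (x + v)\<bar> \<le> B" by (simp add: abs_mult)
    next
      fix v :: 'a assume "norm v \<ge> \<delta>"
      moreover have "norm v \<le> norm (v + t n *\<^sub>R w) + norm (t n *\<^sub>R w)"
        using norm_triangle_ineq4[of "v + t n *\<^sub>R w" "t n *\<^sub>R w"] by simp
      ultimately have "norm (v + t n *\<^sub>R w) \<ge> \<mu>" using tn by simp
      then show "?\<phi> (v + t n *\<^sub>R w) * g (x + v) = 0" using h by (simp add: cutoff_eq_0)
    qed simp
    have "t n * \<Delta> * (\<integral>v. ?\<phi> v \<partial>lborel) = (\<integral>v. t n * \<Delta> * ?\<phi> v \<partial>lborel)" by simp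
    also have "\<dots> \<le> (\<integral>v. ?\<phi> v * g (x + v) - ?\<phi> v * g (x + v - t n *\<^sub>R w) \<partial>lborel)"
    proof (rule integral_mono)
      fix v :: 'a
      show "t n * \<Delta> * ?\<phi> v \<le> ?\<phi> v * g (x + v) - ?\<phi> v * g (x + v - t n *\<^sub>R w)"
      proof (cases "norm v < \<mu>")
        case True
        from mult_left_mono[OF key[OF this, of n] cutoff_bounds(1)[of \<mu> h v]] show ?thesis
          by (simp add: algebra_simps)
      qed (use h in \<open>simp add: cutoff_eq_0\<close>)
    qed (use int\<phi> int1[of "t n"] int1' tn in auto)
    also have "\<dots> = (\<integral>v. ?\<phi> v * g (x + v) \<partial>lborel) - (\<integral>v. ?\<phi> v * g (x + v - t n *\<^sub>R w) \<partial>lborel)"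
      using int1[of "t n"] int1' tn by (intro Bochner_Integration.integral_diff) auto
    also have "(\<integral>v. ?\<phi> v * g (x + v - t n *\<^sub>R w) \<partial>lborel) = (\<integral>v. ?\<phi> (v + t n *\<^sub>R w) * g (x + v) \<partial>lborel)"
      by (subst transl[where a="t n *\<^sub>R w"]) (auto simp: algebra_simps)
    also have "(\<integral>v. ?\<phi> v * g (x + v) \<partial>lborel) - (\<integral>v. ?\<phi> (v + t n *\<^sub>R w) * g (x + v) \<partial>lborel)
        = (\<integral>v. ?\<phi> v * g (x + v) - ?\<phi> (v + t n *\<^sub>R w) * g (x + v) \<partial>lborel)"
      using int2 int1' by (intro Bochner_Integration.integral_diff[symmetric])
    also have "\<dots> = (\<integral>v. t n * s n v \<partial>lborel)"
          proof (intro Bochner_Integration.integral_cong refl)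
      fix v
      have "t n * s n v = (t n / t n) * ((?\<phi> v - ?\<phi> (v + t n *\<^sub>R w)) * g (x + v))"
        unfolding s_def by (simp only: times_divide_eq_left times_divide_eq_right mult.assoc mult.left_commute)
      then show "?\<phi> v * g (x + v) - ?\<phi> (v + t n *\<^sub>R w) * g (x + v) = t n * s n v"
        using tn by (simp add: left_diff_distrib)
    qed
    also have "\<dots> = t n * (\<integral>v. s n v \<partial>lborel)" by simp
    finally show ?thesis using tn by (simp add: mult.assoc)
  qed
  have "(\<lambda>n. \<integral>v. s n v \<partial>lborel) \<longlonglongrightarrow> (\<integral>v. f v \<partial>lborel)"
  proof (rule integral_dominated_convergence[where w="\<lambda>v. (norm w / h * B) * indicator (ball 0 \<delta>) v"])
    show "f \<in> borel_measurable lborel" unfolding f_def measurable_lborel1 by measurable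
    show "s n \<in> borel_measurable lborel" for n unfolding s_def measurable_lborel1 by measurable
    show "integrable lborel (\<lambda>v. (norm w / h * B) * indicator (ball (0::'a) \<delta>) v)"
      by (rule integrable_indicator_ball)
    have "sphere (0::'a) \<mu> \<union> sphere 0 (\<mu> - h) \<in> null_sets lborel"
      using negligible_sphere[of "0::'a" \<mu>] negligible_sphere[of "0::'a" "\<mu> - h"]
      by (auto simp: negligible_iff_null_sets null_sets_completion_iff)
    then have "AE v in lborel. v \<notin> sphere (0::'a) \<mu> \<union> sphere 0 (\<mu> - h)"
      by (rule AE_not_in)
    then show "AE v in lborel. (\<lambda>n. s n v) \<longlonglongrightarrow> f v"
    proof (rule AE_mp, intro AE_I2 impI)
      fix v :: 'a assume v: "v \<notin> sphere 0 \<mu> \<union> sphere 0 (\<mu> - h)"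
      let ?d = "- (indicator (ball 0 \<mu> - ball 0 (\<mu> - h)) v * (sgn v \<bullet> w) / h)"
      have "((\<lambda>a. cutoff \<mu> h (v + a *\<^sub>R w)) has_real_derivative ?d) (at 0)"
        using v h by (intro cutoff_deriv) auto
      then have "((\<lambda>a. (cutoff \<mu> h (v + a *\<^sub>R w) - cutoff \<mu> h v) / a) \<longlongrightarrow> ?d) (at 0)"
        by (simp add: DERIV_def)
      moreover have "filterlim t (at 0) sequentially"
        using t0 t(1) by (auto simp: filterlim_at intro!: always_eventually) (metis less_irrefl)
      ultimately have "(\<lambda>n. (cutoff \<mu> h (v + t n *\<^sub>R w) - cutoff \<mu> h v) / t n) \<longlonglongrightarrow> ?d"
        by (rule filterlim_compose)
      then have "(\<lambda>n. - ((cutoff \<mu> h (v + t n *\<^sub>R w) - cutoff \<mu> h v) / t n) * g (x + v)) \<longlonglongrightarrow> - ?d * g (x + v)"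
        by (intro tendsto_mult tendsto_minus tendsto_const)
      moreover have "- ((cutoff \<mu> h (v + t n *\<^sub>R w) - cutoff \<mu> h v) / t n) * g (x + v) = s n v" for n
        unfolding s_def minus_divide_left minus_diff_eq by (rule refl)
      moreover have "- ?d * g (x + v) = f v"
        unfolding f_def minus_minus by (rule refl)
      ultimately show "(\<lambda>n. s n v) \<longlonglongrightarrow> f v"
        by (simp only:)
    qed
    show "AE v in lborel. norm (s n v) \<le> (norm w / h * B) * indicator (ball 0 \<delta>) v" for n
    proof (intro AE_I2)
      fix v :: 'a
      note tn = t[of n]
      show "norm (s n v) \<le> (norm w / h * B) * indicator (ball 0 \<delta>) v"
      proof (cases "norm v < \<delta>")
        case True
        have "\<bar>?\<phi> v - ?\<phi> (v + t n *\<^sub>R w)\<bar> \<le> t n * norm w / h"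
          using cutoff_lipschitz[OF h(1), of \<mu> v "v + t n *\<^sub>R w"] tn by simp
        then have "\<bar>?\<phi> v - ?\<phi> (v + t n *\<^sub>R w)\<bar> / t n \<le> norm w / h"
          using tn by (simp add: field_simps)
        then have "\<bar>?\<phi> v - ?\<phi> (v + t n *\<^sub>R w)\<bar> / t n * \<bar>g (x + v)\<bar> \<le> norm w / h * B"
          using B0[OF True] tn h by (intro mult_mono) auto
        then show ?thesis using True tn by (simp add: s_def abs_mult)
      next
        case False
        have "norm v \<le> norm (v + t n *\<^sub>R w) + norm (t n *\<^sub>R w)"
          using norm_triangle_ineq4[of "v + t n *\<^sub>R w" "t n *\<^sub>R w"] by simp
        then have "norm (v + t n *\<^sub>R w) \<ge> \<mu>" using tn False by simp
        then show ?thesis using False h by (simp add: s_def cutoff_eq_0)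
      qed
    qed
  qed
  then have "\<Delta> * (\<integral>v. ?\<phi> v \<partial>lborel) \<le> (\<integral>v. f v \<partial>lborel)"
    using lower by (intro LIMSEQ_le_const) auto
  then show ?thesis unfolding \<Delta>_def f_def w_def .
qed

text \<open>
  The mean of \<open>DIM('a) / \<mu> * g (x + \<mu> *\<^sub>R u) *\<^sub>R u\<close> acts as a subgradient of \<open>g\<close> at \<open>x\<close> up to an error
  linear in \<open>\<mu>\<close>.  The underlying reason is that it is the gradient of the ball average
  of \<open>g\<close>, which is convex and within \<open>L * \<mu>\<close> of \<open>g\<close>.  Only the resulting inequality is proved here,
  by letting the width \<open>h\<close> of the shell in the previous lemma tend to 0.  As \<open>g\<close> may be nonsmooth, this
  covers query points at which the objectives have no controlled gradient.
\<close>

lemma sphere_gradient_estimate: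
  fixes g :: "'a::euclidean_space \<Rightarrow> real"
  assumes conv: "convex_on D g" and lip: "L-lipschitz_on D g"
    and meas [measurable]: "g \<in> borel_measurable borel"
    and \<mu>: "0 < \<mu>" "\<mu> < \<delta>" and D: "ball x \<delta> \<subseteq> D" "ball y \<delta> \<subseteq> D"
  shows "g x - g y - 2 * L * \<mu>
      \<le> real DIM('a) / \<mu> * (\<integral>u. g (x + \<mu> *\<^sub>R u) * (u \<bullet> (x - y)) \<partial>uniform_sphere)"
proof -
  define w where "w = x - y"
  define \<Delta> where "\<Delta> = g x - g y - 2 * L * \<mu>"
  define I where "I = (\<integral>u. g (x + \<mu> *\<^sub>R u) * (u \<bullet> w) \<partial>uniform_sphere)"
  define d where "d = DIM('a)"
  define V where "V = unit_ball_vol (real d)"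
  define B where "B = \<bar>g x\<bar> + L * \<mu>"
  define vol where "vol h = \<mu> ^ d - (\<mu> - h) ^ d" for h
  have V: "V > 0" by (simp add: V_def unit_ball_vol_pos)
  have L: "L \<ge> 0" using lip by (rule lipschitz_on_nonneg)
  interpret US: prob_space "uniform_sphere :: 'a measure" by (rule prob_space_uniform_sphere)
  have inD: "x + v \<in> D" if "norm v < \<delta>" for v
    using D that by (auto simp: subset_iff dist_norm)
  have xD: "x \<in> D" using inD[of 0] \<mu> by auto
  have gB: "\<bar>g (x + \<mu> *\<^sub>R u)\<bar> \<le> B" if "norm u \<le> 1" for u
  proof -
    have mu: "\<mu> * norm u \<le> \<mu>" using that \<mu> by (simp add: mult_left_le)
    then have "\<mu> * norm u < \<delta>" using \<mu> by linarith
    then have "\<bar>g (x + \<mu> *\<^sub>R u) - g x\<bar> \<le> L * (\<mu> * norm u)"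
      using lipschitz_on_normD[OF lip inD[of "\<mu> *\<^sub>R u"] xD] \<mu> by simp
    also have "\<dots> \<le> L * \<mu>" using L mu by (intro mult_left_mono)
    finally show ?thesis unfolding B_def by linarith
  qed
  have gBw: "\<bar>g (x + \<mu> *\<^sub>R u) * (u \<bullet> w)\<bar> \<le> B * norm w" if "norm u \<le> 1" for u
  proof -
    have "\<bar>u \<bullet> w\<bar> \<le> norm u * norm w" by (rule Cauchy_Schwarz_ineq2)
    also have "\<dots> \<le> norm w" using that by (simp add: mult_right_le_one_le mult_left_le_one_le)
    finally show ?thesis using gB[OF that] unfolding abs_mult by (intro mult_mono) auto
  qed
  have intI: "integrable uniform_sphere (\<lambda>u. g (x + \<mu> *\<^sub>R u) * (u \<bullet> w))"
    by (rule US.integrable_const_bound[where B="B * norm w"])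
       (use AE_uniform_sphere_norm_le gBw in \<open>auto elim!: eventually_mono\<close>)
  have main: "\<Delta> * \<mu> ^ d - \<bar>\<Delta>\<bar> * vol h \<le> vol h / h * (I + L * h * norm w)" if h: "0 < h" "h < \<mu>" for h
  proof -
    let ?A = "ball (0::'a) \<mu>" and ?A' = "ball (0::'a) (\<mu> - h)"
    let ?\<phi> = "cutoff \<mu> h :: 'a \<Rightarrow> real"
    define k where "k u = g (x + \<mu> *\<^sub>R u) * (u \<bullet> w) + L * h * norm w" for u
    have [measurable]: "k \<in> borel_measurable borel" unfolding k_def by measurable
    have kint: "(\<integral>u. k u \<partial>uniform_sphere) = I + L * h * norm w"
      unfolding k_def I_def using intI by (subst Bochner_Integration.integral_add) (auto simp: US.prob_space)
    have ik: "integrable lborel (\<lambda>v. indicator (ball 0 \<rho>) v * k (sgn v))" for \<rho>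
    proof (rule integrable_bounded_ball[where \<rho>=\<rho> and B="B * norm w + L * h * norm w"])
      fix v :: 'a assume "norm v < \<rho>"
      have "\<bar>k (sgn v)\<bar> \<le> \<bar>g (x + \<mu> *\<^sub>R sgn v) * (sgn v \<bullet> w)\<bar> + \<bar>L * h * norm w\<bar>"
        unfolding k_def by (rule abs_triangle_ineq)
      also have "\<dots> \<le> B * norm w + L * h * norm w"
        using gBw[of "sgn v"] L h by (intro add_mono) (auto simp: norm_sgn)
      finally show "\<bar>indicator (ball 0 \<rho>) v * k (sgn v)\<bar> \<le> B * norm w + L * h * norm w"
        by (auto simp: indicator_def intro: order_trans[OF _ \<open>\<bar>k (sgn v)\<bar> \<le> _\<close>])
    qed auto
    \<comment> \<open>replace \<open>v\<close> by its projection to the sphere, at a distance of at most \<open>h\<close>\<close>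
    have pt: "indicator (?A - ?A') v * (sgn v \<bullet> w) / h * g (x + v)
        \<le> (indicator ?A v * k (sgn v) - indicator ?A' v * k (sgn v)) / h" for v
    proof (cases "v \<in> ?A - ?A'")
      case True
      then have nv: "norm v < \<mu>" "\<mu> - h \<le> norm v" "v \<noteq> 0" using h by auto
      have sg: "norm (sgn v) \<le> 1" by (simp add: norm_sgn)
      have "v - \<mu> *\<^sub>R sgn v = (norm v - \<mu>) *\<^sub>R sgn v"
        using nv by (simp add: sgn_div_norm algebra_simps)
      then have "norm (v - \<mu> *\<^sub>R sgn v) = \<mu> - norm v"
        using nv by (simp add: norm_sgn)
      then have nd: "norm (v - \<mu> *\<^sub>R sgn v) \<le> h" using nv by simp
      have "\<bar>g (x + v) - g (x + \<mu> *\<^sub>R sgn v)\<bar> \<le> L * norm (v - \<mu> *\<^sub>R sgn v)"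
        using lipschitz_on_normD[OF lip inD[of v] inD[of "\<mu> *\<^sub>R sgn v"]] nv \<mu>
        by (simp add: norm_sgn)
      also have "\<dots> \<le> L * h" using nd L by (intro mult_left_mono)
      finally have 1: "\<bar>g (x + v) - g (x + \<mu> *\<^sub>R sgn v)\<bar> \<le> L * h" .
      have "\<bar>sgn v \<bullet> w\<bar> \<le> norm (sgn v) * norm w" by (rule Cauchy_Schwarz_ineq2)
      also have "\<dots> = norm w" using nv by (simp add: norm_sgn)
      finally have 2: "\<bar>sgn v \<bullet> w\<bar> \<le> norm w" .
      have "(g (x + v) - g (x + \<mu> *\<^sub>R sgn v)) * (sgn v \<bullet> w)
          \<le> \<bar>g (x + v) - g (x + \<mu> *\<^sub>R sgn v)\<bar> * \<bar>sgn v \<bullet> w\<bar>"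
        by (metis abs_ge_self abs_mult)
      also have "\<dots> \<le> L * h * norm w" using 1 2 L h by (intro mult_mono) auto
      finally have "(sgn v \<bullet> w) * g (x + v) \<le> k (sgn v)"
        unfolding k_def by (simp add: algebra_simps)
      then have "(sgn v \<bullet> w) * g (x + v) / h \<le> k (sgn v) / h" using h by (intro divide_right_mono) auto
      then show ?thesis using True by (auto simp: indicator_def)
    next
      case False
      then show ?thesis using h by (auto simp: indicator_def)
    qed
    have sub: "indicator ?A' v \<le> ?\<phi> v \<and> ?\<phi> v \<le> indicator ?A v" for v
      using h cutoff_bounds[of \<mu> h v] cutoff_eq_0[of h \<mu> v] cutoff_eq_1[of h v \<mu>]
      by (auto simp: indicator_def not_less)
    have int\<phi>: "integrable lborel ?\<phi>"
      using h by (intro integrable_bounded_ball[where \<rho>=\<mu> and B=1]) (auto simp: cutoff_bounds cutoff_eq_0)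
    have cball: "(\<integral>v. indicator (ball 0 \<rho>) v \<partial>(lborel::'a measure)) = \<rho> ^ d * V" if "0 < \<rho>" for \<rho>
      using ball_weighted_integral_sgn[of "\<lambda>_::'a. 1" \<rho>] that
      by (simp add: US.prob_space d_def V_def)
    have iA: "integrable lborel (\<lambda>v::'a. indicator (ball 0 \<rho>) v :: real)" for \<rho>
      using integrable_indicator_ball[of 1 "0::'a" \<rho>] by simp
    have lo: "(\<mu> - h) ^ d * V \<le> (\<integral>v. ?\<phi> v \<partial>lborel)"
      unfolding cball[of "\<mu> - h", symmetric, OF diff_gt_0_iff_gt[THEN iffD2, OF h(2)]]
      using sub iA int\<phi> by (intro integral_mono) auto
    have hi: "(\<integral>v. ?\<phi> v \<partial>lborel) \<le> \<mu> ^ d * V"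
      unfolding cball[of "\<mu>", symmetric, OF \<mu>(1)]
      using sub iA int\<phi> by (intro integral_mono) auto
    have "\<bar>\<mu> ^ d * V - (\<integral>v. ?\<phi> v \<partial>lborel)\<bar> \<le> vol h * V"
      using lo hi unfolding vol_def by (simp add: algebra_simps)
    then have "\<bar>\<Delta>\<bar> * \<bar>\<mu> ^ d * V - (\<integral>v. ?\<phi> v \<partial>lborel)\<bar> \<le> \<bar>\<Delta>\<bar> * (vol h * V)"
      by (intro mult_left_mono) auto
    then have "\<Delta> * (\<mu> ^ d * V - (\<integral>v. ?\<phi> v \<partial>lborel)) \<le> \<bar>\<Delta>\<bar> * (vol h * V)"
      unfolding abs_mult[symmetric] by linarith
    then have "\<Delta> * (\<mu> ^ d * V) - \<bar>\<Delta>\<bar> * (vol h * V) \<le> \<Delta> * (\<integral>v. ?\<phi> v \<partial>lborel)"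
      by (simp add: algebra_simps)
    also have "\<dots> \<le> (\<integral>v. indicator (?A - ?A') v * (sgn v \<bullet> w) / h * g (x + v) \<partial>lborel)"
      unfolding \<Delta>_def w_def by (rule sphere_gradient_estimate_shell[OF conv lip meas h \<mu>(2) D])
    also have "\<dots> \<le> (\<integral>v. (indicator ?A v * k (sgn v) - indicator ?A' v * k (sgn v)) / h \<partial>lborel)"
    proof (rule integral_mono)
      show "integrable lborel (\<lambda>v. indicator (?A - ?A') v * (sgn v \<bullet> w) / h * g (x + v))"
      proof (rule integrable_bounded_ball[where \<rho>=\<mu> and B="norm w / h * (\<bar>g x\<bar> + L * \<mu>)"])
        fix v :: 'a assume v: "norm v < \<mu>"
        have "\<bar>g (x + v) - g x\<bar> \<le> L * norm v"
          using lipschitz_on_normD[OF lip inD[of v] xD] v \<mu> by simp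
        also have "\<dots> \<le> L * \<mu>" using L v by (intro mult_left_mono) auto
        finally have 1: "\<bar>g (x + v)\<bar> \<le> \<bar>g x\<bar> + L * \<mu>" by linarith
        have "\<bar>sgn v \<bullet> w\<bar> \<le> norm (sgn v) * norm w" by (rule Cauchy_Schwarz_ineq2)
        also have "\<dots> \<le> norm w" by (simp add: norm_sgn)
        finally have "\<bar>sgn v \<bullet> w\<bar> / h \<le> norm w / h" using h by (intro divide_right_mono) auto
        then have "\<bar>indicator (?A - ?A') v * (sgn v \<bullet> w) / h\<bar> \<le> norm w / h"
          using h by (auto simp: indicator_def)
        then have "\<bar>indicator (?A - ?A') v * (sgn v \<bullet> w) / h\<bar> * \<bar>g (x + v)\<bar> \<le> norm w / h * (\<bar>g x\<bar> + L * \<mu>)"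
          using 1 h by (intro mult_mono) auto
        then show "\<bar>indicator (?A - ?A') v * (sgn v \<bullet> w) / h * g (x + v)\<bar> \<le> norm w / h * (\<bar>g x\<bar> + L * \<mu>)"
          by (simp only: abs_mult)
      qed (auto simp: indicator_def)
      show "integrable lborel (\<lambda>v. (indicator ?A v * k (sgn v) - indicator ?A' v * k (sgn v)) / h)"
        using ik by (intro Bochner_Integration.integrable_diff integrable_divide_zero) auto
    qed (rule pt)
    also have "\<dots> = ((\<integral>v. indicator ?A v * k (sgn v) \<partial>lborel) - (\<integral>v. indicator ?A' v * k (sgn v) \<partial>lborel)) / h"
      using ik by (subst integral_divide_zero, subst Bochner_Integration.integral_diff) auto
    also have "\<dots> = V * (vol h / h * (I + L * h * norm w))"
    proof -
      have "(\<integral>v. indicator (ball 0 \<rho>) v * k (sgn v) \<partial>lborel) = \<rho> ^ d * V * (I + L * h * norm w)" if "0 < \<rho>" for \<rho>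
        using ball_weighted_integral_sgn[of k \<rho>] that by (simp only: kint V_def d_def) simp
      from this[of \<mu>] this[of "\<mu> - h"] show ?thesis
        using h by (simp only: vol_def) (simp add: algebra_simps diff_divide_distrib add_divide_distrib)
    qed
    finally have "V * (\<Delta> * \<mu> ^ d - \<bar>\<Delta>\<bar> * vol h) \<le> V * (vol h / h * (I + L * h * norm w))"
      by (simp add: algebra_simps)
    then show ?thesis using mult_le_cancel_left_pos[OF V] by blast
  qed
  \<comment> \<open>after division by the volume of the unit ball, the shell volume over \<open>h\<close> tends to \<open>d * \<mu> ^ (d - 1)\<close>\<close>
  have dpos: "d > 0" by (simp add: d_def)
  have "((\<lambda>h. \<mu> ^ d - (\<mu> - h) ^ d) has_real_derivative (real d * \<mu> ^ (d - 1))) (at 0)"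
    by (auto intro!: derivative_eq_intros)
  then have q: "((\<lambda>h. vol h / h) \<longlongrightarrow> real d * \<mu> ^ (d - 1)) (at 0)"
    by (simp add: DERIV_def vol_def)
  have q: "((\<lambda>h. vol h / h) \<longlongrightarrow> real d * \<mu> ^ (d - 1)) (at_right 0)"
    by (rule tendsto_mono[OF _ q]) (simp add: at_le)
  have id: "((\<lambda>h. h) \<longlongrightarrow> (0::real)) (at_right 0)" by (simp add: tendsto_ident_at)
  have v0: "(vol \<longlongrightarrow> \<mu> ^ d - (\<mu> - 0) ^ d) (at_right 0)"
    unfolding vol_def by (intro tendsto_intros id)
  have ev: "\<forall>\<^sub>F h in at_right 0. \<Delta> * \<mu> ^ d - \<bar>\<Delta>\<bar> * vol h \<le> vol h / h * (I + L * h * norm w)"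
    unfolding eventually_at_right[OF \<mu>(1)] using main \<mu> by auto
  have "\<Delta> * \<mu> ^ d - \<bar>\<Delta>\<bar> * (\<mu> ^ d - (\<mu> - 0) ^ d) \<le> real d * \<mu> ^ (d - 1) * (I + L * 0 * norm w)"
  proof (rule tendsto_le[OF _ _ _ ev])
    show "((\<lambda>h. vol h / h * (I + L * h * norm w)) \<longlongrightarrow> real d * \<mu> ^ (d - 1) * (I + L * 0 * norm w)) (at_right 0)"
      by (intro tendsto_mult tendsto_add tendsto_const q id)
    show "((\<lambda>h. \<Delta> * \<mu> ^ d - \<bar>\<Delta>\<bar> * vol h) \<longlongrightarrow> \<Delta> * \<mu> ^ d - \<bar>\<Delta>\<bar> * (\<mu> ^ d - (\<mu> - 0) ^ d)) (at_right 0)"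
      by (intro tendsto_mult tendsto_diff tendsto_const v0)
  qed simp
  then have "\<Delta> * \<mu> ^ d \<le> real d * \<mu> ^ (d - 1) * I" by simp
  moreover have "\<mu> ^ d = \<mu> ^ (d - 1) * \<mu>"
    using dpos by (metis One_nat_def Suc_pred power_Suc2)
  ultimately have "\<mu> ^ (d - 1) * (\<Delta> * \<mu>) \<le> \<mu> ^ (d - 1) * (real d * I)"
    by (simp add: algebra_simps)
  then have "\<Delta> * \<mu> \<le> real d * I" using \<mu> by simp
  then have "\<Delta> \<le> real d / \<mu> * I" using \<mu> by (simp add: field_simps)
  then show ?thesis unfolding \<Delta>_def I_def d_def w_def .
qed

section \<open>Expectations under product laws\<close>

text \<open>
  As \<open>indep_var\<close> relates variables of one and the same type, images of such variables under maps
  into different types are handled through their joint law.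
\<close>

lemma (in prob_space) indep_var_pair_distr:
  assumes ind: "indep_var A X B X'" and f: "f \<in> measurable A S" and g: "g \<in> measurable B T"
  shows "distr M (S \<Otimes>\<^sub>M T) (\<lambda>w. (f (X w), g (X' w)))
       = distr M S (\<lambda>w. f (X w)) \<Otimes>\<^sub>M distr M T (\<lambda>w. g (X' w))"
proof -
  have [measurable]: "X \<in> measurable M A" "X' \<in> measurable M B"
    using ind by (auto dest: indep_var_rv1 indep_var_rv2)
  note [measurable] = f g
  interpret B: prob_space "distr (distr M B X') T g"
    by (intro prob_space.prob_space_distr prob_space_distr) auto
  have "distr M (S \<Otimes>\<^sub>M T) (\<lambda>w. (f (X w), g (X' w)))
      = distr (distr M (A \<Otimes>\<^sub>M B) (\<lambda>w. (X w, X' w))) (S \<Otimes>\<^sub>M T) (\<lambda>(x, y). (f x, g y))"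
    by (subst distr_distr) (auto simp: comp_def)
  also have "\<dots> = distr (distr M A X \<Otimes>\<^sub>M distr M B X') (S \<Otimes>\<^sub>M T) (\<lambda>(x, y). (f x, g y))"
    using ind unfolding indep_var_distribution_eq by simp
  also have "\<dots> = distr (distr M A X) S f \<Otimes>\<^sub>M distr (distr M B X') T g"
    by (rule pair_measure_distr[symmetric]) (auto intro: B.sigma_finite_measure_axioms)
  also have "\<dots> = distr M S (\<lambda>w. f (X w)) \<Otimes>\<^sub>M distr M T (\<lambda>w. g (X' w))"
    by (simp add: distr_distr comp_def)
  finally show ?thesis .
qed

lemma (in prob_space) product_law_nn_integral:
  assumes Y [measurable]: "Y \<in> measurable M S" and Z [measurable]: "Z \<in> measurable M T"
    and T: "prob_space T"
    and law: "distr M (S \<Otimes>\<^sub>M T) (\<lambda>w. (Y w, Z w)) = distr M S Y \<Otimes>\<^sub>M T"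
    and f [measurable]: "f \<in> borel_measurable (S \<Otimes>\<^sub>M T)"
  shows "(\<integral>\<^sup>+w. f (Y w, Z w) \<partial>M) = (\<integral>\<^sup>+w. (\<integral>\<^sup>+z. f (Y w, z) \<partial>T) \<partial>M)"
proof -
  interpret T: prob_space T by (rule T)
  have "(\<integral>\<^sup>+w. f (Y w, Z w) \<partial>M) = (\<integral>\<^sup>+p. f p \<partial>distr M (S \<Otimes>\<^sub>M T) (\<lambda>w. (Y w, Z w)))"
    by (subst nn_integral_distr) auto
  also have "\<dots> = (\<integral>\<^sup>+p. f p \<partial>(distr M S Y \<Otimes>\<^sub>M T))"
    unfolding law ..
  also have "\<dots> = (\<integral>\<^sup>+y. (\<integral>\<^sup>+z. f (y, z) \<partial>T) \<partial>distr M S Y)"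
    by (subst T.nn_integral_fst[symmetric]) (auto cong: measurable_cong_sets sets_pair_measure_cong)
  also have "\<dots> = (\<integral>\<^sup>+w. (\<integral>\<^sup>+z. f (Y w, z) \<partial>T) \<partial>M)"
    by (subst nn_integral_distr) auto
  finally show ?thesis .
qed

lemma (in prob_space) product_law_integral:
  fixes f :: "_ \<Rightarrow> real"
  assumes Y [measurable]: "Y \<in> measurable M S" and Z [measurable]: "Z \<in> measurable M T"
    and T: "prob_space T"
    and law: "distr M (S \<Otimes>\<^sub>M T) (\<lambda>w. (Y w, Z w)) = distr M S Y \<Otimes>\<^sub>M T"
    and f [measurable]: "f \<in> borel_measurable (S \<Otimes>\<^sub>M T)"
    and int: "integrable M (\<lambda>w. f (Y w, Z w))"
  shows "(\<integral>w. f (Y w, Z w) \<partial>M) = (\<integral>w. (\<integral>z. f (Y w, z) \<partial>T) \<partial>M)"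
    and "integrable M (\<lambda>w. \<integral>z. f (Y w, z) \<partial>T)"
proof -
  interpret T: prob_space T by (rule T)
  interpret S: prob_space "distr M S Y"
    by (rule prob_space_distr) simp
  interpret ST: pair_prob_space "distr M S Y" T ..
  have "integrable (distr M (S \<Otimes>\<^sub>M T) (\<lambda>w. (Y w, Z w))) f"
    using int by (subst integrable_distr_eq) auto
  then have i: "integrable (distr M S Y \<Otimes>\<^sub>M T) f"
    unfolding law .
  have "(\<integral>w. f (Y w, Z w) \<partial>M) = (\<integral>p. f p \<partial>distr M (S \<Otimes>\<^sub>M T) (\<lambda>w. (Y w, Z w)))"
    by (subst integral_distr) auto
  also have "\<dots> = (\<integral>p. f p \<partial>(distr M S Y \<Otimes>\<^sub>M T))"
    unfolding law ..
  also have "\<dots> = (\<integral>y. (\<integral>z. f (y, z) \<partial>T) \<partial>distr M S Y)"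
    by (rule ST.integral_fst'[OF i, symmetric])
  also have "\<dots> = (\<integral>w. (\<integral>z. f (Y w, z) \<partial>T) \<partial>M)"
    by (subst integral_distr) auto
  finally show "(\<integral>w. f (Y w, Z w) \<partial>M) = (\<integral>w. (\<integral>z. f (Y w, z) \<partial>T) \<partial>M)" .
  have "integrable (distr M S Y) (\<lambda>y. \<integral>z. f (y, z) \<partial>T)"
    by (rule ST.integrable_fst'[OF i])
  then show "integrable M (\<lambda>w. \<integral>z. f (Y w, z) \<partial>T)"
    by (subst (asm) integrable_distr_eq) auto
qed

section \<open>A run of Com-DSZO as a function of its draws\<close>

lemma norm_vec_power2: "(norm (X :: 'a::real_inner ^ 'n))\<^sup>2 = (\<Sum>i\<in>UNIV. (norm (X $ i))\<^sup>2)"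
  by (simp add: power2_norm_eq_inner inner_vec_def)

lemma norm_add_power2_le: "(norm (a + b :: 'a::real_inner))\<^sup>2 \<le> 2 * (norm a)\<^sup>2 + 2 * (norm b)\<^sup>2"
proof -
  have "(norm (a + b))\<^sup>2 + (norm (a - b))\<^sup>2 = 2 * (norm a)\<^sup>2 + 2 * (norm b)\<^sup>2"
    by (simp add: power2_norm_eq_inner inner_add inner_diff inner_commute)
  then show ?thesis using zero_le_power2[of "norm (a - b)"] by linarith
qed

lemma norm_diff_power2_le: "(norm (a - b :: 'a::real_inner))\<^sup>2 \<le> 2 * (norm a)\<^sup>2 + 2 * (norm b)\<^sup>2"
  using norm_add_power2_le[of a "- b"] by simp

text \<open>
  Any bound on the operator \<open>I - W\<close> suffices, since it only enters the constant of the final rate.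
\<close>

lemma matrix_action_defect_bound:
  fixes W :: "real ^ 'n ^ ('n::finite)"
  obtains K where "K \<ge> 0" "\<And>Z :: 'a::euclidean_space ^ 'n. norm (Z - matrix_action W Z) \<le> K * norm Z"
proof -
  have "linear (\<lambda>Z :: 'a ^ 'n. Z - matrix_action W Z)"
    by (rule linearI)
       (auto simp: matrix_action_def vec_eq_iff algebra_simps sum.distrib scaleR_sum_right)
  then have "bounded_linear (\<lambda>Z :: 'a ^ 'n. Z - matrix_action W Z)"
    by (rule linear_conv_bounded_linear[THEN iffD1])
  from bounded_linear.nonneg_bounded[OF this] show ?thesis
    using that by (metis mult.commute)
qed

text \<open>
  One run with a fixed horizon.  Besides the radius \<open>R\<close> of \<open>\<Omega>\<close> it fixes a margin \<open>\<delta>\<close> such that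
  all objectives are convex and Lipschitz within distance \<open>\<delta>\<close> of \<open>\<Omega>\<close>; since \<open>\<mu> < \<delta>\<close>, every query
  point lies in that region.
\<close>

locale com_dszo_run =
  fixes N :: "'n::finite \<Rightarrow> 'n set" and W :: "real ^ 'n ^ 'n"
    and \<Omega> D :: "'a::euclidean_space set"
    and P :: "'n \<Rightarrow> 's measure" and F :: "'n \<Rightarrow> 'a \<Rightarrow> 's \<Rightarrow> real"
    and M :: "'w measure" and Q :: "'z measure" and C :: "'z \<Rightarrow> 'a \<Rightarrow> 'a"
    and \<xi> :: "'n \<Rightarrow> nat \<Rightarrow> 'w \<Rightarrow> 's" and u :: "'n \<Rightarrow> nat \<Rightarrow> 'w \<Rightarrow> 'a" and \<zeta> :: "'n \<Rightarrow> nat \<Rightarrow> 'w \<Rightarrow> 'z"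
    and \<eta> :: "nat \<Rightarrow> real" and \<mu> \<epsilon> \<psi> \<gamma> r \<omega> L R \<delta> K :: real and X0 :: "'a ^ 'n"
  assumes closed: "closed \<Omega>" and convex: "convex \<Omega>" and zero_in: "0 \<in> \<Omega>" and sub_R: "\<Omega> \<subseteq> cball 0 R"
    and X0_in: "X0 $ i \<in> \<Omega>"
    and \<epsilon>: "0 \<le> \<epsilon>" "\<epsilon> \<le> 1" and \<mu>: "0 < \<mu>" "\<mu> < \<delta>"
    and nbhd: "x \<in> \<Omega> \<Longrightarrow> ball x \<delta> \<subseteq> D"
    and F_convex: "s \<in> space (P i) \<Longrightarrow> convex_on D (\<lambda>x. F i x s)"
    and F_lipschitz: "s \<in> space (P i) \<Longrightarrow> L-lipschitz_on D (\<lambda>x. F i x s)"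
    and L_nonneg: "0 \<le> L"
    and objective: "stochastic_objective P F \<Omega>"
    and draws: "fresh_draws M P Q \<xi> u \<zeta>"
    and compressor: "assumption_A5 Q C r \<omega>"
    and \<psi>: "0 < \<psi>" "\<psi> * r \<le> 1" and \<gamma>: "0 \<le> \<gamma>" and \<eta>: "0 \<le> \<eta> k"
    and W_rows: "(\<Sum>j\<in>UNIV. W $ i $ j) = 1" and W_cols: "(\<Sum>i\<in>UNIV. W $ i $ j) = 1"
    and W_support: "j \<notin> N i \<Longrightarrow> W $ i $ j = 0"
    and K: "0 \<le> K" "norm (Z - matrix_action W Z) \<le> K * norm (Z :: 'a ^ 'n)"
begin

definition draw_space :: "'n \<Rightarrow> ('s \<times> 'a \<times> 'z) measure" where
  "draw_space i = P i \<Otimes>\<^sub>M uniform_sphere \<Otimes>\<^sub>M Q"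

definition draw :: "'w \<Rightarrow> 'n \<times> nat \<Rightarrow> 's \<times> 'a \<times> 'z" where
  "draw w = (\<lambda>(i, k). (\<xi> i k w, u i k w, \<zeta> i k w))"

definition past :: "nat \<Rightarrow> ('n \<times> nat) set" where
  "past k = UNIV \<times> {..<k}"

text \<open>
  The run as a function of all its draws, indexed by agent and step.  Making this dependence
  explicit separates the algebra of the algorithm from its probability.
\<close>

definition path :: "('n \<times> nat \<Rightarrow> 's \<times> 'a \<times> 'z) \<Rightarrow> nat \<Rightarrow> ('a, 'n) dszo_state" where
  "path h = com_dszo N W \<Omega> F C \<eta> \<mu> \<epsilon> \<psi> \<gamma> X0
     (\<lambda>i k. fst (h (i, k))) (\<lambda>i k. fst (snd (h (i, k)))) (\<lambda>i k. snd (snd (h (i, k))))"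

definition x_at :: "('n \<times> nat \<Rightarrow> 's \<times> 'a \<times> 'z) \<Rightarrow> nat \<Rightarrow> 'n \<Rightarrow> 'a" where
  "x_at h k i = st_x (path h k) $ i"

definition xhat_at :: "('n \<times> nat \<Rightarrow> 's \<times> 'a \<times> 'z) \<Rightarrow> nat \<Rightarrow> 'n \<Rightarrow> 'a" where
  "xhat_at h k i = st_xhat (path h k) $ i"

definition g_at :: "('n \<times> nat \<Rightarrow> 's \<times> 'a \<times> 'z) \<Rightarrow> nat \<Rightarrow> 'n \<Rightarrow> 'a" where
  "g_at h k i = grad_est (F i) \<mu> (x_at h k i) (fst (h (i, k))) (fst (snd (h (i, k))))"

text \<open>
  The correction variable \<open>b\<close> is \<open>(I - W)\<close> applied to the estimates, see \<open>path_b\<close> below.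
\<close>

definition b_at :: "('n \<times> nat \<Rightarrow> 's \<times> 'a \<times> 'z) \<Rightarrow> nat \<Rightarrow> 'n \<Rightarrow> 'a" where
  "b_at h k i = xhat_at h k i - (\<Sum>j\<in>UNIV. W $ i $ j *\<^sub>R xhat_at h k j)"

lemma shrink_closed: "closed (shrink \<epsilon> \<Omega>)" and shrink_convex: "convex (shrink \<epsilon> \<Omega>)"
  and shrink_nonempty: "shrink \<epsilon> \<Omega> \<noteq> {}" and shrink_subset: "shrink \<epsilon> \<Omega> \<subseteq> \<Omega>"
proof -
  show "closed (shrink \<epsilon> \<Omega>)" "convex (shrink \<epsilon> \<Omega>)" "shrink \<epsilon> \<Omega> \<noteq> {}"
    using closed convex zero_in unfolding shrink_def by (auto intro: closed_scaling convex_scaling)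
  show "shrink \<epsilon> \<Omega> \<subseteq> \<Omega>"
    using convexD[OF convex _ zero_in, of _ "1 - \<epsilon>" \<epsilon>] \<epsilon> unfolding shrink_def by auto
qed

lemma path_q: "st_q (path h k) $ i = C (snd (snd (h (i, k)))) (x_at h k i - xhat_at h k i)"
  by (cases k) (auto simp: path_def x_at_def xhat_at_def Let_def)

lemma x_at_0: "x_at h 0 i = X0 $ i" and xhat_at_0: "xhat_at h 0 i = 0"
  by (auto simp: path_def x_at_def xhat_at_def)

lemma xhat_at_Suc:
  "xhat_at h (Suc k) i = xhat_at h k i + \<psi> *\<^sub>R C (snd (snd (h (i, k)))) (x_at h k i - xhat_at h k i)"
  using path_q[of h k i] by (simp add: path_def xhat_at_def x_at_def Let_def)

lemma sum_neighbours: "(\<Sum>j\<in>N i. W $ i $ j *\<^sub>R (v j :: 'a)) = (\<Sum>j\<in>UNIV. W $ i $ j *\<^sub>R v j)"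
  by (rule sum.mono_neutral_left) (auto simp: W_support)

lemma path_b: "st_b (path h k) $ i = b_at h k i"
proof (induction k arbitrary: i)
  case 0
  show ?case by (simp add: b_at_def xhat_at_0) (simp add: path_def)
next
  case (Suc k)
  have "st_b (path h (Suc k)) $ i
      = st_b (path h k) $ i + \<psi> *\<^sub>R (st_q (path h k) $ i - (\<Sum>j\<in>N i. W $ i $ j *\<^sub>R st_q (path h k) $ j))"
    by (simp add: path_def Let_def)
  also have "\<dots> = b_at h (Suc k) i"
    unfolding Suc.IH sum_neighbours path_q
    by (simp add: b_at_def xhat_at_Suc algebra_simps scaleR_sum_right sum.distrib)
  finally show ?case .
qed

lemma x_at_Suc:
  "x_at h (Suc k) i = closest_point (shrink \<epsilon> \<Omega>) (x_at h k i - \<gamma> *\<^sub>R b_at h (Suc k) i - \<eta> k *\<^sub>R g_at h k i)"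
  using path_b[of h "Suc k" i] by (simp add: path_def x_at_def g_at_def Let_def)

lemma x_at_in: "x_at h k i \<in> \<Omega>"
proof (cases k)
  case (Suc m)
  show ?thesis
    unfolding Suc x_at_Suc using closest_point_in_set[OF shrink_closed shrink_nonempty] shrink_subset by blast
qed (simp add: x_at_0 X0_in)

text \<open>
  The iterate and the estimate at step \<open>k\<close> depend on the draws of the steps before \<open>k\<close> only,
  because the compressor randomness of step \<open>k\<close> first acts in the update to step \<open>k + 1\<close>.  This is
  what makes them independent of all draws of step \<open>k\<close>.
\<close>

lemma x_at_xhat_at_cong:
  assumes "\<And>p. p \<in> past k \<Longrightarrow> h p = h' p"
  shows "x_at h k i = x_at h' k i \<and> xhat_at h k i = xhat_at h' k i"
  using assms
proof (induction k arbitrary: i)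
  case (Suc k)
  have IH: "x_at h k i = x_at h' k i" "xhat_at h k i = xhat_at h' k i" for i
    using Suc by (auto simp: past_def)
  have h: "h (i, k) = h' (i, k)" for i
    using Suc.prems by (simp add: past_def)
  have hat: "xhat_at h (Suc k) i = xhat_at h' (Suc k) i" for i
    by (simp add: xhat_at_Suc IH h)
  then show ?case by (simp add: x_at_Suc b_at_def g_at_def IH h)
qed (simp add: x_at_0 xhat_at_0)

lemma prob_spaces: "prob_space (P i)" "prob_space Q" "prob_space M"
  using objective draws by (auto simp: stochastic_objective_def fresh_draws_def)

lemma F_measurable [measurable]:
  assumes "f \<in> borel_measurable A" "g \<in> measurable A (P i)"
  shows "(\<lambda>w. F i (f w) (g w)) \<in> borel_measurable A"
proof -
  have F: "(\<lambda>(x, s). F i x s) \<in> borel_measurable (borel \<Otimes>\<^sub>M P i)"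
    using objective by (auto simp: stochastic_objective_def)
  show ?thesis
    using measurable_compose[OF measurable_Pair[OF assms] F] by simp
qed

lemma C_measurable [measurable]:
  assumes "g \<in> measurable A Q" "f \<in> borel_measurable A"
  shows "(\<lambda>w. C (g w) (f w)) \<in> borel_measurable A"
proof -
  have C: "(\<lambda>(z, x). C z x) \<in> borel_measurable (Q \<Otimes>\<^sub>M borel)"
    using compressor by (auto simp: assumption_A5_def)
  show ?thesis
    using measurable_compose[OF measurable_Pair[OF assms] C] by simp
qed

lemma closest_point_measurable [measurable]:
  "closest_point (shrink \<epsilon> \<Omega>) \<in> borel_measurable borel"
  using continuous_on_closest_point[OF shrink_convex shrink_closed shrink_nonempty]
  by (rule borel_measurable_continuous_onI)

lemma draw_parts_measurable:
  "(\<lambda>t. fst t) \<in> measurable (draw_space i) (P i)"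
  "(\<lambda>t. fst (snd t)) \<in> borel_measurable (draw_space i)"
  "(\<lambda>t. snd (snd t)) \<in> measurable (draw_space i) Q"
proof -
  show "(\<lambda>t. fst t) \<in> measurable (draw_space i) (P i)" "(\<lambda>t. snd (snd t)) \<in> measurable (draw_space i) Q"
    unfolding draw_space_def by measurable
  have "(\<lambda>t. fst (snd t)) \<in> measurable (draw_space i) uniform_sphere"
    unfolding draw_space_def by measurable
  then show "(\<lambda>t. fst (snd t)) \<in> borel_measurable (draw_space i)"
    by (simp add: uniform_sphere_def)
qed

text \<open>
  Histories of length \<open>m \<ge> k\<close> are admitted to make the induction on \<open>k\<close> go through on one fixed
  product space.
\<close>

lemma x_at_xhat_at_measurable:
  assumes "k \<le> m"
  shows "(\<lambda>h. x_at h k i) \<in> borel_measurable (PiM (past m) (\<lambda>(i, k). draw_space i))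
    \<and> (\<lambda>h. xhat_at h k i) \<in> borel_measurable (PiM (past m) (\<lambda>(i, k). draw_space i))"
  using assms
proof (induction k arbitrary: i)
  case 0
  show ?case by (simp add: x_at_0 xhat_at_0)
next
  case (Suc k)
  let ?H = "PiM (past m) (\<lambda>(i, k). draw_space i)"
  have [measurable]: "(\<lambda>h. x_at h k i) \<in> borel_measurable ?H" "(\<lambda>h. xhat_at h k i) \<in> borel_measurable ?H" for i
    using Suc by auto
  have "(i, k) \<in> past m" for i using Suc.prems by (simp add: past_def)
  then have comp: "(\<lambda>h. h (i, k)) \<in> measurable ?H (draw_space i)" for i
    using measurable_component_singleton[of "(i, k)" "past m" "\<lambda>(i, k). draw_space i"] by simp
  have [measurable]: "(\<lambda>h. fst (h (i, k))) \<in> measurable ?H (P i)"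
    "(\<lambda>h. fst (snd (h (i, k)))) \<in> borel_measurable ?H"
    "(\<lambda>h. snd (snd (h (i, k)))) \<in> measurable ?H Q" for i
    using draw_parts_measurable[of i, THEN measurable_compose[OF comp]] by auto
  have hat [measurable]: "(\<lambda>h. xhat_at h (Suc k) i) \<in> borel_measurable ?H" for i
    unfolding xhat_at_Suc by measurable
  have "(\<lambda>h. x_at h (Suc k) i) \<in> borel_measurable ?H"
    unfolding x_at_Suc b_at_def g_at_def grad_est_def by measurable
  with hat show ?case by simp
qed

end

section \<open>Independence and the mean of the gradient estimates\<close>

lemma norm_grad_est_le:
  fixes Fi :: "'a::euclidean_space \<Rightarrow> 's \<Rightarrow> real"
  assumes lip: "L-lipschitz_on D (\<lambda>x. Fi x s)" and \<mu>: "0 < \<mu>"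
    and D: "x \<in> D" "x + \<mu> *\<^sub>R v \<in> D" and v: "norm v \<le> 1"
  shows "norm (grad_est Fi \<mu> x s v) \<le> real DIM('a) * L"
proof -
  have L: "L \<ge> 0" using lip by (rule lipschitz_on_nonneg)
  have "\<bar>Fi (x + \<mu> *\<^sub>R v) s - Fi x s\<bar> \<le> L * (\<mu> * norm v)"
    using lipschitz_on_normD[OF lip D(2,1)] \<mu> by simp
  also have "\<dots> \<le> L * (\<mu> * 1)"
    using L \<mu> v by (intro mult_left_mono) auto
  finally have "real DIM('a) / \<mu> * \<bar>Fi (x + \<mu> *\<^sub>R v) s - Fi x s\<bar> \<le> real DIM('a) / \<mu> * (L * \<mu>)"
    using \<mu> by (intro mult_left_mono) auto
  also have "\<dots> = real DIM('a) * L" using \<mu> by simp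
  finally have a: "real DIM('a) / \<mu> * \<bar>Fi (x + \<mu> *\<^sub>R v) s - Fi x s\<bar> \<le> real DIM('a) * L" .
  have "real DIM('a) / \<mu> * \<bar>Fi (x + \<mu> *\<^sub>R v) s - Fi x s\<bar> * norm v \<le> real DIM('a) * L * 1"
    using L by (intro mult_mono[OF a v]) auto
  then show ?thesis
    using \<mu> by (simp add: grad_est_def abs_mult)
qed

context com_dszo_run
begin

sublocale prob_space M by (rule prob_spaces)

lemma draw_space_prob: "prob_space (draw_space i)"
proof -
  show ?thesis unfolding draw_space_def
    by (intro prob_space_pair prob_spaces prob_space_uniform_sphere)
qed

lemma draw_measurable [measurable]: "(\<lambda>w. draw w (i, k)) \<in> measurable M (draw_space i)"
proof -
  have "indep_vars (\<lambda>(i, k). P i \<Otimes>\<^sub>M uniform_sphere \<Otimes>\<^sub>M Q) (\<lambda>(i, k) w. (\<xi> i k w, u i k w, \<zeta> i k w)) UNIV"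
    using draws by (simp add: fresh_draws_def)
  then show ?thesis
    unfolding indep_vars_def by (force simp: draw_space_def draw_def)
qed

lemma draw_law: "distr M (draw_space i) (\<lambda>w. draw w (i, k)) = draw_space i"
  using draws by (simp add: fresh_draws_def draw_space_def draw_def)

text \<open>
  Quantities determined by the past and the current draw of an agent have a product law, so
  expectations can be computed by first integrating over the current draw.
\<close>

lemma past_independent:
  assumes Y: "Y \<in> measurable (PiM (past k) (\<lambda>(i, k). draw_space i)) S"
  shows "(\<lambda>w. Y (restrict (draw w) (past k))) \<in> measurable M S"
    and "distr M (S \<Otimes>\<^sub>M draw_space i) (\<lambda>w. (Y (restrict (draw w) (past k)), draw w (i, k)))
       = distr M S (\<lambda>w. Y (restrict (draw w) (past k))) \<Otimes>\<^sub>M draw_space i"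
proof -
  let ?D = "\<lambda>(i, k :: nat). draw_space i"
  have "indep_vars (\<lambda>(i, k). P i \<Otimes>\<^sub>M uniform_sphere \<Otimes>\<^sub>M Q) (\<lambda>(i, k) w. (\<xi> i k w, u i k w, \<zeta> i k w)) UNIV"
    using draws by (simp add: fresh_draws_def)
  then have ind: "indep_vars ?D (\<lambda>p w. draw w p) UNIV"
    by (simp add: draw_space_def draw_def case_prod_unfold)
  have ind': "indep_var (PiM (past k) ?D) (\<lambda>w. restrict (\<lambda>p. draw w p) (past k))
          (PiM {(i, k)} ?D) (\<lambda>w. restrict (\<lambda>p. draw w p) {(i, k)})"
    by (rule indep_var_restrict[OF ind]) (auto simp: past_def)
  have g: "(\<lambda>f. f (i, k)) \<in> measurable (PiM {(i, k)} ?D) (draw_space i)"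
    using measurable_component_singleton[of "(i, k)" "{(i, k)}" ?D] by simp
  show "(\<lambda>w. Y (restrict (draw w) (past k))) \<in> measurable M S"
    using measurable_compose[OF indep_var_rv1[OF ind'] Y] by simp
  show "distr M (S \<Otimes>\<^sub>M draw_space i) (\<lambda>w. (Y (restrict (draw w) (past k)), draw w (i, k)))
       = distr M S (\<lambda>w. Y (restrict (draw w) (past k))) \<Otimes>\<^sub>M draw_space i"
    using indep_var_pair_distr[OF ind' Y g] by (simp add: draw_law)
qed

lemma x_at_past: "x_at (restrict h (past k)) k i = x_at h k i"
  and xhat_at_past: "xhat_at (restrict h (past k)) k i = xhat_at h k i"
  using x_at_xhat_at_cong[of k "restrict h (past k)" h i] by auto

lemma x_at_borel [measurable]: "(\<lambda>w. x_at (draw w) k i) \<in> borel_measurable M"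
  and x_at_law: "distr M (borel \<Otimes>\<^sub>M draw_space i) (\<lambda>w. (x_at (draw w) k i, draw w (i, k)))
    = distr M borel (\<lambda>w. x_at (draw w) k i) \<Otimes>\<^sub>M draw_space i"
  using past_independent(1)[where Y="\<lambda>h. x_at h k i" and k=k and S=borel]
    past_independent(2)[where Y="\<lambda>h. x_at h k i" and k=k and S=borel and i=i] x_at_xhat_at_measurable[of k k i]
  by (simp_all add: x_at_past)

lemma gap_borel [measurable]: "(\<lambda>w. x_at (draw w) k i - xhat_at (draw w) k i) \<in> borel_measurable M"
  and gap_law: "distr M (borel \<Otimes>\<^sub>M draw_space i) (\<lambda>w. (x_at (draw w) k i - xhat_at (draw w) k i, draw w (i, k)))
    = distr M borel (\<lambda>w. x_at (draw w) k i - xhat_at (draw w) k i) \<Otimes>\<^sub>M draw_space i"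
  using past_independent(1)[where Y="\<lambda>h. x_at h k i - xhat_at h k i" and k=k and S=borel]
    past_independent(2)[where Y="\<lambda>h. x_at h k i - xhat_at h k i" and k=k and S=borel and i=i] x_at_xhat_at_measurable[of k k i]
  by (auto simp: x_at_past xhat_at_past)

lemma xhat_at_borel [measurable]: "(\<lambda>w. xhat_at (draw w) k i) \<in> borel_measurable M"
proof -
  have "(\<lambda>w. x_at (draw w) k i - (x_at (draw w) k i - xhat_at (draw w) k i)) \<in> borel_measurable M"
    by (intro borel_measurable_diff x_at_borel gap_borel)
  then show ?thesis by simp
qed

lemma draw_parts_borel [measurable]:
  "(\<lambda>w. fst (draw w (i, k))) \<in> measurable M (P i)"
  "(\<lambda>w. fst (snd (draw w (i, k)))) \<in> borel_measurable M"
  "(\<lambda>w. snd (snd (draw w (i, k)))) \<in> measurable M Q"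
  using draw_parts_measurable[of i, THEN measurable_compose[OF draw_measurable]] by auto

lemma g_at_borel [measurable]: "(\<lambda>w. g_at (draw w) k i) \<in> borel_measurable M"
  unfolding g_at_def grad_est_def by measurable

lemma AE_draw_space: "AE t in draw_space i. norm (fst (snd t)) \<le> 1"
proof -
  interpret P: prob_space "P i" by (rule prob_spaces)
  interpret Q: prob_space Q by (rule prob_spaces)
  interpret US: prob_space "uniform_sphere :: 'a measure" by (rule prob_space_uniform_sphere)
  interpret UQ: pair_prob_space "uniform_sphere :: 'a measure" Q ..
  interpret PUQ: pair_prob_space "P i" "(uniform_sphere :: 'a measure) \<Otimes>\<^sub>M Q" ..
  have 1: "AE p in (uniform_sphere :: 'a measure) \<Otimes>\<^sub>M Q. norm (fst p) \<le> 1"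
    by (rule UQ.AE_pair_measure) (use AE_uniform_sphere_norm_le in auto)
  show ?thesis unfolding draw_space_def
    by (rule PUQ.AE_pair_measure) (use 1 in auto)
qed

lemma AE_direction: "AE w in M. norm (fst (snd (draw w (i, k)))) \<le> 1"
proof -
  have "AE t in distr M (draw_space i) (\<lambda>w. draw w (i, k)). norm (fst (snd t)) \<le> 1"
    unfolding draw_law by (rule AE_draw_space)
  then show ?thesis
    using draw_parts_measurable(2)[of i] by (subst (asm) AE_distr_iff) auto
qed

lemma \<Omega>_D: "x \<in> \<Omega> \<Longrightarrow> x \<in> D" "x \<in> \<Omega> \<Longrightarrow> norm v \<le> 1 \<Longrightarrow> x + \<mu> *\<^sub>R v \<in> D"
proof -
  assume x: "x \<in> \<Omega>"
  show "x \<in> D" using nbhd[OF x] \<mu> by (auto simp: subset_iff)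
  assume "norm v \<le> 1"
  then have "\<mu> * norm v \<le> \<mu>" using \<mu> by (simp add: mult_left_le)
  then have "\<mu> * norm v < \<delta>" using \<mu> by linarith
  then show "x + \<mu> *\<^sub>R v \<in> D" using nbhd[OF x] \<mu> by (auto simp: subset_iff dist_norm)
qed

lemma norm_g_at_le: "AE w in M. norm (g_at (draw w) k i) \<le> real DIM('a) * L"
  using AE_direction[of i k] AE_space
proof eventually_elim
  case (elim w)
  have "fst (draw w (i, k)) \<in> space (P i)"
    using draw_parts_borel(1)[of i k] elim(2) by (rule measurable_space)
  then show ?case
    unfolding g_at_def using elim
    by (intro norm_grad_est_le[where Fi="F i" and D=D, OF F_lipschitz] \<mu> \<Omega>_D x_at_in)
qed

lemma diameter: "x \<in> \<Omega> \<Longrightarrow> norm x \<le> R" "x \<in> \<Omega> \<Longrightarrow> y \<in> \<Omega> \<Longrightarrow> norm (x - y) \<le> 2 * R"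
proof -
  show *: "norm x \<le> R" if "x \<in> \<Omega>" for x using sub_R that by auto
  show "norm (x - y) \<le> 2 * R" if "x \<in> \<Omega>" "y \<in> \<Omega>"
    using norm_triangle_ineq4[of x y] *[OF that(1)] *[OF that(2)] by linarith
qed

text \<open>
  For a fixed sample the sphere estimate applies to \<open>F i\<close> as it stands, so it is used before
  averaging over the sample; the inequality is linear in \<open>F i\<close> and thus survives the average.
\<close>

lemma grad_est_inner_mean:
  assumes x: "x \<in> \<Omega>" and y: "y \<in> \<Omega>"
  shows "local_obj P F i x - local_obj P F i y - 2 * L * \<mu>
    \<le> (\<integral>t. grad_est (F i) \<mu> x (fst t) (fst (snd t)) \<bullet> (x - y) \<partial>draw_space i)"
proof -
  interpret P: prob_space "P i" by (rule prob_spaces)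
  interpret Q: prob_space Q by (rule prob_spaces)
  interpret US: prob_space "uniform_sphere :: 'a measure" by (rule prob_space_uniform_sphere)
  interpret UQ: pair_prob_space "uniform_sphere :: 'a measure" Q ..
  interpret PUQ: pair_prob_space "P i" "(uniform_sphere :: 'a measure) \<Otimes>\<^sub>M Q" ..
  interpret T: prob_space "draw_space i" by (rule draw_space_prob)
  let ?\<phi> = "\<lambda>s v. grad_est (F i) \<mu> x s v \<bullet> (x - y)"
  have [measurable]: "(\<lambda>t. fst t) \<in> measurable (draw_space i) (P i)"
    "(\<lambda>t. fst (snd t)) \<in> borel_measurable (draw_space i)"
    by (rule draw_parts_measurable)+
  have "AE t in draw_space i. norm (?\<phi> (fst t) (fst (snd t))) \<le> real DIM('a) * L * norm (x - y)"
    using AE_draw_space AE_space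
  proof eventually_elim
    case (elim t)
    then have s: "fst t \<in> space (P i)" by (auto simp: draw_space_def space_pair_measure)
    have "norm (?\<phi> (fst t) (fst (snd t))) \<le> norm (grad_est (F i) \<mu> x (fst t) (fst (snd t))) * norm (x - y)"
      using Cauchy_Schwarz_ineq2 by simp
    also have "\<dots> \<le> real DIM('a) * L * norm (x - y)"
      using elim x by (intro mult_right_mono norm_grad_est_le[where Fi="F i" and s="fst t" and D=D, OF F_lipschitz[OF s]] \<mu> \<Omega>_D) auto
    finally show ?case .
  qed
  then have int: "integrable (draw_space i) (\<lambda>t. ?\<phi> (fst t) (fst (snd t)))"
    unfolding grad_est_def by (rule T.integrable_const_bound) measurable
  have inner: "(\<integral>p. ?\<phi> s (fst p) \<partial>(uniform_sphere \<Otimes>\<^sub>M Q)) = (\<integral>v. ?\<phi> s v \<partial>uniform_sphere)"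
    if s: "s \<in> space (P i)" for s
  proof -
    have m: "(\<lambda>v. ?\<phi> s v) \<in> borel_measurable uniform_sphere"
      unfolding grad_est_def using s by measurable
    have "(\<integral>v. ?\<phi> s v \<partial>uniform_sphere) = (\<integral>v. ?\<phi> s v \<partial>distr (uniform_sphere \<Otimes>\<^sub>M Q) uniform_sphere fst)"
      by (simp only: Q.distr_pair_fst)
    also have "\<dots> = (\<integral>p. ?\<phi> s (fst p) \<partial>(uniform_sphere \<Otimes>\<^sub>M Q))"
      using m by (intro integral_distr) auto
    finally show ?thesis by simp
  qed
  have int': "integrable (P i \<Otimes>\<^sub>M (uniform_sphere \<Otimes>\<^sub>M Q)) (\<lambda>t. ?\<phi> (fst t) (fst (snd t)))"
    using int by (simp add: draw_space_def)
  have intF: "integrable (P i) (F i x)" "integrable (P i) (F i y)"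
    using objective x y by (auto simp: stochastic_objective_def)
  have eq: "(\<integral>t. ?\<phi> (fst t) (fst (snd t)) \<partial>draw_space i)
      = (\<integral>s. (\<integral>p. ?\<phi> s (fst p) \<partial>(uniform_sphere \<Otimes>\<^sub>M Q)) \<partial>P i)"
    unfolding draw_space_def using PUQ.integral_fst'[OF int'] by simp
  have pw: "F i x s - F i y s - 2 * L * \<mu> \<le> (\<integral>p. ?\<phi> s (fst p) \<partial>(uniform_sphere \<Otimes>\<^sub>M Q))"
    if s: "s \<in> space (P i)" for s
  proof -
    \<comment> \<open>subtracting the value at \<open>x\<close> turns the one-point into the two-point estimator\<close>
    define g where "g z = F i z s - F i x s" for z
    have "convex_on D (\<lambda>z. F i z s + (- F i x s))"
      using F_convex[OF s] by (intro convex_on_add convex_on_const[THEN iffD2] convex_on_imp_convex[OF F_convex[OF s]])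
    then have c: "convex_on D g" by (simp add: g_def[abs_def])
    have l: "L-lipschitz_on D g"
      using F_lipschitz[OF s] unfolding g_def lipschitz_on_def by (simp add: dist_real_def)
    have m: "g \<in> borel_measurable borel"
      unfolding g_def using s by measurable
    have "F i x s - F i y s - 2 * L * \<mu> = g x - g y - 2 * L * \<mu>" by (simp add: g_def)
    also have "\<dots> \<le> real DIM('a) / \<mu> * (\<integral>v. g (x + \<mu> *\<^sub>R v) * (v \<bullet> (x - y)) \<partial>uniform_sphere)"
      by (rule sphere_gradient_estimate[OF c l m \<mu> nbhd[OF x] nbhd[OF y]])
    also have "\<dots> = (\<integral>v. ?\<phi> s v \<partial>uniform_sphere)"
      unfolding g_def grad_est_def by (simp add: mult.assoc)
    finally show ?thesis using inner[OF s] by simp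
  qed
  have "local_obj P F i x - local_obj P F i y - 2 * L * \<mu> = (\<integral>s. F i x s - F i y s - 2 * L * \<mu> \<partial>P i)"
    using intF by (simp add: local_obj_def P.prob_space)
  also have "\<dots> \<le> (\<integral>s. (\<integral>p. ?\<phi> s (fst p) \<partial>(uniform_sphere \<Otimes>\<^sub>M Q)) \<partial>P i)"
    using PUQ.integrable_fst'[OF int'] intF pw by (intro integral_mono) auto
  finally show ?thesis unfolding eq .
qed

lemma local_obj_lipschitz:
  assumes x: "x \<in> \<Omega>" and y: "y \<in> \<Omega>"
  shows "\<bar>local_obj P F i x - local_obj P F i y\<bar> \<le> L * norm (x - y)"
proof -
  interpret P: prob_space "P i" by (rule prob_spaces)
  have intF: "integrable (P i) (F i x)" "integrable (P i) (F i y)"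
    using objective x y by (auto simp: stochastic_objective_def)
  have "\<bar>local_obj P F i x - local_obj P F i y\<bar> = \<bar>\<integral>s. F i x s - F i y s \<partial>P i\<bar>"
    using intF by (simp add: local_obj_def)
  also have "\<dots> \<le> (\<integral>s. \<bar>F i x s - F i y s\<bar> \<partial>P i)"
    by (rule integral_abs_bound)
  also have "\<dots> \<le> (\<integral>s. L * norm (x - y) \<partial>P i)"
    using intF lipschitz_on_normD[OF F_lipschitz \<Omega>_D(1)[OF x] \<Omega>_D(1)[OF y]]
    by (intro integral_mono) auto
  finally show ?thesis by (simp add: P.prob_space)
qed

lemma local_obj_borel [measurable]: "local_obj P F i \<in> borel_measurable borel"
proof -
  interpret P: prob_space "P i" by (rule prob_spaces)
  show ?thesis unfolding local_obj_def by measurable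
qed

lemma bounded_integrable:
  assumes "f \<in> borel_measurable M" "\<And>w. \<bar>f w\<bar> \<le> (B::real)"
  shows "integrable M f"
  by (rule integrable_const_bound[where B=B]) (use assms in auto)

lemma local_obj_x_at_integrable: "integrable M (\<lambda>w. local_obj P F i (x_at (draw w) k j))"
proof (rule bounded_integrable)
  fix w
  have "\<bar>local_obj P F i (x_at (draw w) k j) - local_obj P F i 0\<bar> \<le> L * norm (x_at (draw w) k j - 0)"
    by (rule local_obj_lipschitz[OF x_at_in zero_in])
  also have "\<dots> \<le> L * R" using L_nonneg diameter(1)[OF x_at_in] by (intro mult_left_mono) auto
  finally show "\<bar>local_obj P F i (x_at (draw w) k j)\<bar> \<le> \<bar>local_obj P F i 0\<bar> + L * R" by linarith
qed measurable

lemma g_at_inner_integrable: "y \<in> \<Omega> \<Longrightarrow> integrable M (\<lambda>w. g_at (draw w) k i \<bullet> (x_at (draw w) k i - y))"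
proof (rule integrable_const_bound)
  assume y: "y \<in> \<Omega>"
  show "AE w in M. norm (g_at (draw w) k i \<bullet> (x_at (draw w) k i - y)) \<le> real DIM('a) * L * (2 * R)"
    using norm_g_at_le[of k i]
  proof eventually_elim
    case (elim w)
    have "norm (g_at (draw w) k i \<bullet> (x_at (draw w) k i - y)) \<le> norm (g_at (draw w) k i) * norm (x_at (draw w) k i - y)"
      using Cauchy_Schwarz_ineq2 by simp
    also have "\<dots> \<le> real DIM('a) * L * (2 * R)"
      using elim L_nonneg diameter(2)[OF x_at_in y] by (intro mult_mono) auto
    finally show ?case .
  qed
qed measurable

lemma g_at_inner_mean:
  assumes y: "y \<in> \<Omega>"
  shows "(\<integral>w. local_obj P F i (x_at (draw w) k i) \<partial>M) - local_obj P F i y - 2 * L * \<mu>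
    \<le> (\<integral>w. g_at (draw w) k i \<bullet> (x_at (draw w) k i - y) \<partial>M)"
proof -
  define f where "f = (\<lambda>(x, t). grad_est (F i) \<mu> x (fst t) (fst (snd t :: 'a \<times> 'z)) \<bullet> (x - y))"
  have f: "f \<in> borel_measurable (borel \<Otimes>\<^sub>M draw_space i)"
  proof -
    have [measurable]: "(\<lambda>p. fst (snd p)) \<in> measurable (borel \<Otimes>\<^sub>M draw_space i) (P i)"
      "(\<lambda>p. fst (snd (snd p))) \<in> borel_measurable (borel \<Otimes>\<^sub>M draw_space i)"
      using draw_parts_measurable(1,2)[of i, THEN measurable_compose[OF measurable_snd]] by auto
    show ?thesis unfolding f_def grad_est_def case_prod_unfold by measurable
  qed
  have int: "integrable M (\<lambda>w. f (x_at (draw w) k i, draw w (i, k)))"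
    using g_at_inner_integrable[OF y, of k i] by (simp add: f_def g_at_def)
  note ind = product_law_integral[OF x_at_borel draw_measurable draw_space_prob x_at_law f int]
  have "(\<integral>w. local_obj P F i (x_at (draw w) k i) \<partial>M) - local_obj P F i y - 2 * L * \<mu>
      = (\<integral>w. local_obj P F i (x_at (draw w) k i) - local_obj P F i y - 2 * L * \<mu> \<partial>M)"
    using local_obj_x_at_integrable by (simp add: prob_space)
  also have "\<dots> \<le> (\<integral>w. (\<integral>t. f (x_at (draw w) k i, t) \<partial>draw_space i) \<partial>M)"
    using local_obj_x_at_integrable ind(2) grad_est_inner_mean[OF x_at_in y]
    by (intro integral_mono) (auto simp: f_def)
  also have "\<dots> = (\<integral>w. g_at (draw w) k i \<bullet> (x_at (draw w) k i - y) \<partial>M)"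
    using ind(1) by (simp add: f_def g_at_def)
  finally show ?thesis .
qed

end

section \<open>Second moments and the descent inequality along a path\<close>

context com_dszo_run
begin

definition xbar_at :: "('n \<times> nat \<Rightarrow> 's \<times> 'a \<times> 'z) \<Rightarrow> nat \<Rightarrow> 'a" where
  "xbar_at h k = row_mean (st_x (path h k))"

definition consensus_sq :: "('n \<times> nat \<Rightarrow> 's \<times> 'a \<times> 'z) \<Rightarrow> nat \<Rightarrow> real" where
  "consensus_sq h k = (\<Sum>i\<in>UNIV. (norm (x_at h k i - xbar_at h k))\<^sup>2)"

definition compression_sq :: "('n \<times> nat \<Rightarrow> 's \<times> 'a \<times> 'z) \<Rightarrow> nat \<Rightarrow> real" where
  "compression_sq h k = (\<Sum>i\<in>UNIV. (norm (xhat_at h (Suc k) i - x_at h k i))\<^sup>2)"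

lemma xbar_at_eq: "xbar_at h k = (1 / real CARD('n)) *\<^sub>R (\<Sum>i\<in>UNIV. x_at h k i)"
  by (simp add: xbar_at_def row_mean_def x_at_def)

lemma xbar_at_in: "xbar_at h k \<in> \<Omega>"
  unfolding xbar_at_eq scaleR_sum_right
  by (rule convex_sum[OF finite convex]) (auto simp: x_at_in)

lemma xbar_at_borel [measurable]: "(\<lambda>w. xbar_at (draw w) k) \<in> borel_measurable M"
  unfolding xbar_at_eq by measurable

lemma consensus_sq_borel [measurable]: "(\<lambda>w. consensus_sq (draw w) k) \<in> borel_measurable M"
  unfolding consensus_sq_def by measurable

lemma compression_sq_borel [measurable]: "(\<lambda>w. compression_sq (draw w) k) \<in> borel_measurable M"
  unfolding compression_sq_def by measurable

lemma run_error_eq: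
  "run_error M (\<lambda>w. path (draw w)) k = (\<integral>w. consensus_sq (draw w) k + compression_sq (draw w) k \<partial>M)"
proof -
  have "matrix_action H_mat X $ i = row_mean X" for X :: "'a ^ 'n" and i
    by (simp add: matrix_action_def H_mat_def row_mean_def scaleR_sum_right)
  then show ?thesis
    unfolding run_error_def norm_vec_power2 consensus_sq_def compression_sq_def xbar_at_def x_at_def xhat_at_def
    by simp
qed

lemma compressor_second_moment:
  "(\<integral>\<^sup>+z. ennreal ((norm ((1 / r) *\<^sub>R C z y - y))\<^sup>2) \<partial>Q) \<le> ennreal ((norm y)\<^sup>2)"
proof -
  have i: "integrable Q (\<lambda>z. (norm ((1 / r) *\<^sub>R C z y - y))\<^sup>2)"
    and "(\<integral>z. (norm ((1 / r) *\<^sub>R C z y - y))\<^sup>2 \<partial>Q) \<le> (1 - \<omega>) * (norm y)\<^sup>2" and "0 < \<omega>"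
    using compressor by (auto simp: assumption_A5_def)
  moreover from \<open>0 < \<omega>\<close> have "(1 - \<omega>) * (norm y)\<^sup>2 \<le> 1 * (norm y)\<^sup>2"
    by (intro mult_right_mono) auto
  ultimately have "(\<integral>z. (norm ((1 / r) *\<^sub>R C z y - y))\<^sup>2 \<partial>Q) \<le> (norm y)\<^sup>2"
    by linarith
  then show ?thesis
    by (subst nn_integral_eq_integral[OF i]) (auto intro: ennreal_leI)
qed

text \<open>
  The compressor is applied with the damping \<open>\<psi> * r \<le> 1\<close>, which makes the compression error a
  mixture of the error of the scaled compressor and of the uncompressed vector.
\<close>

lemma compression_step:
  assumes r: "1 \<le> r"
  shows "(norm (\<psi> *\<^sub>R c - y))\<^sup>2 \<le> 2 * (norm ((1 / r) *\<^sub>R c - y))\<^sup>2 + 2 * (norm (y :: 'a))\<^sup>2"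
proof -
  have a: "0 \<le> \<psi> * r" using \<psi> r by simp
  have "\<psi> *\<^sub>R c - y = (\<psi> * r) *\<^sub>R ((1 / r) *\<^sub>R c - y) + (\<psi> * r - 1) *\<^sub>R y"
    using r by (simp add: algebra_simps)
  then have "(norm (\<psi> *\<^sub>R c - y))\<^sup>2
      \<le> 2 * (norm ((\<psi> * r) *\<^sub>R ((1 / r) *\<^sub>R c - y)))\<^sup>2 + 2 * (norm ((\<psi> * r - 1) *\<^sub>R y))\<^sup>2"
    by (simp only: norm_add_power2_le)
  also have "\<dots> \<le> 2 * (norm ((1 / r) *\<^sub>R c - y))\<^sup>2 + 2 * (norm y)\<^sup>2"
    using a \<psi> by (intro add_mono mult_left_mono power_mono) (auto simp: mult_left_le_one_le)
  finally show ?thesis .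
qed

text \<open>
  The compressor draw of step \<open>k\<close> is independent of the gap it compresses, so the second moment
  bound for the compressor carries over.
\<close>

lemma compression_error_moment:
  assumes gap: "integrable M (\<lambda>w. (norm (x_at (draw w) k i - xhat_at (draw w) k i))\<^sup>2)"
  shows "integrable M (\<lambda>w. (norm (xhat_at (draw w) (Suc k) i - x_at (draw w) k i))\<^sup>2)"
    and "(\<integral>w. (norm (xhat_at (draw w) (Suc k) i - x_at (draw w) k i))\<^sup>2 \<partial>M)
      \<le> 4 * (\<integral>w. (norm (x_at (draw w) k i - xhat_at (draw w) k i))\<^sup>2 \<partial>M)"
proof -
  interpret P: prob_space "P i" by (rule prob_spaces)
  interpret Q: prob_space Q by (rule prob_spaces)
  interpret US: prob_space "uniform_sphere :: 'a measure" by (rule prob_space_uniform_sphere)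
  interpret UQ: pair_prob_space "uniform_sphere :: 'a measure" Q ..
  have r: "1 \<le> r" using compressor by (auto simp: assumption_A5_def)
  let ?gap = "\<lambda>w. x_at (draw w) k i - xhat_at (draw w) k i"
  define f where "f = (\<lambda>(y, t). ennreal ((norm (\<psi> *\<^sub>R C (snd (snd (t :: 's \<times> 'a \<times> 'z))) y - y))\<^sup>2))"
  have f: "f \<in> borel_measurable (borel \<Otimes>\<^sub>M draw_space i)"
  proof -
    have [measurable]: "(\<lambda>p. snd (snd (snd p))) \<in> measurable (borel \<Otimes>\<^sub>M draw_space i) Q"
      using draw_parts_measurable(3)[of i, THEN measurable_compose[OF measurable_snd]] by auto
    show ?thesis unfolding f_def case_prod_unfold by measurable
  qed
  have inner: "(\<integral>\<^sup>+t. f (y, t) \<partial>draw_space i) \<le> ennreal (4 * (norm y)\<^sup>2)" for y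
  proof -
    define q where "q z = ennreal (2 * (norm ((1 / r) *\<^sub>R C z y - y))\<^sup>2 + 2 * (norm y)\<^sup>2)" for z
    have [measurable]: "q \<in> borel_measurable Q"
      unfolding q_def by measurable
    have "(\<integral>\<^sup>+t. f (y, t) \<partial>draw_space i) \<le> (\<integral>\<^sup>+t. q (snd (snd t)) \<partial>draw_space i)"
    proof (rule nn_integral_mono)
      fix t
      show "f (y, t) \<le> q (snd (snd t))"
        using ennreal_leI[OF compression_step[OF r, of "C (snd (snd t)) y" y]]
        unfolding f_def q_def by (simp only: prod.case)
    qed
    also have "\<dots> = (\<integral>\<^sup>+s. (\<integral>\<^sup>+v. (\<integral>\<^sup>+z. q z \<partial>Q) \<partial>(uniform_sphere :: 'a measure)) \<partial>P i)"
      unfolding draw_space_def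
      by (subst UQ.nn_integral_fst[symmetric], simp, subst Q.nn_integral_fst[symmetric], simp_all)
    also have "\<dots> = (\<integral>\<^sup>+z. q z \<partial>Q)"
      by (simp add: P.emeasure_space_1 US.emeasure_space_1)
    also have "\<dots> = 2 * (\<integral>\<^sup>+z. ennreal ((norm ((1 / r) *\<^sub>R C z y - y))\<^sup>2) \<partial>Q) + ennreal (2 * (norm y)\<^sup>2)"
      unfolding q_def
      by (subst ennreal_plus) (auto simp: nn_integral_add nn_integral_cmult ennreal_mult Q.emeasure_space_1)
    also have "\<dots> \<le> 2 * ennreal ((norm y)\<^sup>2) + ennreal (2 * (norm y)\<^sup>2)"
      using compressor_second_moment by (intro add_mono mult_left_mono) auto
    also have "\<dots> = ennreal (2 * (norm y)\<^sup>2) + ennreal (2 * (norm y)\<^sup>2)"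
      by (simp add: ennreal_mult)
    also have "\<dots> = ennreal (4 * (norm y)\<^sup>2)"
      by (subst ennreal_plus[symmetric]) auto
    finally show ?thesis .
  qed
  have eq: "ennreal ((norm (xhat_at (draw w) (Suc k) i - x_at (draw w) k i))\<^sup>2) = f (?gap w, draw w (i, k))" for w
    by (simp add: f_def xhat_at_Suc algebra_simps)
  have "(\<integral>\<^sup>+w. ennreal ((norm (xhat_at (draw w) (Suc k) i - x_at (draw w) k i))\<^sup>2) \<partial>M)
      = (\<integral>\<^sup>+w. (\<integral>\<^sup>+t. f (?gap w, t) \<partial>draw_space i) \<partial>M)"
    unfolding eq
    by (rule product_law_nn_integral[OF gap_borel draw_measurable draw_space_prob gap_law f])
  also have "\<dots> \<le> (\<integral>\<^sup>+w. ennreal (4 * (norm (?gap w))\<^sup>2) \<partial>M)"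
    by (intro nn_integral_mono inner)
  also have "\<dots> = ennreal (\<integral>w. 4 * (norm (?gap w))\<^sup>2 \<partial>M)"
    using gap by (intro nn_integral_eq_integral) auto
  finally have le: "(\<integral>\<^sup>+w. ennreal ((norm (xhat_at (draw w) (Suc k) i - x_at (draw w) k i))\<^sup>2) \<partial>M)
      \<le> ennreal (4 * (\<integral>w. (norm (?gap w))\<^sup>2 \<partial>M))"
    by simp
  show int: "integrable M (\<lambda>w. (norm (xhat_at (draw w) (Suc k) i - x_at (draw w) k i))\<^sup>2)"
    by (rule integrableI_nonneg) (use le in \<open>auto intro: le_less_trans\<close>)
  show "(\<integral>w. (norm (xhat_at (draw w) (Suc k) i - x_at (draw w) k i))\<^sup>2 \<partial>M) \<le> 4 * (\<integral>w. (norm (?gap w))\<^sup>2 \<partial>M)"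
    using le unfolding nn_integral_eq_integral[OF int AE_I2[OF zero_le_power2]]
    by (subst (asm) ennreal_le_iff) auto
qed

lemma x_at_power2_le: "y \<in> \<Omega> \<Longrightarrow> (norm (x_at h k i - y))\<^sup>2 \<le> (2 * R)\<^sup>2"
  by (intro power_mono diameter x_at_in) auto

lemma x_at_power2_integrable: "y \<in> \<Omega> \<Longrightarrow> integrable M (\<lambda>w. (norm (x_at (draw w) k i - y))\<^sup>2)"
  using x_at_power2_le by (intro bounded_integrable[where B="(2 * R)\<^sup>2"]) (simp_all only: abs_power2, measurable)

text \<open>
  The estimates are not confined to a bounded set, in contrast to the iterates, so the finiteness
  of their second moments has to be carried along the run.  Without it the expectation in
  \<open>run_error\<close> would be the default value 0 and say nothing.
\<close>

lemma gap_power2_integrable: "integrable M (\<lambda>w. (norm (x_at (draw w) k i - xhat_at (draw w) k i))\<^sup>2)"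
proof (induction k)
  case 0
  show ?case by (simp add: x_at_0 xhat_at_0)
next
  case (Suc k)
  let ?c = "\<lambda>w. xhat_at (draw w) (Suc k) i - x_at (draw w) k i"
  show ?case
  proof (rule Bochner_Integration.integrable_bound[where f="\<lambda>w. 2 * (2 * R)\<^sup>2 + 2 * (norm (?c w))\<^sup>2"])
    show "integrable M (\<lambda>w. 2 * (2 * R)\<^sup>2 + 2 * (norm (?c w))\<^sup>2)"
      using compression_error_moment(1)[OF Suc] by simp
    show "AE w in M. norm ((norm (x_at (draw w) (Suc k) i - xhat_at (draw w) (Suc k) i))\<^sup>2)
        \<le> norm (2 * (2 * R)\<^sup>2 + 2 * (norm (?c w))\<^sup>2)"
    proof (rule AE_I2)
      fix w
      have "(norm (x_at (draw w) (Suc k) i - x_at (draw w) k i))\<^sup>2 \<le> (2 * R)\<^sup>2"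
        by (intro power_mono diameter x_at_in) auto
      then show "norm ((norm (x_at (draw w) (Suc k) i - xhat_at (draw w) (Suc k) i))\<^sup>2)
          \<le> norm (2 * (2 * R)\<^sup>2 + 2 * (norm (?c w))\<^sup>2)"
        using norm_diff_power2_le[of "x_at (draw w) (Suc k) i - x_at (draw w) k i" "?c w"] by simp
    qed
  qed measurable
qed

lemma compression_sq_integrable: "integrable M (\<lambda>w. compression_sq (draw w) k)"
  unfolding compression_sq_def
  using compression_error_moment(1)[OF gap_power2_integrable] by (intro Bochner_Integration.integrable_sum)

lemma consensus_sq_bounds: "0 \<le> consensus_sq h k" "consensus_sq h k \<le> real CARD('n) * (2 * R)\<^sup>2"
proof -
  show "0 \<le> consensus_sq h k" unfolding consensus_sq_def by (intro sum_nonneg) auto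
  have "consensus_sq h k \<le> (\<Sum>i\<in>(UNIV :: 'n set). (2 * R)\<^sup>2)"
    unfolding consensus_sq_def by (intro sum_mono power_mono diameter x_at_in xbar_at_in) auto
  then show "consensus_sq h k \<le> real CARD('n) * (2 * R)\<^sup>2" by simp
qed

lemma compression_sq_nonneg: "0 \<le> compression_sq h k"
  unfolding compression_sq_def by (intro sum_nonneg) auto

lemma consensus_sq_integrable: "integrable M (\<lambda>w. consensus_sq (draw w) k)"
  by (rule bounded_integrable[where B="real CARD('n) * (2 * R)\<^sup>2"])
     (use consensus_sq_bounds in \<open>auto simp: abs_of_nonneg\<close>)

lemma run_error_nonneg: "0 \<le> run_error M (\<lambda>w. path (draw w)) k"
  unfolding run_error_eq
  by (rule Bochner_Integration.integral_nonneg) (simp add: consensus_sq_bounds compression_sq_nonneg)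

lemma run_error_0_le: "run_error M (\<lambda>w. path (draw w)) 0 \<le> 8 * real CARD('n) * R\<^sup>2"
proof -
  have "(\<integral>w. compression_sq (draw w) 0 \<partial>M)
      = (\<Sum>i\<in>UNIV. \<integral>w. (norm (xhat_at (draw w) (Suc 0) i - x_at (draw w) 0 i))\<^sup>2 \<partial>M)"
    unfolding compression_sq_def
    using compression_error_moment(1)[OF gap_power2_integrable] by (intro Bochner_Integration.integral_sum) auto
  also have "\<dots> \<le> (\<Sum>i\<in>(UNIV :: 'n set). 4 * R\<^sup>2)"
  proof (intro sum_mono)
    fix i
    have "(\<integral>w. (norm (xhat_at (draw w) (Suc 0) i - x_at (draw w) 0 i))\<^sup>2 \<partial>M) \<le> 4 * (norm (X0 $ i))\<^sup>2"
      using compression_error_moment(2)[OF gap_power2_integrable, of 0 i]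
      by (simp add: x_at_0 xhat_at_0 prob_space)
    also have "\<dots> \<le> 4 * R\<^sup>2"
      using diameter(1)[OF X0_in] by (intro mult_left_mono power_mono) auto
    finally show "(\<integral>w. (norm (xhat_at (draw w) (Suc 0) i - x_at (draw w) 0 i))\<^sup>2 \<partial>M) \<le> 4 * R\<^sup>2" .
  qed
  finally have "(\<integral>w. compression_sq (draw w) 0 \<partial>M) \<le> real CARD('n) * (4 * R\<^sup>2)" by simp
  moreover have "(\<integral>w. consensus_sq (draw w) 0 \<partial>M) \<le> (\<integral>w. real CARD('n) * (2 * R)\<^sup>2 \<partial>M)"
    using consensus_sq_bounds(2) consensus_sq_integrable by (intro integral_mono) auto
  ultimately show ?thesis
    unfolding run_error_eq using consensus_sq_integrable compression_sq_integrable
    by (simp add: prob_space power_mult_distrib)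
qed

text \<open>
  Expand the square after the projection, which is nonexpansive and fixes \<open>y\<close>.  The corrections
  \<open>b\<close> sum to 0 over the agents because the columns of \<open>W\<close> sum to 1, so they only see the deviation
  of the iterates from their mean; and they are small because the rows of \<open>W\<close> sum to 1, so that
  the mean cancels in \<open>(I - W)\<close>.  Hence all terms with \<open>b\<close> are of the order of the error of the run.
\<close>

lemma descent_pointwise:
  assumes y: "y \<in> shrink \<epsilon> \<Omega>"
  shows "(\<Sum>i\<in>UNIV. (norm (x_at h (Suc k) i - y))\<^sup>2)
    \<le> (\<Sum>i\<in>UNIV. (norm (x_at h k i - y))\<^sup>2)
      - 2 * \<eta> k * (\<Sum>i\<in>UNIV. g_at h k i \<bullet> (x_at h k i - y))
      + (3 * \<gamma> * K + 4 * \<gamma>\<^sup>2 * K\<^sup>2) * (consensus_sq h k + compression_sq h k)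
      + 2 * (\<eta> k)\<^sup>2 * (\<Sum>i\<in>UNIV. (norm (g_at h k i))\<^sup>2)"
proof -
  let ?b = "b_at h (Suc k)" and ?x = "x_at h k" and ?g = "g_at h k" and ?m = "xbar_at h k"
  define Pv :: "'a ^ 'n" where "Pv = (\<chi> i. ?x i - ?m)"
  define Qv :: "'a ^ 'n" where "Qv = (\<chi> i. xhat_at h (Suc k) i - ?x i)"
  define B :: "'a ^ 'n" where "B = (\<chi> i. ?b i)"
  define E where "E = consensus_sq h k + compression_sq h k"
  have E: "E = (norm Pv)\<^sup>2 + (norm Qv)\<^sup>2"
    by (simp add: E_def Pv_def Qv_def norm_vec_power2 consensus_sq_def compression_sq_def)
  have Z: "(norm (Qv + Pv))\<^sup>2 \<le> 2 * E"
    using norm_add_power2_le[of Qv Pv] unfolding E by simp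
  have "B = (Qv + Pv) - matrix_action W (Qv + Pv)"
  proof (rule vec_eq_iff[THEN iffD2], rule allI)
    fix i
    have "(\<Sum>j\<in>UNIV. W $ i $ j *\<^sub>R ?m) = ?m"
      by (simp add: scaleR_sum_left[symmetric] W_rows)
    then show "B $ i = ((Qv + Pv) - matrix_action W (Qv + Pv)) $ i"
      by (simp add: B_def Qv_def Pv_def matrix_action_def b_at_def algebra_simps sum_subtractf sum.distrib)
  qed
  then have B: "norm B \<le> K * norm (Qv + Pv)" using K(2) by simp
  have "(norm B)\<^sup>2 \<le> (K * norm (Qv + Pv))\<^sup>2"
    using B by (intro power_mono) auto
  also have "\<dots> \<le> K\<^sup>2 * (2 * E)"
    unfolding power_mult_distrib using Z by (intro mult_left_mono) auto
  finally have B2: "(\<Sum>i\<in>UNIV. (norm (?b i))\<^sup>2) \<le> 2 * K\<^sup>2 * E"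
    by (simp add: norm_vec_power2 B_def)
  have sum_b: "(\<Sum>i\<in>UNIV. ?b i) = 0"
  proof -
    have "(\<Sum>i\<in>UNIV. \<Sum>j\<in>UNIV. W $ i $ j *\<^sub>R xhat_at h (Suc k) j)
        = (\<Sum>j\<in>UNIV. (\<Sum>i\<in>UNIV. W $ i $ j) *\<^sub>R xhat_at h (Suc k) j)"
      unfolding scaleR_sum_left by (rule sum.swap)
    then show ?thesis by (simp add: b_at_def sum_subtractf W_cols)
  qed
  have "(\<Sum>i\<in>UNIV. ?b i \<bullet> (?x i - y)) = (\<Sum>i\<in>UNIV. ?b i \<bullet> (?x i - ?m)) + (\<Sum>i\<in>UNIV. ?b i) \<bullet> (?m - y)"
    unfolding inner_sum_left sum.distrib[symmetric] by (intro sum.cong) (auto simp: algebra_simps)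
  also have "\<dots> = B \<bullet> Pv"
    by (simp add: sum_b B_def Pv_def inner_vec_def)
  finally have bx: "(\<Sum>i\<in>UNIV. ?b i \<bullet> (?x i - y)) = B \<bullet> Pv" .
  have "2 * (norm (Qv + Pv) * norm Pv) \<le> (norm (Qv + Pv))\<^sup>2 + (norm Pv)\<^sup>2"
    using sum_squares_bound[of "norm (Qv + Pv)" "norm Pv"] by simp
  moreover have "(norm Pv)\<^sup>2 \<le> E" unfolding E by simp
  ultimately have ZP: "norm (Qv + Pv) * norm Pv \<le> 3 / 2 * E"
    using Z by linarith
  have "\<bar>B \<bullet> Pv\<bar> \<le> norm B * norm Pv" by (rule Cauchy_Schwarz_ineq2)
  also have "\<dots> \<le> K * (norm (Qv + Pv) * norm Pv)"
    using mult_right_mono[OF B, of "norm Pv"] by (simp add: mult.assoc)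
  also have "\<dots> \<le> K * (3 / 2 * E)"
    using ZP K(1) by (intro mult_left_mono)
  finally have "- (B \<bullet> Pv) \<le> K * (3 / 2 * E)" by linarith
  then have "2 * \<gamma> * (- (B \<bullet> Pv)) \<le> 2 * \<gamma> * (K * (3 / 2 * E))"
    using \<gamma> by (intro mult_left_mono) auto
  then have bP: "- 2 * \<gamma> * (B \<bullet> Pv) \<le> 3 * \<gamma> * K * E" by (simp add: algebra_simps)
  have step: "(norm (x_at h (Suc k) i - y))\<^sup>2 \<le> (norm (?x i - y))\<^sup>2 - 2 * \<gamma> * (?b i \<bullet> (?x i - y))
      - 2 * \<eta> k * (?g i \<bullet> (?x i - y)) + (2 * \<gamma>\<^sup>2 * (norm (?b i))\<^sup>2 + 2 * (\<eta> k)\<^sup>2 * (norm (?g i))\<^sup>2)" for i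
  proof -
    let ?v = "\<gamma> *\<^sub>R ?b i + \<eta> k *\<^sub>R ?g i"
    have "closest_point (shrink \<epsilon> \<Omega>) y = y" using y by (rule closest_point_self)
    then have "norm (x_at h (Suc k) i - y) \<le> norm ((?x i - \<gamma> *\<^sub>R ?b i - \<eta> k *\<^sub>R ?g i) - y)"
      using closest_point_lipschitz[OF shrink_convex shrink_closed shrink_nonempty,
          of "?x i - \<gamma> *\<^sub>R ?b i - \<eta> k *\<^sub>R ?g i" y]
      by (simp add: x_at_Suc dist_norm)
    also have "(?x i - \<gamma> *\<^sub>R ?b i - \<eta> k *\<^sub>R ?g i) - y = (?x i - y) - ?v" by simp
    finally have "(norm (x_at h (Suc k) i - y))\<^sup>2 \<le> (norm ((?x i - y) - ?v))\<^sup>2"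
      by (intro power_mono) auto
    also have "\<dots> = (norm (?x i - y))\<^sup>2 - 2 * (?v \<bullet> (?x i - y)) + (norm ?v)\<^sup>2"
      by (simp only: power2_norm_eq_inner inner_diff_left inner_diff_right) (simp add: inner_commute algebra_simps)
    also have "(norm ?v)\<^sup>2 \<le> 2 * (norm (\<gamma> *\<^sub>R ?b i))\<^sup>2 + 2 * (norm (\<eta> k *\<^sub>R ?g i))\<^sup>2"
      by (rule norm_add_power2_le)
    finally show ?thesis
      by (simp add: power_mult_distrib inner_add_left algebra_simps)
  qed
  have "(\<Sum>i\<in>UNIV. (norm (x_at h (Suc k) i - y))\<^sup>2)
    \<le> (\<Sum>i\<in>UNIV. (norm (?x i - y))\<^sup>2 - 2 * \<gamma> * (?b i \<bullet> (?x i - y))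
      - 2 * \<eta> k * (?g i \<bullet> (?x i - y)) + (2 * \<gamma>\<^sup>2 * (norm (?b i))\<^sup>2 + 2 * (\<eta> k)\<^sup>2 * (norm (?g i))\<^sup>2))"
    by (intro sum_mono step)
  also have "\<dots> = (\<Sum>i\<in>UNIV. (norm (?x i - y))\<^sup>2) - 2 * \<gamma> * (\<Sum>i\<in>UNIV. ?b i \<bullet> (?x i - y))
      - 2 * \<eta> k * (\<Sum>i\<in>UNIV. ?g i \<bullet> (?x i - y))
      + (2 * \<gamma>\<^sup>2 * (\<Sum>i\<in>UNIV. (norm (?b i))\<^sup>2) + 2 * (\<eta> k)\<^sup>2 * (\<Sum>i\<in>UNIV. (norm (?g i))\<^sup>2))"
    by (simp only: sum.distrib sum_subtractf sum_distrib_left)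
  also have "\<dots> \<le> (\<Sum>i\<in>UNIV. (norm (?x i - y))\<^sup>2) + 3 * \<gamma> * K * E
      - 2 * \<eta> k * (\<Sum>i\<in>UNIV. ?g i \<bullet> (?x i - y))
      + (2 * \<gamma>\<^sup>2 * (2 * K\<^sup>2 * E) + 2 * (\<eta> k)\<^sup>2 * (\<Sum>i\<in>UNIV. (norm (?g i))\<^sup>2))"
  proof -
    have "2 * \<gamma>\<^sup>2 * (\<Sum>i\<in>UNIV. (norm (?b i))\<^sup>2) \<le> 2 * \<gamma>\<^sup>2 * (2 * K\<^sup>2 * E)"
      using B2 by (intro mult_left_mono) auto
    then show ?thesis using bP unfolding bx by linarith
  qed
  finally show ?thesis by (simp add: E_def algebra_simps)
qed

end

section \<open>Summation of descent inequalities\<close>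

text \<open>
  The coefficient of \<open>sqrt (T + c)\<close> in the summed descent inequality.  It is written out so that it is
  visibly independent of the horizon and of the compressor, apart from the lower bound \<open>a\<close> on the
  contraction gain and the constants of the error recursion.
\<close>

definition regret_factor :: "real \<Rightarrow> real \<Rightarrow> real \<Rightarrow> real \<Rightarrow> real \<Rightarrow> real \<Rightarrow> real \<Rightarrow> real \<Rightarrow> real \<Rightarrow> real" where
  "regret_factor n m c a b E0 Dm A B =
     m / (2 * n) * (Dm + A * ((E0 + 2 * (E0 + b / (a * m\<^sup>2 * c)) + 6 * b / m\<^sup>2) / a) + 3 * B / m\<^sup>2)"

lemma sqrt_shift_bounds:
  fixes c :: real assumes c: "1 \<le> c"
  shows "1 \<le> sqrt (real k + c)" "sqrt (real k + c) \<le> sqrt (real (Suc k) + c)"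
    "sqrt (real (Suc k) + c) \<le> 2 * sqrt (real k + c)"
    "1 / sqrt (real (Suc k) + c) \<le> 2 * (sqrt (real (Suc k) + c) - sqrt (real k + c))"
proof -
  let ?s = "sqrt (real k + c)" and ?t = "sqrt (real (Suc k) + c)"
  show s: "1 \<le> ?s" using c by simp
  show st: "?s \<le> ?t" by simp
  have "?t \<le> sqrt (4 * (real k + c))" using c by (intro real_sqrt_le_mono) simp
  also have "\<dots> = 2 * ?s" by (subst real_sqrt_mult) simp
  finally show "?t \<le> 2 * ?s" .
  have "?t\<^sup>2 - ?s\<^sup>2 = 1" using c by simp
  then have "1 = (?t - ?s) * (?t + ?s)" by (simp add: power2_eq_square algebra_simps)
  also have "\<dots> \<le> (?t - ?s) * (2 * ?t)" using st by (intro mult_left_mono) auto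
  finally show "1 / ?t \<le> 2 * (?t - ?s)" using s st by (simp add: field_simps)
qed

lemma sum_inverse_sqrt_le:
  fixes c :: real assumes c: "1 \<le> c"
  shows "(\<Sum>k\<le>T. 1 / sqrt (real k + c)) \<le> 3 * sqrt (real T + c)"
proof (induction T)
  case 0
  have "1 / sqrt c \<le> 1" using c by simp
  moreover have "1 \<le> sqrt c" using c by simp
  ultimately have "1 / sqrt c \<le> 3 * sqrt c" by linarith
  then show ?case by simp
next
  case (Suc T)
  define s where "s k = sqrt (real k + c)" for k
  have "(\<Sum>k\<le>T. 1 / s k) + 1 / s (Suc T) \<le> 3 * s (Suc T)"
    using Suc.IH sqrt_shift_bounds(2,4)[OF c, of T] unfolding s_def[symmetric] by (simp add: right_diff_distrib)
  then show ?case by (simp only: sum.atMost_Suc s_def)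
qed

text \<open>
  The errors are of the order of the squared step size, so weighted with the inverse step size
  they sum to the order of the square root.  Multiplying the recursion by the weight and
  telescoping, the growth of the weights is absorbed by a uniform bound \<open>Em\<close> on the errors.  This
  avoids asking that the contraction beat the growth of the weights in each step, which
  fails for small \<open>a\<close> in the first steps.
\<close>

lemma contraction_weighted_sum:
  fixes e :: "nat \<Rightarrow> real"
  assumes c: "1 \<le> c" and m: "0 < m" and a: "0 < a" "a \<le> 1" and b: "0 \<le> b"
    and e: "\<And>k. 0 \<le> e k" "e 0 \<le> E0"
    and rec: "\<And>k. e (Suc k) \<le> (1 - a) * e k + b * (1 / (m * sqrt (real k + c)))\<^sup>2"
  shows "(\<Sum>k\<le>T. e k * sqrt (real k + c))
    \<le> (E0 + 2 * (E0 + b / (a * m\<^sup>2 * c)) + 6 * b / m\<^sup>2) / a * sqrt (real T + c)"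
proof -
  define s where "s k = sqrt (real k + c)" for k
  define Em where "Em = E0 + b / (a * m\<^sup>2 * c)"
  note sb = sqrt_shift_bounds[OF c, folded s_def]
  have spos: "0 < s k" for k using sb(1)[of k] by linarith
  have E0: "0 \<le> E0" using e(1)[of 0] e(2) by linarith
  have sq: "b * (1 / (m * s k))\<^sup>2 = b / m\<^sup>2 / (s k)\<^sup>2" for k
    by (simp add: power_divide power_mult_distrib)
  have Em: "e k \<le> Em" for k
  proof (induction k)
    case 0
    show ?case using e(2) a b c m by (simp add: Em_def add_increasing2)
  next
    case (Suc k)
    have "b / m\<^sup>2 / (s k)\<^sup>2 \<le> b / m\<^sup>2 / c"
      using c b by (intro divide_left_mono) (auto simp: s_def intro!: mult_pos_pos divide_nonneg_nonneg)
    also have "\<dots> = a * (b / (a * m\<^sup>2 * c))" using a by simp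
    also have "\<dots> \<le> a * Em" unfolding Em_def using a E0 by (intro mult_left_mono) auto
    finally have "b / m\<^sup>2 / (s k)\<^sup>2 \<le> a * Em" .
    moreover have "(1 - a) * e k \<le> (1 - a) * Em" using Suc a by (intro mult_left_mono) auto
    ultimately have "e (Suc k) \<le> (1 - a) * Em + a * Em"
      using rec[of k] unfolding sq[unfolded s_def] s_def by linarith
    then show ?case by (simp add: algebra_simps)
  qed
  have step: "e (Suc k) * s (Suc k) \<le> (1 - a) * (e k * s k) + Em * (s (Suc k) - s k) + 2 * b / m\<^sup>2 * (1 / s k)" for k
  proof -
    have "e (Suc k) * s (Suc k) \<le> ((1 - a) * e k + b / m\<^sup>2 / (s k)\<^sup>2) * s (Suc k)"
      using rec[of k, folded s_def] spos[of "Suc k"] unfolding sq by (intro mult_right_mono) auto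
    also have "\<dots> = (1 - a) * (e k * s k) + (1 - a) * e k * (s (Suc k) - s k) + b / m\<^sup>2 / (s k)\<^sup>2 * s (Suc k)"
      by (simp add: algebra_simps)
    also have "(1 - a) * e k * (s (Suc k) - s k) \<le> Em * (s (Suc k) - s k)"
    proof (rule mult_right_mono)
      have "(1 - a) * e k \<le> 1 * e k" using a e(1)[of k] by (intro mult_right_mono) auto
      then show "(1 - a) * e k \<le> Em" using Em[of k] by linarith
    qed (use sb(2)[of k] in simp)
    also have "b / m\<^sup>2 / (s k)\<^sup>2 * s (Suc k) \<le> b / m\<^sup>2 / (s k)\<^sup>2 * (2 * s k)"
      using sb(3)[of k] b by (intro mult_left_mono) auto
    also have "\<dots> = 2 * b / m\<^sup>2 * (1 / s k)"
      using spos[of k] by (simp add: power2_eq_square mult.commute mult.left_commute)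
    finally show ?thesis by simp
  qed
  have tele: "a * (\<Sum>k<T. e k * s k) + e T * s T
      \<le> e 0 * s 0 + Em * (s T - s 0) + 2 * b / m\<^sup>2 * (\<Sum>k<T. 1 / s k)" for T
  proof (induction T)
    case (Suc T)
    then show ?case using step[of T] by (simp only: sum.lessThan_Suc) (simp add: algebra_simps)
  qed simp
  have sT: "s 0 \<le> s T" "s 0 \<ge> 0" by (simp_all add: s_def c order_trans[OF _ c])
  have "e 0 * s 0 \<le> E0 * s T" using e E0 sT by (intro mult_mono) auto
  moreover have "Em * (s (Suc T) - s 0) \<le> Em * (2 * s T)"
    using sb(3)[of T] sT Em[of 0] e(1)[of 0] by (intro mult_left_mono) auto
  moreover have "2 * b / m\<^sup>2 * (\<Sum>k\<le>T. 1 / s k) \<le> 2 * b / m\<^sup>2 * (3 * s T)"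
    using sum_inverse_sqrt_le[OF c, of T] b by (intro mult_left_mono) (auto simp: s_def)
  moreover have "0 \<le> e (Suc T) * s (Suc T)" using e(1)[of "Suc T"] spos[of "Suc T"] by simp
  ultimately have "a * (\<Sum>k\<le>T. e k * s k) \<le> E0 * s T + Em * (2 * s T) + 2 * b / m\<^sup>2 * (3 * s T)"
    using tele[of "Suc T"] unfolding lessThan_Suc_atMost by linarith
  also have "\<dots> = (E0 + 2 * Em + 6 * b / m\<^sup>2) * s T" by (simp add: algebra_simps)
  finally have "(\<Sum>k\<le>T. e k * s k) \<le> (E0 + 2 * Em + 6 * b / m\<^sup>2) / a * s T"
    using a by (simp add: field_simps)
  then show ?thesis unfolding Em_def s_def .
qed

text \<open>
  Summation by parts for a bounded sequence and increasing weights.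
\<close>

lemma abel_sum_le:
  fixes d s :: "nat \<Rightarrow> real"
  assumes s: "\<And>k. s k \<le> s (Suc k)" and d: "\<And>k. d k \<le> Dm"
  shows "(\<Sum>k=1..T. (d k - d (Suc k)) * s k) \<le> Dm * (s T - s 0) + d 1 * s 0 - d (Suc T) * s T"
proof (induction T)
  case (Suc T)
  have "d (Suc T) * (s (Suc T) - s T) \<le> Dm * (s (Suc T) - s T)"
    using s[of T] d[of "Suc T"] by (intro mult_right_mono) auto
  with Suc show ?case by (simp add: algebra_simps)
qed simp

text \<open>
  Dividing the descent inequality by the step size leaves three sums, each of order
  \<open>sqrt (T + c)\<close>: a telescoping one with increasing weights, the weighted errors, and the step sizes.
\<close>

lemma descent_regret_sum:
  fixes e d \<rho> \<eta> :: "nat \<Rightarrow> real"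
  assumes c: "1 \<le> c" and m: "0 < m" and a: "0 < a" "a \<le> 1" and b: "0 \<le> b"
    and e: "\<And>k. 0 \<le> e k" "e 0 \<le> E0"
    and step: "\<And>k. \<eta> k = 1 / (m * sqrt (real k + c))"
    and rec: "\<And>k. e (Suc k) \<le> (1 - a) * e k + b * (\<eta> k)\<^sup>2"
    and d: "\<And>k. 0 \<le> d k" "\<And>k. d k \<le> Dm"
    and n: "0 < n" and A: "0 \<le> A" and B: "0 \<le> B"
    and descent: "\<And>k. 2 * \<eta> k * n * (\<rho> k - q) \<le> d k - d (Suc k) + A * e k + B * (\<eta> k)\<^sup>2"
  shows "(\<Sum>k=1..T. \<rho> k) \<le> regret_factor n m c a b E0 Dm A B * sqrt (real T + c) + real T * q"
proof -
  define s where "s k = sqrt (real k + c)" for k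
  note sb = sqrt_shift_bounds[OF c, folded s_def]
  have spos: "0 < s k" for k using sb(1)[of k] by linarith
  have one: "\<rho> k \<le> m / (2 * n) * ((d k - d (Suc k)) * s k + A * (e k * s k) + B / m\<^sup>2 * (1 / s k)) + q" for k
  proof -
    have "\<rho> k - q = (m * s k / (2 * n)) * (2 * (1 / (m * s k)) * n * (\<rho> k - q))"
      using m n spos[of k] by (simp add: field_simps)
    also have "\<dots> \<le> (m * s k / (2 * n)) * (d k - d (Suc k) + A * e k + B * (1 / (m * s k))\<^sup>2)"
      using descent[of k, unfolded step, folded s_def] m n spos[of k] by (intro mult_left_mono) auto
    also have "\<dots> = m / (2 * n) * ((d k - d (Suc k)) * s k + A * (e k * s k) + B * ((1 / (m * s k))\<^sup>2 * s k))"
      by (simp add: algebra_simps)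
    also have "(1 / (m * s k))\<^sup>2 * s k = 1 / m\<^sup>2 * (1 / s k)"
      using m spos[of k] by (simp add: power2_eq_square field_simps)
    finally show ?thesis by simp
  qed
  have "(\<Sum>k=1..T. \<rho> k) \<le> (\<Sum>k=1..T. m / (2 * n) * ((d k - d (Suc k)) * s k + A * (e k * s k) + B / m\<^sup>2 * (1 / s k)) + q)"
    by (intro sum_mono one)
  also have "\<dots> = m / (2 * n) * ((\<Sum>k=1..T. (d k - d (Suc k)) * s k) + A * (\<Sum>k=1..T. e k * s k)
      + B / m\<^sup>2 * (\<Sum>k=1..T. 1 / s k)) + real T * q"
    unfolding sum.distrib sum_distrib_left[symmetric] by simp
  also have "\<dots> \<le> m / (2 * n) * (Dm * s T + A * ((E0 + 2 * (E0 + b / (a * m\<^sup>2 * c)) + 6 * b / m\<^sup>2) / a * s T)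
      + B / m\<^sup>2 * (3 * s T)) + real T * q"
  proof (intro add_right_mono mult_left_mono add_mono)
    have "d 1 * s 0 \<le> Dm * s 0" using d(2)[of 1] spos[of 0] by (intro mult_right_mono) auto
    moreover have "0 \<le> d (Suc T) * s T" using d(1)[of "Suc T"] spos[of T] by simp
    ultimately show "(\<Sum>k=1..T. (d k - d (Suc k)) * s k) \<le> Dm * s T"
      using abel_sum_le[of s d Dm T, OF sb(2) d(2)] by (simp add: algebra_simps)
    have "(\<Sum>k=1..T. e k * s k) \<le> (\<Sum>k\<le>T. e k * s k)"
      using e(1) spos by (intro sum_mono2) (auto intro: mult_nonneg_nonneg less_imp_le)
    also have "\<dots> \<le> (E0 + 2 * (E0 + b / (a * m\<^sup>2 * c)) + 6 * b / m\<^sup>2) / a * s T"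
      unfolding s_def by (rule contraction_weighted_sum[OF c m a b e rec[unfolded step]])
    finally show "(\<Sum>k=1..T. e k * s k) \<le> (E0 + 2 * (E0 + b / (a * m\<^sup>2 * c)) + 6 * b / m\<^sup>2) / a * s T" .
    have "(\<Sum>k=1..T. 1 / s k) \<le> (\<Sum>k\<le>T. 1 / s k)"
      using spos by (intro sum_mono2) (auto intro: less_imp_le)
    also have "\<dots> \<le> 3 * s T" unfolding s_def by (rule sum_inverse_sqrt_le[OF c])
    finally show "(\<Sum>k=1..T. 1 / s k) \<le> 3 * s T" .
  qed (use A B m n in auto)
  also have "\<dots> = regret_factor n m c a b E0 Dm A B * s T + real T * q"
    unfolding regret_factor_def by (simp add: algebra_simps)
  finally show ?thesis unfolding s_def .
qed

section \<open>Expected descent and the regret of one run\<close>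

context com_dszo_run
begin

lemma g_at_sum_moment:
  "integrable M (\<lambda>w. \<Sum>i\<in>UNIV. (norm (g_at (draw w) k i))\<^sup>2)"
  "(\<integral>w. (\<Sum>i\<in>UNIV. (norm (g_at (draw w) k i))\<^sup>2) \<partial>M) \<le> real CARD('n) * (real DIM('a) * L)\<^sup>2"
proof -
  have AE: "AE w in M. (norm (g_at (draw w) k i))\<^sup>2 \<le> (real DIM('a) * L)\<^sup>2" for i
    using norm_g_at_le[of k i] by eventually_elim (auto intro: power_mono)
  have int: "integrable M (\<lambda>w. (norm (g_at (draw w) k i))\<^sup>2)" for i
    by (rule integrable_const_bound[where B="(real DIM('a) * L)\<^sup>2"]) (use AE[of i] in auto)
  then show "integrable M (\<lambda>w. \<Sum>i\<in>UNIV. (norm (g_at (draw w) k i))\<^sup>2)"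
    by (intro Bochner_Integration.integrable_sum)
  have "(\<integral>w. (norm (g_at (draw w) k i))\<^sup>2 \<partial>M) \<le> (\<integral>w. (real DIM('a) * L)\<^sup>2 \<partial>M)" for i
    using int AE by (intro integral_mono_AE) auto
  then have "(\<Sum>i\<in>UNIV. \<integral>w. (norm (g_at (draw w) k i))\<^sup>2 \<partial>M) \<le> (\<Sum>i\<in>(UNIV :: 'n set). (real DIM('a) * L)\<^sup>2)"
    by (intro sum_mono) (simp add: prob_space)
  then show "(\<integral>w. (\<Sum>i\<in>UNIV. (norm (g_at (draw w) k i))\<^sup>2) \<partial>M) \<le> real CARD('n) * (real DIM('a) * L)\<^sup>2"
    using int by (subst Bochner_Integration.integral_sum) auto
qed

lemma global_obj_xbar_at_integrable: "integrable M (\<lambda>w. global_obj P F (xbar_at (draw w) k))"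
proof -
  have "integrable M (\<lambda>w. local_obj P F i (xbar_at (draw w) k))" for i
  proof (rule bounded_integrable)
    fix w
    have "\<bar>local_obj P F i (xbar_at (draw w) k) - local_obj P F i 0\<bar> \<le> L * norm (xbar_at (draw w) k - 0)"
      by (rule local_obj_lipschitz[OF xbar_at_in zero_in])
    also have "\<dots> \<le> L * R" using L_nonneg diameter(1)[OF xbar_at_in] by (intro mult_left_mono) auto
    finally show "\<bar>local_obj P F i (xbar_at (draw w) k)\<bar> \<le> \<bar>local_obj P F i 0\<bar> + L * R" by linarith
  qed measurable
  then show ?thesis unfolding global_obj_def by (intro integrable_mult_right Bochner_Integration.integrable_sum)
qed

lemma global_obj_sum: "(\<Sum>i\<in>UNIV. local_obj P F i x) = real CARD('n) * global_obj P F x"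
  by (simp add: global_obj_def)

text \<open>
  Passing from the iterates of the agents to their mean costs \<open>L\<close> times their distance.  By the
  inequality of the arithmetic and geometric mean, this is split into a squared distance, which is
  part of the error of the run, and a term of second order in the step size.
\<close>

lemma consensus_penalty:
  "2 * \<eta> k * (real CARD('n) * global_obj P F (xbar_at h k))
    \<le> 2 * \<eta> k * (\<Sum>i\<in>UNIV. local_obj P F i (x_at h k i)) + consensus_sq h k + real CARD('n) * L\<^sup>2 * (\<eta> k)\<^sup>2"
proof -
  have "2 * \<eta> k * local_obj P F i (xbar_at h k)
      \<le> 2 * \<eta> k * local_obj P F i (x_at h k i) + ((norm (x_at h k i - xbar_at h k))\<^sup>2 + L\<^sup>2 * (\<eta> k)\<^sup>2)" for i
  proof -
    have "local_obj P F i (xbar_at h k) \<le> local_obj P F i (x_at h k i) + L * norm (x_at h k i - xbar_at h k)"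
      using local_obj_lipschitz[OF x_at_in xbar_at_in, of i h k i h k] by linarith
    then have "2 * \<eta> k * local_obj P F i (xbar_at h k)
        \<le> 2 * \<eta> k * (local_obj P F i (x_at h k i) + L * norm (x_at h k i - xbar_at h k))"
      using \<eta>[of k] by (intro mult_left_mono) auto
    moreover have "2 * (L * \<eta> k) * norm (x_at h k i - xbar_at h k) \<le> (L * \<eta> k)\<^sup>2 + (norm (x_at h k i - xbar_at h k))\<^sup>2"
      by (rule sum_squares_bound)
    ultimately show ?thesis by (simp add: algebra_simps power_mult_distrib)
  qed
  then have "(\<Sum>i\<in>UNIV. 2 * \<eta> k * local_obj P F i (xbar_at h k))
      \<le> (\<Sum>i\<in>UNIV. 2 * \<eta> k * local_obj P F i (x_at h k i) + ((norm (x_at h k i - xbar_at h k))\<^sup>2 + L\<^sup>2 * (\<eta> k)\<^sup>2))"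
    by (intro sum_mono)
  also have "(\<Sum>i\<in>UNIV. 2 * \<eta> k * local_obj P F i (xbar_at h k)) = 2 * \<eta> k * (real CARD('n) * global_obj P F (xbar_at h k))"
    unfolding global_obj_sum[symmetric] sum_distrib_left ..
  also have "(\<Sum>i\<in>UNIV. 2 * \<eta> k * local_obj P F i (x_at h k i) + ((norm (x_at h k i - xbar_at h k))\<^sup>2 + L\<^sup>2 * (\<eta> k)\<^sup>2))
      = 2 * \<eta> k * (\<Sum>i\<in>UNIV. local_obj P F i (x_at h k i)) + (consensus_sq h k + real CARD('n) * (L\<^sup>2 * (\<eta> k)\<^sup>2))"
    unfolding sum.distrib sum_distrib_left consensus_sq_def by simp
  finally show ?thesis by (simp add: mult.assoc)
qed

text \<open>
  The arithmetic of the next proof, stated for numbers to keep the simplifier out of the integrals.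
\<close>

lemma descent_combine:
  fixes h :: real
  assumes "d' \<le> dk - 2 * h * G + A * e + 2 * h\<^sup>2 * (n * g)"
    and "2 * h * (S - n * fy - n * (2 * l * mu)) \<le> 2 * h * G"
    and "2 * h * (n * Fm) \<le> 2 * h * S + e + n * l\<^sup>2 * h\<^sup>2"
    and "2 * h * (n * fy) \<le> 2 * h * (n * (fx + l * eR))"
  shows "2 * h * n * (Fm - fx - l * (eR + 2 * mu)) \<le> dk - d' + (A + 1) * e + n * (2 * g + l\<^sup>2) * h\<^sup>2"
  using assms by (simp add: algebra_simps)

text \<open>
  The comparison point is the optimum shrunk into the feasible set of the projection; \<open>L * (\<epsilon> * R)\<close> is
  the price for shrinking and \<open>2 * L * \<mu>\<close> the bias of the gradient estimator.
\<close>

lemma expected_descent: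
  assumes xs: "xs \<in> \<Omega>"
  defines "y \<equiv> (1 - \<epsilon>) *\<^sub>R xs"
  defines "d \<equiv> \<lambda>k. \<integral>w. (\<Sum>i\<in>UNIV. (norm (x_at (draw w) k i - y))\<^sup>2) \<partial>M"
  shows "2 * \<eta> k * real CARD('n) * ((\<integral>w. global_obj P F (xbar_at (draw w) k) - global_obj P F xs \<partial>M) - L * (\<epsilon> * R + 2 * \<mu>))
    \<le> d k - d (Suc k) + (3 * \<gamma> * K + 4 * \<gamma>\<^sup>2 * K\<^sup>2 + 1) * run_error M (\<lambda>w. path (draw w)) k
      + real CARD('n) * (2 * (real DIM('a) * L)\<^sup>2 + L\<^sup>2) * (\<eta> k)\<^sup>2"
proof -
  let ?n = "real CARD('n)" and ?f = "global_obj P F"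
  let ?A = "3 * \<gamma> * K + 4 * \<gamma>\<^sup>2 * K\<^sup>2" and ?e = "run_error M (\<lambda>w. path (draw w)) k"
  have y: "y \<in> shrink \<epsilon> \<Omega>" using xs by (auto simp: y_def shrink_def)
  then have y\<Omega>: "y \<in> \<Omega>" using shrink_subset by auto
  have int_d: "integrable M (\<lambda>w. \<Sum>i\<in>UNIV. (norm (x_at (draw w) k i - y))\<^sup>2)" for k
    using x_at_power2_integrable[OF y\<Omega>] by (intro Bochner_Integration.integrable_sum)
  have int_g: "integrable M (\<lambda>w. \<Sum>i\<in>UNIV. g_at (draw w) k i \<bullet> (x_at (draw w) k i - y))"
    using g_at_inner_integrable[OF y\<Omega>] by (intro Bochner_Integration.integrable_sum)
  have int_e: "integrable M (\<lambda>w. consensus_sq (draw w) k + compression_sq (draw w) k)"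
    using consensus_sq_integrable compression_sq_integrable by auto
  have int_f: "integrable M (\<lambda>w. \<Sum>i\<in>UNIV. local_obj P F i (x_at (draw w) k i))"
    using local_obj_x_at_integrable by (intro Bochner_Integration.integrable_sum)
  have A: "0 \<le> ?A" using \<gamma> K by simp
  have "d (Suc k) \<le> (\<integral>w. (\<Sum>i\<in>UNIV. (norm (x_at (draw w) k i - y))\<^sup>2)
      - 2 * \<eta> k * (\<Sum>i\<in>UNIV. g_at (draw w) k i \<bullet> (x_at (draw w) k i - y))
      + ?A * (consensus_sq (draw w) k + compression_sq (draw w) k)
      + 2 * (\<eta> k)\<^sup>2 * (\<Sum>i\<in>UNIV. (norm (g_at (draw w) k i))\<^sup>2) \<partial>M)"
    unfolding d_def using int_d int_g int_e g_at_sum_moment(1) descent_pointwise[OF y]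
    by (intro integral_mono) auto
  also have "\<dots> = d k - 2 * \<eta> k * (\<integral>w. (\<Sum>i\<in>UNIV. g_at (draw w) k i \<bullet> (x_at (draw w) k i - y)) \<partial>M)
      + ?A * ?e + 2 * (\<eta> k)\<^sup>2 * (\<integral>w. (\<Sum>i\<in>UNIV. (norm (g_at (draw w) k i))\<^sup>2) \<partial>M)"
    unfolding d_def run_error_eq using int_d int_g int_e g_at_sum_moment(1) by simp
  also have "\<dots> \<le> d k - 2 * \<eta> k * (\<integral>w. (\<Sum>i\<in>UNIV. g_at (draw w) k i \<bullet> (x_at (draw w) k i - y)) \<partial>M)
      + ?A * ?e + 2 * (\<eta> k)\<^sup>2 * (?n * (real DIM('a) * L)\<^sup>2)"
    using g_at_sum_moment(2) by (intro add_left_mono mult_left_mono) auto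
  finally have 1: "d (Suc k) \<le> d k - 2 * \<eta> k * (\<integral>w. (\<Sum>i\<in>UNIV. g_at (draw w) k i \<bullet> (x_at (draw w) k i - y)) \<partial>M)
      + ?A * ?e + 2 * (\<eta> k)\<^sup>2 * (?n * (real DIM('a) * L)\<^sup>2)" .
  have "(\<integral>w. (\<Sum>i\<in>UNIV. local_obj P F i (x_at (draw w) k i)) \<partial>M) - ?n * ?f y - ?n * (2 * L * \<mu>)
      = (\<Sum>i\<in>UNIV. (\<integral>w. local_obj P F i (x_at (draw w) k i) \<partial>M) - local_obj P F i y - 2 * L * \<mu>)"
    using local_obj_x_at_integrable
    by (subst Bochner_Integration.integral_sum) (auto simp: sum_subtractf global_obj_sum)
  also have "\<dots> \<le> (\<Sum>i\<in>UNIV. (\<integral>w. g_at (draw w) k i \<bullet> (x_at (draw w) k i - y) \<partial>M))"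
    by (intro sum_mono g_at_inner_mean y\<Omega>)
  also have "\<dots> = (\<integral>w. (\<Sum>i\<in>UNIV. g_at (draw w) k i \<bullet> (x_at (draw w) k i - y)) \<partial>M)"
    using g_at_inner_integrable[OF y\<Omega>] by (subst Bochner_Integration.integral_sum) auto
  finally have "2 * \<eta> k * ((\<integral>w. (\<Sum>i\<in>UNIV. local_obj P F i (x_at (draw w) k i)) \<partial>M) - ?n * ?f y - ?n * (2 * L * \<mu>))
      \<le> 2 * \<eta> k * (\<integral>w. (\<Sum>i\<in>UNIV. g_at (draw w) k i \<bullet> (x_at (draw w) k i - y)) \<partial>M)"
    using \<eta>[of k] by (intro mult_left_mono) auto
  note 2 = this
  have "2 * \<eta> k * (?n * (\<integral>w. ?f (xbar_at (draw w) k) \<partial>M)) = (\<integral>w. 2 * \<eta> k * (?n * ?f (xbar_at (draw w) k)) \<partial>M)"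
    by simp
  also have "\<dots> \<le> (\<integral>w. 2 * \<eta> k * (\<Sum>i\<in>UNIV. local_obj P F i (x_at (draw w) k i)) + consensus_sq (draw w) k + ?n * L\<^sup>2 * (\<eta> k)\<^sup>2 \<partial>M)"
    using global_obj_xbar_at_integrable int_f consensus_sq_integrable consensus_penalty
    by (intro integral_mono) auto
  also have "\<dots> = 2 * \<eta> k * (\<integral>w. (\<Sum>i\<in>UNIV. local_obj P F i (x_at (draw w) k i)) \<partial>M) + (\<integral>w. consensus_sq (draw w) k \<partial>M) + ?n * L\<^sup>2 * (\<eta> k)\<^sup>2"
    using int_f consensus_sq_integrable by (simp add: prob_space)
  also have "(\<integral>w. consensus_sq (draw w) k \<partial>M) \<le> ?e"
    unfolding run_error_eq using consensus_sq_integrable int_e compression_sq_nonneg by (intro integral_mono) auto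
  finally have 3: "2 * \<eta> k * (?n * (\<integral>w. ?f (xbar_at (draw w) k) \<partial>M))
      \<le> 2 * \<eta> k * (\<integral>w. (\<Sum>i\<in>UNIV. local_obj P F i (x_at (draw w) k i)) \<partial>M) + ?e + ?n * L\<^sup>2 * (\<eta> k)\<^sup>2"
    by simp
  have "?n * ?f y \<le> ?n * (?f xs + L * (\<epsilon> * R))"
  proof -
    have "local_obj P F i y \<le> local_obj P F i xs + L * (\<epsilon> * R)" for i
    proof -
      have "y - xs = - (\<epsilon> *\<^sub>R xs)" by (simp add: y_def algebra_simps)
      then have "norm (y - xs) \<le> \<epsilon> * R"
        using \<epsilon> diameter(1)[OF xs] by (simp add: mult_left_mono)
      then have "L * norm (y - xs) \<le> L * (\<epsilon> * R)" using L_nonneg by (intro mult_left_mono)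
      then show ?thesis using local_obj_lipschitz[OF y\<Omega> xs, of i] by linarith
    qed
    then have "(\<Sum>i\<in>UNIV. local_obj P F i y) \<le> (\<Sum>i\<in>UNIV. local_obj P F i xs + L * (\<epsilon> * R))"
      by (intro sum_mono)
    then show ?thesis by (simp add: sum.distrib global_obj_sum algebra_simps)
  qed
  then have 4: "2 * \<eta> k * (?n * ?f y) \<le> 2 * \<eta> k * (?n * (?f xs + L * (\<epsilon> * R)))"
    using \<eta>[of k] by (intro mult_left_mono) auto
  have 5: "(\<integral>w. ?f (xbar_at (draw w) k) - ?f xs \<partial>M) = (\<integral>w. ?f (xbar_at (draw w) k) \<partial>M) - ?f xs"
    using global_obj_xbar_at_integrable by (simp add: prob_space)
  show ?thesis unfolding 5 by (rule descent_combine[OF 1 2 3 4])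
qed

lemma contraction_recursion:
  assumes "contraction_factor M F \<eta> \<mu> C3 \<xi> u (\<lambda>w. path (draw w)) \<kappa>"
    and \<kappa>: "\<kappa> \<le> 1 - a" and C3: "C3 \<le> C3'" "0 \<le> C3'"
  shows "run_error M (\<lambda>w. path (draw w)) (Suc k)
    \<le> (1 - a) * run_error M (\<lambda>w. path (draw w)) k + C3' * (real CARD('n) * (real DIM('a) * L)\<^sup>2) * (\<eta> k)\<^sup>2"
proof -
  let ?e = "run_error M (\<lambda>w. path (draw w))" and ?g = "\<integral>w. (\<Sum>i\<in>UNIV. (norm (g_at (draw w) k i))\<^sup>2) \<partial>M"
  have G: "(\<integral>w. (norm (G_mat F \<mu> (st_x (path (draw w) k)) (\<lambda>i. \<xi> i k w) (\<lambda>i. u i k w)))\<^sup>2 \<partial>M) = ?g"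
    unfolding norm_vec_power2 G_mat_def g_at_def x_at_def by (simp add: draw_def)
  have "?e (Suc k) \<le> \<kappa> * ?e k + C3 * (\<eta> k)\<^sup>2 * ?g"
    using assms(1)[unfolded contraction_factor_def, THEN spec, of k] unfolding G .
  also have "\<kappa> * ?e k \<le> (1 - a) * ?e k"
    using \<kappa> run_error_nonneg by (intro mult_right_mono)
  also have "C3 * (\<eta> k)\<^sup>2 * ?g \<le> C3' * (\<eta> k)\<^sup>2 * ?g"
    using C3 by (intro mult_right_mono Bochner_Integration.integral_nonneg sum_nonneg) auto
  also have "\<dots> \<le> C3' * (\<eta> k)\<^sup>2 * (real CARD('n) * (real DIM('a) * L)\<^sup>2)"
    using C3 g_at_sum_moment(2) by (intro mult_left_mono) auto
  finally show ?thesis by (simp add: algebra_simps)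
qed

lemma regret_bound:
  assumes xs: "xs \<in> \<Omega>" and c: "1 \<le> c" and m: "0 < m"
    and step: "\<And>k. \<eta> k = 1 / (m * sqrt (real k + c))"
    and contr: "contraction_factor M F \<eta> \<mu> C3 \<xi> u (\<lambda>w. path (draw w)) \<kappa>"
    and \<kappa>: "\<kappa> \<le> 1 - a" and a: "0 < a" "a \<le> 1" and C3: "C3 \<le> C3'" "0 \<le> C3'"
  shows "regret_sum M (global_obj P F) (\<lambda>w. path (draw w)) xs T
    \<le> regret_factor (real CARD('n)) m c a (C3' * (real CARD('n) * (real DIM('a) * L)\<^sup>2))
         (8 * real CARD('n) * R\<^sup>2) (real CARD('n) * (2 * R)\<^sup>2) (3 * \<gamma> * K + 4 * \<gamma>\<^sup>2 * K\<^sup>2 + 1)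
         (real CARD('n) * (2 * (real DIM('a) * L)\<^sup>2 + L\<^sup>2)) * sqrt (real T + c)
      + real T * (L * (\<epsilon> * R + 2 * \<mu>))"
proof -
  define y where "y = (1 - \<epsilon>) *\<^sub>R xs"
  have y: "y \<in> \<Omega>" using xs shrink_subset by (auto simp: y_def shrink_def)
  let ?d = "\<lambda>k. \<integral>w. (\<Sum>i\<in>UNIV. (norm (x_at (draw w) k i - y))\<^sup>2) \<partial>M"
  have d0: "0 \<le> ?d k" for k
    by (intro Bochner_Integration.integral_nonneg sum_nonneg) auto
  have d1: "?d k \<le> real CARD('n) * (2 * R)\<^sup>2" for k
  proof -
    have "?d k \<le> (\<integral>w. (\<Sum>i\<in>(UNIV :: 'n set). (2 * R)\<^sup>2) \<partial>M)"
      using x_at_power2_integrable[OF y] x_at_power2_le[OF y]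
      by (intro integral_mono Bochner_Integration.integrable_sum sum_mono) auto
    then show ?thesis by (simp add: prob_space)
  qed
  show ?thesis
    unfolding regret_sum_def xbar_at_def[symmetric]
  proof (rule descent_regret_sum[where d="?d" and e="run_error M (\<lambda>w. path (draw w))"])
    show "run_error M (\<lambda>w. path (draw w)) (Suc k) \<le> (1 - a) * run_error M (\<lambda>w. path (draw w)) k
        + C3' * (real CARD('n) * (real DIM('a) * L)\<^sup>2) * (\<eta> k)\<^sup>2" for k
      by (rule contraction_recursion[OF contr \<kappa> C3])
    show "2 * \<eta> k * real CARD('n)
        * ((\<integral>w. global_obj P F (xbar_at (draw w) k) - global_obj P F xs \<partial>M) - L * (\<epsilon> * R + 2 * \<mu>))
      \<le> ?d k - ?d (Suc k) + (3 * \<gamma> * K + 4 * \<gamma>\<^sup>2 * K\<^sup>2 + 1) * run_error M (\<lambda>w. path (draw w)) k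
        + real CARD('n) * (2 * (real DIM('a) * L)\<^sup>2 + L\<^sup>2) * (\<eta> k)\<^sup>2" for k
      unfolding y_def by (rule expected_descent[OF xs])
  qed (rule c m a step run_error_nonneg run_error_0_le d0 d1 | use C3 \<gamma> K in simp)+
qed

end

section \<open>The regret of Com-DSZO\<close>

text \<open>
  A bound that involves the compressor only through the lower bound \<open>a\<close>, as needed for a rate
  that is uniform over a sequence of compressors.
\<close>

lemma C3_const_le:
  assumes gap: "0 < spectral_gap W" and \<gamma>: "0 < \<gamma>"
    and \<psi>: "0 \<le> \<psi> * r" "\<psi> * r \<le> 1" and \<omega>: "0 \<le> \<omega>" "\<omega> \<le> 1"
    and a: "0 < a" "a \<le> c0_const \<psi> r \<omega>"
  shows "C3_const W \<gamma> \<psi> r \<omega>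
    \<le> 4 * (1 + \<gamma> * spectral_gap W / 2) * (1 + 2 / (\<gamma> * spectral_gap W)) + 4 * (1 + inverse a)"
proof -
  let ?c0 = "c0_const \<psi> r \<omega>"
  have p: "0 \<le> \<psi> * r * \<omega>" "\<psi> * r * \<omega> \<le> 1"
    using \<psi> \<omega> by (auto intro: mult_le_one)
  then have c0: "0 < ?c0" "?c0 \<le> 1" using a by (auto simp: c0_const_def)
  have "2 * (1 + inverse ?c0) * (1 + ?c0) * (1 - \<psi> * r * \<omega>) \<le> 2 * (1 + inverse a) * 2 * 1"
    using c0 a p by (intro mult_mono add_left_mono le_imp_inverse_le mult_nonneg_nonneg) auto
  also have "\<dots> = 4 * (1 + inverse a)" by simp
  finally show ?thesis unfolding C3_const_def Let_def by (rule add_left_mono)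
qed

theorem corollary1:
  fixes N :: "'n::finite \<Rightarrow> 'n set" and W :: "real ^ 'n ^ 'n"
    and \<Omega> :: "'a::euclidean_space set" and R_low R_up :: real
    and P :: "'n \<Rightarrow> 's measure" and F :: "'n \<Rightarrow> 'a \<Rightarrow> 's \<Rightarrow> real"
    and L_f \<sigma> L_m :: real
    and M :: "'w measure" and Q :: "'z measure"
    and \<xi> :: "'n \<Rightarrow> nat \<Rightarrow> 'w \<Rightarrow> 's" and u :: "'n \<Rightarrow> nat \<Rightarrow> 'w \<Rightarrow> 'a" and \<zeta> :: "'n \<Rightarrow> nat \<Rightarrow> 'w \<Rightarrow> 'z"
    and c \<gamma> :: real and X0 :: "nat \<Rightarrow> 'a ^ 'n" and xs :: 'a
    and \<eta> :: "nat \<Rightarrow> real" and \<mu> \<epsilon> :: "nat \<Rightarrow> real"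
    and run :: "('z \<Rightarrow> 'a \<Rightarrow> 'a) \<Rightarrow> real \<Rightarrow> nat \<Rightarrow> 'w \<Rightarrow> nat \<Rightarrow> ('a, 'n) dszo_state"
    and admissible :: "('z \<Rightarrow> 'a \<Rightarrow> 'a) \<Rightarrow> real \<Rightarrow> real \<Rightarrow> real \<Rightarrow> bool"
    and regret :: "('z \<Rightarrow> 'a \<Rightarrow> 'a) \<Rightarrow> real \<Rightarrow> nat \<Rightarrow> real"
  assumes obj: "stochastic_objective P F \<Omega>"
    and A1: "assumption_A1 N W"
    and A2: "assumption_A2 \<Omega> R_low R_up"
    and A3: "assumption_A3 P F \<Omega> L_f"
    and A4: "assumption_A4 P F \<Omega> \<sigma>"
    and A6: "assumption_A6 P F \<Omega> L_m" and L_m: "L_m > 0"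
    and draws: "fresh_draws M P Q \<xi> u \<zeta>"
    and X0: "\<And>T i. X0 T $ i \<in> \<Omega>"
    and c: "c > 4"
    and xs: "optimal_point \<Omega> (global_obj P F) xs"
    and \<eta>: "\<And>k. \<eta> k = 1 / (M1_const CARD('n) DIM('a) L_m * sqrt (real k + c))"
    and \<mu>: "\<And>T. \<mu> T = 1 / sqrt (real T)"
    and \<epsilon>: "\<And>T. \<epsilon> T = \<mu> T / (2 * R_low)"
    and run: "\<And>C \<psi> T w. run C \<psi> T w =
        com_dszo N W \<Omega> F C \<eta> (\<mu> T) (\<epsilon> T) \<psi> \<gamma> (X0 T)
          (\<lambda>i k. \<xi> i k w) (\<lambda>i k. u i k w) (\<lambda>i k. \<zeta> i k w)"
    and admissible: "\<And>C r \<omega> \<psi>. admissible C r \<omega> \<psi> \<longleftrightarrow>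
        assumption_A5 Q C r \<omega> \<and> step_params_ok W \<gamma> \<psi> r \<omega> \<and>
        (\<forall>T\<ge>1. contraction_factor M F \<eta> (\<mu> T) (C3_const W \<gamma> \<psi> r \<omega>) \<xi> u (run C \<psi> T)
                  (1 - c0_const \<psi> r \<omega>))"
    and regret: "\<And>C \<psi> T. regret C \<psi> T = regret_sum M (global_obj P F) (run C \<psi> T) xs T"
  shows "(\<forall>C r \<omega> \<psi>. admissible C r \<omega> \<psi> \<longrightarrow>
            is_bigO (regret C \<psi>)
              (\<lambda>T. (real DIM('a))\<^sup>2 * sqrt (real T + c) / (\<psi> * r * \<omega>)\<^sup>2))
       \<and> (\<forall>C r \<omega> \<psi>. (\<forall>m::nat. admissible (C m) (r m) (\<omega> m) (\<psi> m)) \<longrightarrow>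
            \<omega> \<longlonglongrightarrow> 1 \<longrightarrow> (\<lambda>m. \<psi> m * r m) \<longlonglongrightarrow> 1 \<longrightarrow>
            limsup (\<lambda>m. limsup (\<lambda>T. ereal (regret (C m) (\<psi> m) T / sqrt (real T + c)))) < \<infinity>)"
proof -
  from A2 have cl: "closed \<Omega>" and cv: "convex \<Omega>" and Rl: "R_low > 0" and ball: "cball 0 R_low \<subseteq> \<Omega>"
    and sub: "\<Omega> \<subseteq> cball 0 R_up"
    by (auto simp: assumption_A2_def)
  have zero: "0 \<in> \<Omega>" using ball Rl by auto
  have Ru: "0 \<le> R_up" using sub zero by auto
  have cp: "compact \<Omega>"
    using cl bounded_subset[OF bounded_cball sub] by (simp add: compact_eq_bounded_closed)
  obtain D where Lf: "L_f > 0" and D: "open D" "\<Omega> \<subseteq> D"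
    and F: "\<And>i s. s \<in> space (P i) \<Longrightarrow> convex_on D (\<lambda>x. F i x s)"
           "\<And>i s. s \<in> space (P i) \<Longrightarrow> L_f-lipschitz_on D (\<lambda>x. F i x s)"
    using A3 unfolding assumption_A3_def by blast
  obtain \<delta> where \<delta>: "\<delta> > 0" "(\<Union>x\<in>\<Omega>. ball x \<delta>) \<subseteq> D"
    using compact_subset_open_imp_ball_epsilon_subset[OF cp D] by auto
  obtain K where K: "K \<ge> 0" "\<And>Z :: 'a ^ 'n. norm (Z - matrix_action W Z) \<le> K * norm Z"
    using matrix_action_defect_bound[where 'a='a, of W] by blast
  from A1 have W: "\<And>i j. j \<notin> N i \<Longrightarrow> W $ i $ j = 0" "\<And>i. (\<Sum>j\<in>UNIV. W $ i $ j) = 1"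
      "\<And>j. (\<Sum>i\<in>UNIV. W $ i $ j) = 1" and gap: "0 < spectral_gap W"
    by (auto simp: assumption_A1_def)
  define m where "m = M1_const CARD('n) DIM('a) L_m"
  have m: "m > 0" using L_m by (auto simp: m_def M1_const_def intro!: mult_pos_pos add_pos_nonneg)
  have \<mu>0: "\<mu> \<longlonglongrightarrow> 0"
    unfolding \<mu> by (rule tendsto_divide_0[OF tendsto_const])
      (intro filterlim_at_top_imp_at_infinity filterlim_compose[OF sqrt_at_top filterlim_real_sequentially])
  have "\<forall>\<^sub>F T in sequentially. \<mu> T < \<delta> \<and> \<mu> T < 2 * R_low \<and> T \<ge> 1"
    using order_tendstoD(2)[OF \<mu>0 \<delta>(1)] order_tendstoD(2)[OF \<mu>0, of "2 * R_low"] Rl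
    by (intro eventually_conj eventually_ge_at_top) auto
  then obtain T0 where T0: "\<And>T. T \<ge> T0 \<Longrightarrow> \<mu> T < \<delta> \<and> \<mu> T < 2 * R_low \<and> T \<ge> 1"
    by (auto simp: eventually_sequentially)
  define q where "q = L_f * (R_up / (2 * R_low) + 2)"
  have q: "0 \<le> q" using Lf Ru Rl by (simp add: q_def)
  define C3' where "C3' a = 4 * (1 + \<gamma> * spectral_gap W / 2) * (1 + 2 / (\<gamma> * spectral_gap W)) + 4 * (1 + inverse a)" for a
  define B where "B a = regret_factor (real CARD('n)) m c a (C3' a * (real CARD('n) * (real DIM('a) * L_f)\<^sup>2))
         (8 * real CARD('n) * R_up\<^sup>2) (real CARD('n) * (2 * R_up)\<^sup>2) (3 * \<gamma> * K + 4 * \<gamma>\<^sup>2 * K\<^sup>2 + 1)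
         (real CARD('n) * (2 * (real DIM('a) * L_f)\<^sup>2 + L_f\<^sup>2)) + q" for a
  \<comment> \<open>a rate whose constant depends on the compressor only through \<open>a\<close>, which serves both claims: the first
    with \<open>a\<close> the contraction gain itself, the second with \<open>a = 1 / 4\<close>, as the gain tends to \<open>1 / 2\<close>\<close>
  have uniform: "regret C \<psi> T \<le> B a * sqrt (real T + c)"
    if adm: "admissible C r \<omega> \<psi>" and a: "0 < a" "a \<le> c0_const \<psi> r \<omega>" and T: "T \<ge> T0" for C r \<omega> \<psi> a T
  proof -
    from adm have A5: "assumption_A5 Q C r \<omega>" and sp: "step_params_ok W \<gamma> \<psi> r \<omega>"
      and contr: "contraction_factor M F \<eta> (\<mu> T) (C3_const W \<gamma> \<psi> r \<omega>) \<xi> u (run C \<psi> T) (1 - c0_const \<psi> r \<omega>)"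
      using T0[OF T] unfolding admissible by auto
    from A5 have r: "1 \<le> r" "0 < \<omega>" "\<omega> \<le> 1" by (auto simp: assumption_A5_def)
    from sp have ps: "0 < \<psi>" "\<psi> \<le> inverse r" and g: "0 < \<gamma>"
      by (auto simp: step_params_ok_def Let_def)
    have pr: "0 \<le> \<psi> * r" "\<psi> * r \<le> 1"
      using ps r mult_right_mono[OF ps(2), of r] by auto
    have \<mu>T: "0 < \<mu> T" "\<mu> T < \<delta>" "\<mu> T < 2 * R_low" and T1: "T \<ge> 1" using T0[OF T] by (auto simp: \<mu>)
    have "\<psi> * r * \<omega> \<le> 1" using mult_le_one[OF pr(2), of \<omega>] r by simp
    then have a1: "a \<le> 1" using a by (simp add: c0_const_def)
    have C3': "C3_const W \<gamma> \<psi> r \<omega> \<le> C3' a" "0 \<le> C3' a"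
      using C3_const_le[OF gap g pr _ r(3) a] r gap g a by (auto simp: C3'_def)
    have c1: "1 \<le> c" using c by simp
    interpret R: com_dszo_run N W \<Omega> D P F M Q C \<xi> u \<zeta> \<eta> "\<mu> T" "\<epsilon> T" \<psi> \<gamma> r \<omega> L_f R_up \<delta> K "X0 T"
    proof unfold_locales
      show "0 \<le> \<eta> k" for k using m c by (simp add: \<eta> m_def[symmetric])
      show "0 \<le> \<epsilon> T" "\<epsilon> T \<le> 1" using \<mu>T Rl by (auto simp: \<epsilon>)
      show "ball x \<delta> \<subseteq> D" if "x \<in> \<Omega>" for x using \<delta>(2) that by auto
    qed (use cl cv zero sub X0 \<mu>T F Lf obj draws A5 ps pr g W K in auto)
    have run': "run C \<psi> T = (\<lambda>w. R.path (R.draw w))"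
      by (rule ext) (simp add: run R.path_def R.draw_def)
    have xs\<Omega>: "xs \<in> \<Omega>" using xs by (simp add: optimal_point_def)
    have step: "\<eta> k = 1 / (m * sqrt (real k + c))" for k by (simp add: \<eta> m_def)
    have "regret C \<psi> T \<le> (B a - q) * sqrt (real T + c) + real T * (L_f * (\<epsilon> T * R_up + 2 * \<mu> T))"
      unfolding regret run' B_def
      using R.regret_bound[OF xs\<Omega> c1 m step contr[unfolded run'] _ a(1) a1 C3', of T] a(2) by simp
    also have "real T * (L_f * (\<epsilon> T * R_up + 2 * \<mu> T)) = q * (real T * \<mu> T)"
      by (simp add: q_def \<epsilon> algebra_simps)
    \<comment> \<open>the choice \<open>\<mu> = 1 / sqrt T\<close> balances the bias against the remaining terms\<close>
    also have "real T * \<mu> T = sqrt (real T)"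
      by (simp add: \<mu> real_div_sqrt)
    also have "q * sqrt (real T) \<le> q * sqrt (real T + c)"
      using q c by (intro mult_left_mono) auto
    finally show ?thesis by (simp add: algebra_simps)
  qed
  have ratio: "limsup (\<lambda>T. ereal (regret C \<psi> T / (s * sqrt (real T + c)))) \<le> ereal (B a / s)"
    if adm: "admissible C r \<omega> \<psi>" and a: "0 < a" "a \<le> c0_const \<psi> r \<omega>" and s: "s > 0" for C r \<omega> \<psi> a s
  proof (rule Limsup_bounded)
    show "\<forall>\<^sub>F T in sequentially. ereal (regret C \<psi> T / (s * sqrt (real T + c))) \<le> ereal (B a / s)"
      using eventually_ge_at_top[of T0]
    proof eventually_elim
      case (elim T)
      have "0 < sqrt (real T + c)" using c by simp
      then show ?case using uniform[OF adm a elim] s by (simp add: field_simps)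
    qed
  qed
  show ?thesis
  proof (intro conjI allI impI)
    fix C r \<omega> \<psi> assume adm: "admissible C r \<omega> \<psi>"
    let ?p = "\<psi> * r * \<omega>" and ?d = "real DIM('a)"
    have p: "?p > 0"
      using adm unfolding admissible assumption_A5_def step_params_ok_def Let_def by auto
    have "limsup (\<lambda>T. ereal (regret C \<psi> T / (?d\<^sup>2 / ?p\<^sup>2 * sqrt (real T + c)))) \<le> ereal (B (c0_const \<psi> r \<omega>) / (?d\<^sup>2 / ?p\<^sup>2))"
    proof (rule ratio[OF adm])
      show "0 < c0_const \<psi> r \<omega>" using p by (simp add: c0_const_def)
      show "0 < ?d\<^sup>2 / ?p\<^sup>2" by (intro divide_pos_pos zero_less_power p) simp
    qed simp
    also have "\<dots> < \<infinity>" by simp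
    finally show "is_bigO (regret C \<psi>) (\<lambda>T. ?d\<^sup>2 * sqrt (real T + c) / ?p\<^sup>2)"
      unfolding is_bigO_def by (simp only: times_divide_eq_left)
  next
    fix C r \<omega> \<psi>
    assume adm: "\<forall>k::nat. admissible (C k) (r k) (\<omega> k) (\<psi> k)"
      and \<omega>1: "\<omega> \<longlonglongrightarrow> 1" and p1: "(\<lambda>k. \<psi> k * r k) \<longlonglongrightarrow> 1"
    have "(\<lambda>k. c0_const (\<psi> k) (r k) (\<omega> k)) \<longlonglongrightarrow> 1 * 1 / 2"
      unfolding c0_const_def by (intro tendsto_divide tendsto_mult p1 \<omega>1 tendsto_const) simp
    then have ev: "\<forall>\<^sub>F k in sequentially. c0_const (\<psi> k) (r k) (\<omega> k) > 1 / 4"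
      by (rule order_tendstoD(1)) simp
    have "limsup (\<lambda>k. limsup (\<lambda>T. ereal (regret (C k) (\<psi> k) T / sqrt (real T + c)))) \<le> ereal (B (1 / 4))"
    proof (rule Limsup_bounded)
      show "\<forall>\<^sub>F k in sequentially. limsup (\<lambda>T. ereal (regret (C k) (\<psi> k) T / sqrt (real T + c))) \<le> ereal (B (1 / 4))"
        using ev
      proof eventually_elim
        case (elim k)
        then show ?case
          using ratio[OF adm[rule_format, of k], of "1 / 4" 1] by simp
      qed
    qed
    also have "\<dots> < \<infinity>" by simp
    finally show "limsup (\<lambda>k. limsup (\<lambda>T. ereal (regret (C k) (\<psi> k) T / sqrt (real T + c)))) < \<infinity>" .
  qed
qed

end
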